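(* Assume (G1), (G2$^+$), (SP1) and (SP2). Then as $n\to\infty$, $$\mathbb E[(\hat\rho^*-\rho)^2]\le C\,\frac{\mathrm{Var}(U_n(\rho))}{(\mathbb E[Q_n(a)])^2}\le C\,r_n(\theta),$$ for a constant $C>0$, where $r_n(\theta)\to0$. If in addition the MDH condition holds, then $r_n(\theta)\le \frac{C}{n^2e^\gamma}\max\{1,e^{-(\gamma+\rho)}\}\to0$.
   Context: Asymptotic framework: $n\to\infty$ and all parameters may depend on $n$; $a_n\asymp b_n$ means $c_0\le a_n/b_n\le c_1$ for constants $c_1>c_0>0$ and all large $n$. $(x,y)$ is the inner product, $\|x\|_q$ the $\ell^q$ norm, $x_{\max}$ the largest entry. The $p_1$ model: a directed network on nodes $\{1,\dots,n\}$ has adjacency matrix $A\in\{0,1\}^{n\times n}$ with $A_{ii}=0$. The pairs $(A_{ij},A_{ji})$, $1\le i<j\le n$, are independent, and for parameters $\theta=(\rho,\gamma,\alpha_1,\beta_1,\dots,\alpha_n,\beta_n)$ with $\sum_i\alpha_i=\sum_i\beta_i=0$, for $a,b\in\{0,1\}$, $i\ne j$: $\mathbb P(A_{ij}=a,A_{ji}=b)=K_{ij}\exp(a(\gamma+\alpha_i+\beta_j)+b(\gamma+\alpha_j+\beta_i)+ab\rho)$, $K_{ij}=[1+e^{\gamma+\alpha_i+\beta_j}+e^{\gamma+\alpha_j+\beta_i}+e^{2\gamma+\alpha_i+\beta_j+\alpha_j+\beta_i+\rho}]^{-1}$. Let $\mu_i=e^{\gamma/2+\alpha_i}$, $\nu_i=e^{\gamma/2+\beta_i}$,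 $\eta_i=\mu_i\nu_i$. Let $\tilde J_n$ be the all-ones matrix minus identity, $\circ$ entrywise product; $A^{11}=A\circ A'$, $A^{00}=(\tilde J_n-A)\circ(\tilde J_n-A')$, $A^{10}=A\circ(\tilde J_n-A')$, $A^{01}=(A^{10})'$. Statistics: $Q_n(a)=\sum_{i,j,k,\ell\,(\mathrm{dist})}A^{11}_{ij}A^{00}_{jk}A^{01}_{k\ell}A^{00}_{\ell i}$, $Q_n(b)=\sum_{i,j,k,\ell\,(\mathrm{dist})}A^{10}_{ij}A^{10}_{jk}A^{00}_{k\ell}A^{10}_{\ell i}$ (sums over distinct indices); $U_n(\rho)=Q_n(a)-e^\rho Q_n(b)$. With $H(x;t)=x$ if $|x|\le t$ and $H(x;t)=\mathrm{sign}(x)\,t$ otherwise, the LCR estimator is $\hat\rho^*=H(\hat\rho;2\log n)$, $\hat\rho=\log(Q_n(a)/Q_n(b))$. $r_n(\theta)=\max\{1/(e^\rho\|\eta\|_1^2),\,(\mu,\eta)(\nu,\eta)/\|\eta\|_1^4\}$; $\tilde\rho=\log(\|\eta\|_1^2/[(\mu,\eta)(\nu,\eta)])$. Conditions: (G1) $\mu_{\max}\to0$, $\nu_{\max}\to0$, $e^{\rho/2}\eta_{\max}\to0$. (G2$^+$) $\|\eta\|_1/\log^2(n)\to\infty$ and $e^{\rho/2}\|\eta\|_1/\sqrt{\log n}\to\infty$. (SP1) $\mu_{\max}^2\nu_{\max}^2/[(\mu,\eta)(\nu,\eta)]\to0$. Case (L): $e^\rho\ge Ce^{\tilde\rho}$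 for a constant $C>0$. (SP2) In Case (L) (and only there), $\|\mu\|_1\asymp\|\nu\|_1$. MDH condition: $\max_i\max\{|\alpha_i|,|\beta_i|\}\le c_0$ for a constant $c_0>0$. *)

theory Defs
  imports Complex_Main
begin

text \<open>Nodes are indexed 0..n-1. A directed network is a relation
  A :: nat => nat => bool (A i j means an edge i -> j) without loops and
  supported on the node set.\<close>

type_synonym adjm = "nat \<Rightarrow> nat \<Rightarrow> bool"

definition adj_mats :: "nat \<Rightarrow> adjm set" where
  "adj_mats n = {A. \<forall>i j. A i j \<longrightarrow> i < n \<and> j < n \<and> i \<noteq> j}"

definition p1_K :: "real \<Rightarrow> real \<Rightarrow> (nat \<Rightarrow> real) \<Rightarrow> (nat \<Rightarrow> real) \<Rightarrow> nat \<Rightarrow> nat \<Rightarrow> real" where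
  "p1_K \<rho> \<gamma> \<alpha> \<beta> i j = inverse (1 + exp (\<gamma> + \<alpha> i + \<beta> j) + exp (\<gamma> + \<alpha> j + \<beta> i)
       + exp (2 * \<gamma> + \<alpha> i + \<beta> j + \<alpha> j + \<beta> i + \<rho>))"

definition p1_dyad_prob :: "real \<Rightarrow> real \<Rightarrow> (nat \<Rightarrow> real) \<Rightarrow> (nat \<Rightarrow> real) \<Rightarrow> nat \<Rightarrow> nat \<Rightarrow> bool \<Rightarrow> bool \<Rightarrow> real" where
  "p1_dyad_prob \<rho> \<gamma> \<alpha> \<beta> i j a b =
     p1_K \<rho> \<gamma> \<alpha> \<beta> i j * exp (of_bool a * (\<gamma> + \<alpha> i + \<beta> j) + of_bool b * (\<gamma> + \<alpha> j + \<beta> i)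
       + of_bool (a \<and> b) * \<rho>)"

definition p1_prob :: "nat \<Rightarrow> real \<Rightarrow> real \<Rightarrow> (nat \<Rightarrow> real) \<Rightarrow> (nat \<Rightarrow> real) \<Rightarrow> adjm \<Rightarrow> real" where
  "p1_prob n \<rho> \<gamma> \<alpha> \<beta> A = (\<Prod>(i, j) \<in> {(i, j). i < j \<and> j < n}. p1_dyad_prob \<rho> \<gamma> \<alpha> \<beta> i j (A i j) (A j i))"

definition p1_E :: "nat \<Rightarrow> real \<Rightarrow> real \<Rightarrow> (nat \<Rightarrow> real) \<Rightarrow> (nat \<Rightarrow> real) \<Rightarrow> (adjm \<Rightarrow> real) \<Rightarrow> real" where
  "p1_E n \<rho> \<gamma> \<alpha> \<beta> f = (\<Sum>A \<in> adj_mats n. p1_prob n \<rho> \<gamma> \<alpha> \<beta> A * f A)"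

definition p1_Var :: "nat \<Rightarrow> real \<Rightarrow> real \<Rightarrow> (nat \<Rightarrow> real) \<Rightarrow> (nat \<Rightarrow> real) \<Rightarrow> (adjm \<Rightarrow> real) \<Rightarrow> real" where
  "p1_Var n \<rho> \<gamma> \<alpha> \<beta> f = p1_E n \<rho> \<gamma> \<alpha> \<beta> (\<lambda>A. (f A - p1_E n \<rho> \<gamma> \<alpha> \<beta> f)\<^sup>2)"

text \<open>Entries of A11 = A o A', A00 = (J - A) o (J - A'), A10 = A o (J - A'), A01 = A10'.\<close>

definition A11 :: "adjm \<Rightarrow> nat \<Rightarrow> nat \<Rightarrow> real" where
  "A11 A i j = of_bool (A i j \<and> A j i)"
definition A00 :: "adjm \<Rightarrow> nat \<Rightarrow> nat \<Rightarrow> real" where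
  "A00 A i j = of_bool (i \<noteq> j \<and> \<not> A i j \<and> \<not> A j i)"
definition A10 :: "adjm \<Rightarrow> nat \<Rightarrow> nat \<Rightarrow> real" where
  "A10 A i j = of_bool (i \<noteq> j \<and> A i j \<and> \<not> A j i)"
definition A01 :: "adjm \<Rightarrow> nat \<Rightarrow> nat \<Rightarrow> real" where
  "A01 A i j = A10 A j i"

definition quads :: "nat \<Rightarrow> (nat \<times> nat \<times> nat \<times> nat) set" where
  "quads n = {(i, j, k, l). i < n \<and> j < n \<and> k < n \<and> l < n \<and> distinct [i, j, k, l]}"

definition Qa :: "nat \<Rightarrow> adjm \<Rightarrow> real" where
  "Qa n A = (\<Sum>(i, j, k, l) \<in> quads n. A11 A i j * A00 A j k * A01 A k l * A00 A l i)"

definition Qb :: "nat \<Rightarrow> adjm \<Rightarrow> real" where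
  "Qb n A = (\<Sum>(i, j, k, l) \<in> quads n. A10 A i j * A10 A j k * A00 A k l * A10 A l i)"

definition Ustat :: "nat \<Rightarrow> real \<Rightarrow> adjm \<Rightarrow> real" where
  "Ustat n r A = Qa n A - exp r * Qb n A"

definition Htrunc :: "real \<Rightarrow> real \<Rightarrow> real" where
  "Htrunc x t = (if \<bar>x\<bar> \<le> t then x else sgn x * t)"

text \<open>LCR estimator. log(Qa/Qb) is read in the extended reals: if Qa = 0 < Qb it is
  -infinity (truncated to -2 log n); if Qb = 0 < Qa it is +infinity (truncated to 2 log n);
  the case 0/0 is given the value 0.\<close>

definition rho_hat_star :: "nat \<Rightarrow> adjm \<Rightarrow> real" where
  "rho_hat_star n A =
     (if Qa n A > 0 \<and> Qb n A > 0 then Htrunc (ln (Qa n A / Qb n A)) (2 * ln (real n))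
      else if Qa n A > 0 then 2 * ln (real n)
      else if Qb n A > 0 then - 2 * ln (real n)
      else 0)"

definition mu :: "real \<Rightarrow> (nat \<Rightarrow> real) \<Rightarrow> nat \<Rightarrow> real" where
  "mu \<gamma> \<alpha> i = exp (\<gamma> / 2 + \<alpha> i)"
definition nu :: "real \<Rightarrow> (nat \<Rightarrow> real) \<Rightarrow> nat \<Rightarrow> real" where
  "nu \<gamma> \<beta> i = exp (\<gamma> / 2 + \<beta> i)"
definition eta :: "real \<Rightarrow> (nat \<Rightarrow> real) \<Rightarrow> (nat \<Rightarrow> real) \<Rightarrow> nat \<Rightarrow> real" where
  "eta \<gamma> \<alpha> \<beta> i = mu \<gamma> \<alpha> i * nu \<gamma> \<beta> i"

definition l1 :: "nat \<Rightarrow> (nat \<Rightarrow> real) \<Rightarrow> real" where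
  "l1 n x = (\<Sum>i<n. \<bar>x i\<bar>)"
definition ip :: "nat \<Rightarrow> (nat \<Rightarrow> real) \<Rightarrow> (nat \<Rightarrow> real) \<Rightarrow> real" where
  "ip n x y = (\<Sum>i<n. x i * y i)"
definition vmax :: "nat \<Rightarrow> (nat \<Rightarrow> real) \<Rightarrow> real" where
  "vmax n x = Max (x ` {..<n})"

definition r_n :: "nat \<Rightarrow> real \<Rightarrow> real \<Rightarrow> (nat \<Rightarrow> real) \<Rightarrow> (nat \<Rightarrow> real) \<Rightarrow> real" where
  "r_n n \<rho> \<gamma> \<alpha> \<beta> =
     max (1 / (exp \<rho> * (l1 n (eta \<gamma> \<alpha> \<beta>))\<^sup>2))
         (ip n (mu \<gamma> \<alpha>) (eta \<gamma> \<alpha> \<beta>) * ip n (nu \<gamma> \<beta>) (eta \<gamma> \<alpha> \<beta>) / (l1 n (eta \<gamma> \<alpha> \<beta>)) ^ 4)"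

definition rho_tilde :: "nat \<Rightarrow> real \<Rightarrow> (nat \<Rightarrow> real) \<Rightarrow> (nat \<Rightarrow> real) \<Rightarrow> real" where
  "rho_tilde n \<gamma> \<alpha> \<beta> =
     ln ((l1 n (eta \<gamma> \<alpha> \<beta>))\<^sup>2 / (ip n (mu \<gamma> \<alpha>) (eta \<gamma> \<alpha> \<beta>) * ip n (nu \<gamma> \<beta>) (eta \<gamma> \<alpha> \<beta>)))"

end

theory Submission
  imports Defs
begin

text \<open>For a given quadruple of nodes the \<open>a\<close>-pattern is \<open>e\<^sup>\<rho>\<close> times as likely as the
  \<open>b\<close>-pattern, so \<open>U\<^sub>n(\<rho>)\<close> is centred.

  Upper bound on the variance: by the Efron--Stein inequality it is at most the sum over the dyads of the
  mean square change of \<open>U\<^sub>n\<close> when the dyad is emptied. Such a change is bounded by eight path counts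
  (one for each slot of the two patterns), in which all factors \<open>A\<^sup>0\<^sup>0\<close> may be bounded by 1; their second
  moments follow by exposing the edges of a path one after the other.

  Lower bound on the variance: \<open>U\<^sub>n\<close> is correlated with a count of reciprocated pairs, because such a pair
  can only occur in an \<open>a\<close>-pattern; Cauchy--Schwarz gives a relative variance of at least a constant times
  \<open>1 / (e\<^sup>\<rho> \<parallel>\<eta>\<parallel>\<^sup>2)\<close>.

  If \<open>Q\<^sub>n(a)\<close> and \<open>Q\<^sub>n(b)\<close> are at least constant fractions of their means, then the error of the estimator is
  \<open>O(|U\<^sub>n| / E Q\<^sub>n(a))\<close>. The other event has probability \<open>O(n\<^sup>-\<^sup>9)\<close>: split the nodes into four groups of
  comparable weight, count only patterns with one node in each group, and apply Chernoff bounds to the blocks of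
  dyads between the groups one block at a time. On that event the squared error is at most \<open>16 log\<^sup>2 n\<close>, which
  the lower bound on the variance absorbs.\<close>

section \<open>Functions of finitely many independent coordinates\<close>

text \<open>The middle term of the claimed chain is the relative variance itself, so the rare event
  has to be compared with that variance and not only with \<open>r_n\<close>; this forces the lower
  bound. As \<open>e * H\<^sup>2\<close> is at most n^2, the relative variance is at least of order
  n^-2, which a probability of order n^-9 times log^2 n beats. Dyads are emptied rather than
  resampled because emptying can only destroy edges: the old and the new value of a pattern are then
  dominated by one product in the old network, and the null factors, the only ones that can grow,
  are discarded. The node weights may be very uneven, so no typical degree is available. Everything
  is expressed by the sums of \<mu>, \<nu>, \<eta> and the two inner products with \<eta>, and these
  are compared by Cauchy-Schwarz. Disjoint groups make the blocks of dyads between different pairs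
  of groups disjoint. A block is therefore still fresh after others have been exposed, and the
  weights in its Chernoff bound are constants; caps on these weights supply the exponent.\<close>

definition cyl :: "'d set \<Rightarrow> ('d \<Rightarrow> 's) \<Rightarrow> ('d \<Rightarrow> 's) set" where
  "cyl D \<omega> = {\<omega>'. \<forall>d. d \<notin> D \<longrightarrow> \<omega>' d = \<omega> d}"

text \<open>Functional rather than stochastic independence: \<open>g\<close> does not read the
  coordinates in \<open>S\<close>. The notion is stable under pointwise operations, and on a
  cylinder over \<open>S\<close> such a function is constant.\<close>

definition indep_of :: "'d set \<Rightarrow> (('d \<Rightarrow> 's) \<Rightarrow> 'b) \<Rightarrow> bool" where
  "indep_of S g \<longleftrightarrow> (\<forall>\<omega> \<omega>'. \<omega>' \<in> cyl S \<omega> \<longrightarrow> g \<omega>' = g \<omega>)"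

lemma cyl_empty [simp]: "cyl {} \<omega> = {\<omega>}"
  by (auto simp: cyl_def)

lemma cyl_insert: "cyl (insert d D) \<omega> = (\<Union>s. cyl D (\<omega>(d := s)))" if "d \<notin> D"
proof (intro set_eqI iffI)
  fix \<omega>' assume "\<omega>' \<in> cyl (insert d D) \<omega>"
  hence "\<omega>' \<in> cyl D (\<omega>(d := \<omega>' d))"
    by (auto simp: cyl_def)
  thus "\<omega>' \<in> (\<Union>s. cyl D (\<omega>(d := s)))" by blast
qed (use that in \<open>auto simp: cyl_def split: if_splits\<close>)

lemma finite_cyl:
  fixes \<omega> :: "'d \<Rightarrow> 's::finite"
  assumes "finite D"
  shows "finite (cyl D \<omega>)"
  using assms
proof (induction D arbitrary: \<omega> rule: finite_induct)
  case (insert d D)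
  then show ?case by (subst cyl_insert) auto
qed auto

lemma indep_ofD: "indep_of S g \<Longrightarrow> \<omega>' \<in> cyl S \<omega> \<Longrightarrow> g \<omega>' = g \<omega>"
  by (auto simp: indep_of_def)

lemma indep_of_upd: "indep_of S g \<Longrightarrow> d \<in> S \<Longrightarrow> g (\<omega>(d := s)) = g \<omega>"
  by (erule indep_ofD) (auto simp: cyl_def)

lemma indep_of_const [intro, simp]: "indep_of S (\<lambda>_. c)"
  by (auto simp: indep_of_def)

lemma indep_of_comp2: "indep_of S f \<Longrightarrow> indep_of S g \<Longrightarrow> indep_of S (\<lambda>\<omega>. h (f \<omega>) (g \<omega>))"
  by (auto simp: indep_of_def)

lemma indep_of_comp: "indep_of S f \<Longrightarrow> indep_of S (\<lambda>\<omega>. h (f \<omega>))"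
  by (auto simp: indep_of_def)

lemma indep_of_sum: "(\<And>e. e \<in> F \<Longrightarrow> indep_of S (f e)) \<Longrightarrow> indep_of S (\<lambda>\<omega>. \<Sum>e\<in>F. f e \<omega>)"
  unfolding indep_of_def by (intro allI impI sum.cong refl) auto

lemma indep_of_mult:
  fixes f g :: "('d \<Rightarrow> 's) \<Rightarrow> real"
  shows "indep_of S f \<Longrightarrow> indep_of S g \<Longrightarrow> indep_of S (\<lambda>\<omega>. f \<omega> * g \<omega>)"
  by (rule indep_of_comp2)

lemma indep_of_power:
  fixes f :: "('d \<Rightarrow> 's) \<Rightarrow> real"
  shows "indep_of S f \<Longrightarrow> indep_of S (\<lambda>\<omega>. (f \<omega>) ^ k)"
  by (rule indep_of_comp)

lemmas indep_intros = indep_of_sum indep_of_mult indep_of_power indep_of_const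

locale product_prob =
  fixes p :: "'d \<Rightarrow> 's::finite \<Rightarrow> real"
  assumes p_nonneg: "\<And>d s. 0 \<le> p d s"
    and p_sum: "\<And>d. (\<Sum>s\<in>UNIV. p d s) = 1"
begin

text \<open>The conditional expectation given the coordinates outside \<open>D\<close>, whose values
  are supplied by \<open>\<omega>\<close>. Finite sums over cylinders take the place of a product
  measure, and conditioning becomes nesting of means.\<close>

definition mean :: "'d set \<Rightarrow> ('d \<Rightarrow> 's) \<Rightarrow> (('d \<Rightarrow> 's) \<Rightarrow> real) \<Rightarrow> real" where
  "mean D \<omega> f = (\<Sum>\<omega>'\<in>cyl D \<omega>. (\<Prod>d\<in>D. p d (\<omega>' d)) * f \<omega>')"

lemma mean_empty [simp]: "mean {} \<omega> f = f \<omega>"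
  by (simp add: mean_def)

lemma mean_insert:
  assumes "finite D" "d \<notin> D"
  shows "mean (insert d D) \<omega> f = (\<Sum>s\<in>UNIV. p d s * mean D (\<omega>(d := s)) f)"
proof -
  have "mean (insert d D) \<omega> f
    = (\<Sum>s\<in>UNIV. \<Sum>\<omega>'\<in>cyl D (\<omega>(d := s)). (\<Prod>d\<in>insert d D. p d (\<omega>' d)) * f \<omega>')"
    unfolding mean_def cyl_insert[OF assms(2)]
  proof (rule sum.UNION_disjoint)
    show "\<forall>s\<in>UNIV. \<forall>t\<in>UNIV. s \<noteq> t \<longrightarrow> cyl D (\<omega>(d := s)) \<inter> cyl D (\<omega>(d := t)) = {}"
      using assms(2) by (auto simp: cyl_def)
  qed (auto simp: finite_cyl assms)
  also have "\<dots> = (\<Sum>s\<in>UNIV. p d s * mean D (\<omega>(d := s)) f)"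
    unfolding mean_def sum_distrib_left
  proof (intro sum.cong refl)
    fix s \<omega>' assume "\<omega>' \<in> cyl D (\<omega>(d := s))"
    hence "\<omega>' d = s" using assms(2) by (auto simp: cyl_def)
    thus "(\<Prod>d\<in>insert d D. p d (\<omega>' d)) * f \<omega>' = p d s * ((\<Prod>d\<in>D. p d (\<omega>' d)) * f \<omega>')"
      using assms by simp
  qed
  finally show ?thesis .
qed

lemma mean_cong: "(\<And>\<omega>'. \<omega>' \<in> cyl D \<omega> \<Longrightarrow> f \<omega>' = g \<omega>') \<Longrightarrow> mean D \<omega> f = mean D \<omega> g"
  unfolding mean_def by (rule sum.cong) auto

lemma mean_add: "mean D \<omega> (\<lambda>x. f x + g x) = mean D \<omega> f + mean D \<omega> g"
  by (simp add: mean_def algebra_simps sum.distrib)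

lemma mean_diff: "mean D \<omega> (\<lambda>x. f x - g x) = mean D \<omega> f - mean D \<omega> g"
  by (simp add: mean_def algebra_simps sum_subtractf)

lemma mean_cmult: "mean D \<omega> (\<lambda>x. c * f x) = c * mean D \<omega> f"
  by (simp add: mean_def sum_distrib_left mult_ac)

lemma mean_sum: "mean D \<omega> (\<lambda>x. \<Sum>e\<in>F. f e x) = (\<Sum>e\<in>F. mean D \<omega> (f e))"
  unfolding mean_def sum_distrib_left by (rule sum.swap)

lemma mean_mono: "(\<And>\<omega>'. \<omega>' \<in> cyl D \<omega> \<Longrightarrow> f \<omega>' \<le> g \<omega>') \<Longrightarrow> mean D \<omega> f \<le> mean D \<omega> g"
  unfolding mean_def by (intro sum_mono mult_left_mono prod_nonneg) (auto simp: p_nonneg)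

lemma mean_nonneg: "(\<And>\<omega>'. \<omega>' \<in> cyl D \<omega> \<Longrightarrow> 0 \<le> f \<omega>') \<Longrightarrow> 0 \<le> mean D \<omega> f"
  unfolding mean_def by (intro sum_nonneg mult_nonneg_nonneg prod_nonneg) (auto simp: p_nonneg)

lemma mean_const:
  assumes "finite D"
  shows "mean D \<omega> (\<lambda>_. c) = c"
  using assms
  by (induction D arbitrary: \<omega> rule: finite_induct)
     (auto simp: mean_insert p_sum sum_distrib_right[symmetric])

lemma mean_Un:
  assumes "finite D" "finite S" "D \<inter> S = {}"
  shows "mean (D \<union> S) \<omega> f = mean D \<omega> (\<lambda>\<omega>'. mean S \<omega>' f)"
  using assms
proof (induction D arbitrary: \<omega> rule: finite_induct)
  case (insert d D)
  then show ?case by (simp add: mean_insert)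
qed auto

lemma mean_split:
  assumes "finite D" "S \<subseteq> D"
  shows "mean D \<omega> f = mean (D - S) \<omega> (\<lambda>\<omega>'. mean S \<omega>' f)"
proof -
  have "D = (D - S) \<union> S" using assms by auto
  moreover have "mean ((D - S) \<union> S) \<omega> f = mean (D - S) \<omega> (\<lambda>\<omega>'. mean S \<omega>' f)"
    by (rule mean_Un) (use assms in \<open>auto intro: finite_subset\<close>)
  ultimately show ?thesis by simp
qed

lemma mean_pull: "mean S \<omega> (\<lambda>\<omega>'. g \<omega>' * f \<omega>') = g \<omega> * mean S \<omega> f" if "indep_of S g"
  by (subst mean_cmult[symmetric], rule mean_cong) (simp add: indep_ofD[OF that])

lemma mean_drop:
  assumes "finite D" "S \<subseteq> D" "indep_of S g"
  shows "mean (D - S) \<omega> g = mean D \<omega> g"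
proof -
  have "mean S \<omega>' g = g \<omega>'" for \<omega>'
    using mean_pull[OF assms(3), of \<omega>' "\<lambda>_. 1"] mean_const[of S \<omega>' 1] assms(1,2)
    by (auto dest: finite_subset)
  thus ?thesis using mean_split[OF assms(1,2), of \<omega> g] by simp
qed

text \<open>Tower property with a uniform bound: given everything outside \<open>S\<close>,
  \<open>g\<close> is a constant and \<open>f\<close> has mean at most \<open>c\<close>. This is the
  form in which one block is integrated out.\<close>

lemma mean_mult_le:
  assumes "finite D" "S \<subseteq> D" "indep_of S g" "\<And>\<omega>. 0 \<le> g \<omega>" "\<And>\<omega>. mean S \<omega> f \<le> c"
  shows "mean D \<omega> (\<lambda>\<omega>'. g \<omega>' * f \<omega>') \<le> c * mean D \<omega> g"
proof -
  have "mean D \<omega> (\<lambda>\<omega>'. g \<omega>' * f \<omega>') = mean (D - S) \<omega> (\<lambda>\<omega>'. g \<omega>' * mean S \<omega>' f)"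
    by (subst mean_split[OF assms(1,2)]) (simp add: mean_pull[OF assms(3)])
  also have "\<dots> \<le> mean (D - S) \<omega> (\<lambda>\<omega>'. c * g \<omega>')"
    using assms(4,5) by (intro mean_mono) (metis mult.commute mult_left_mono)
  also have "\<dots> = c * mean D \<omega> g"
    by (simp add: mean_cmult mean_drop[OF assms(1-3)])
  finally show ?thesis .
qed

lemma mean_coord:
  assumes "finite D" "d \<in> D" "indep_of {d} g"
  shows "mean D \<omega> (\<lambda>\<omega>'. \<phi> (\<omega>' d) * g \<omega>') = (\<Sum>s\<in>UNIV. p d s * \<phi> s) * mean D \<omega> g"
proof -
  have "mean {d} \<omega>' (\<lambda>\<omega>'. \<phi> (\<omega>' d) * g \<omega>') = (\<Sum>s\<in>UNIV. p d s * \<phi> s) * g \<omega>'" for \<omega>'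
    by (simp add: mean_insert indep_of_upd[OF assms(3)] sum_distrib_left mult_ac)
  thus ?thesis
    using mean_split[OF assms(1), of "{d}" \<omega> "\<lambda>\<omega>'. \<phi> (\<omega>' d) * g \<omega>'"] assms
    by (simp add: mean_cmult mean_drop)
qed

lemma mean_square_ge:
  assumes "finite D"
  shows "(mean D \<omega> f)\<^sup>2 \<le> mean D \<omega> (\<lambda>x. (f x)\<^sup>2)"
proof -
  define c where "c = mean D \<omega> f"
  have "0 \<le> mean D \<omega> (\<lambda>x. (f x - c)\<^sup>2)" by (rule mean_nonneg) simp
  also have "\<dots> = mean D \<omega> (\<lambda>x. (f x)\<^sup>2 + (- 2 * c) * f x + c\<^sup>2)"
    by (simp add: power2_eq_square algebra_simps)
  also have "\<dots> = mean D \<omega> (\<lambda>x. (f x)\<^sup>2) - c\<^sup>2"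
    by (simp only: mean_add mean_cmult mean_const[OF assms] c_def[symmetric])
       (simp add: power2_eq_square)
  finally show ?thesis by (simp add: c_def)
qed

text \<open>Expand the mean square of \<open>f - c / t * g\<close>. An upper bound
  \<open>t > 0\<close> in place of the second moment of \<open>g\<close> avoids the degenerate case
  in which \<open>g\<close> vanishes.\<close>

lemma mean_Cauchy_Schwarz:
  assumes "finite D" "0 < t" "mean D \<omega> (\<lambda>x. (g x)\<^sup>2) \<le> t"
  shows "(mean D \<omega> (\<lambda>x. f x * g x))\<^sup>2 \<le> t * mean D \<omega> (\<lambda>x. (f x)\<^sup>2)"
proof -
  define c where "c = mean D \<omega> (\<lambda>x. f x * g x)"
  have "0 \<le> mean D \<omega> (\<lambda>x. (f x - c / t * g x)\<^sup>2)" by (rule mean_nonneg) simp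
  also have "\<dots> = mean D \<omega> (\<lambda>x. (f x)\<^sup>2 + (- 2 * c / t) * (f x * g x) + (c / t)\<^sup>2 * (g x)\<^sup>2)"
    by (rule mean_cong) (simp add: power2_eq_square algebra_simps)
  also have "\<dots> = mean D \<omega> (\<lambda>x. (f x)\<^sup>2) - 2 * c / t * c + (c / t)\<^sup>2 * mean D \<omega> (\<lambda>x. (g x)\<^sup>2)"
    unfolding mean_add mean_cmult c_def[symmetric] by simp
  also have "\<dots> \<le> mean D \<omega> (\<lambda>x. (f x)\<^sup>2) - 2 * c / t * c + (c / t)\<^sup>2 * t"
    using assms(3) by (intro add_left_mono mult_left_mono) auto
  also have "\<dots> = mean D \<omega> (\<lambda>x. (f x)\<^sup>2) - c\<^sup>2 / t"
    using assms(2) by (simp add: power2_eq_square field_simps)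
  finally show ?thesis using assms(2) by (simp add: c_def field_simps)
qed

text \<open>Version with a fixed reference state \<open>s0\<close> instead of an independent copy.
  The induction splits the variance into the mean conditional variance given the new coordinate and
  the variance of the conditional mean \<open>?h\<close>.\<close>

lemma efron_stein:
  assumes "finite D"
  shows "mean D \<omega> (\<lambda>x. (f x)\<^sup>2) - (mean D \<omega> f)\<^sup>2 \<le> (\<Sum>d\<in>D. mean D \<omega> (\<lambda>x. (f x - f (x(d := s0)))\<^sup>2))"
  using assms
proof (induction D arbitrary: \<omega> rule: finite_induct)
  case (insert d D)
  note [simp] = mean_insert[OF insert(1,2)]
  let ?h = "\<lambda>s. mean D (\<omega>(d := s)) f"
  let ?m = "\<Sum>s\<in>UNIV. p d s * ?h s"
  have 1: "mean D (\<omega>(d := s)) (\<lambda>x. (f x)\<^sup>2)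
      \<le> (?h s)\<^sup>2 + (\<Sum>e\<in>D. mean D (\<omega>(d := s)) (\<lambda>x. (f x - f (x(e := s0)))\<^sup>2))" for s
    using insert.IH[of "\<omega>(d := s)"] by linarith
  \<comment> \<open>The conditional mean at state \<open>s0\<close> is rewritten over the cylinder
    at state \<open>s\<close>. The difference of the two is then the mean of one function, to which
    Jensen's inequality applies.\<close>
  have shift: "mean E (\<omega>(d := s0)) f = mean E (\<omega>(d := s)) (\<lambda>x. f (x(d := s0)))"
    if "finite E" "d \<notin> E" for E s \<omega>
    using that
  proof (induction E arbitrary: \<omega> rule: finite_induct)
    case (insert e E)
    have *: "\<omega>(d := t, e := u) = \<omega>(e := u, d := t)" for t u
      using insert.prems by (auto simp: fun_upd_twist)
    have "mean E (\<omega>(e := u, d := s0)) f = mean E (\<omega>(e := u, d := s)) (\<lambda>x. f (x(d := s0)))" for u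
      using insert.IH[of "\<omega>(e := u)"] insert.prems by blast
    thus ?case by (simp only: mean_insert[OF insert(1,2)] *)
  qed auto
  have 2: "(?h s - ?h s0)\<^sup>2 \<le> mean D (\<omega>(d := s)) (\<lambda>x. (f x - f (x(d := s0)))\<^sup>2)" for s
  proof -
    have "?h s - ?h s0 = mean D (\<omega>(d := s)) (\<lambda>x. f x - f (x(d := s0)))"
      by (simp add: mean_diff shift[OF insert(1,2), of \<omega> s])
    thus ?thesis using mean_square_ge[OF insert(1)] by simp
  qed
  \<comment> \<open>The variance is the least mean squared distance to a constant; the constant used
    here is \<open>?h s0\<close>.\<close>
  have 3: "(\<Sum>s\<in>UNIV. p d s * (?h s)\<^sup>2) - ?m\<^sup>2 \<le> (\<Sum>s\<in>UNIV. p d s * (?h s - ?h s0)\<^sup>2)"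
  proof -
    have "(\<Sum>s\<in>UNIV. p d s * (?h s - ?h s0)\<^sup>2)
        = (\<Sum>s\<in>UNIV. p d s * (?h s)\<^sup>2 + (- 2 * ?h s0) * (p d s * ?h s) + p d s * (?h s0)\<^sup>2)"
      by (intro sum.cong refl) (simp add: power2_eq_square algebra_simps)
    also have "\<dots> = (\<Sum>s\<in>UNIV. p d s * (?h s)\<^sup>2) - 2 * ?h s0 * ?m + (?h s0)\<^sup>2"
      unfolding sum.distrib sum_distrib_left[symmetric] sum_distrib_right[symmetric] p_sum
      by simp
    moreover have "0 \<le> (?m - ?h s0)\<^sup>2" by simp
    ultimately show ?thesis by (simp add: power2_eq_square algebra_simps)
  qed
  have "mean (insert d D) \<omega> (\<lambda>x. (f x)\<^sup>2) - (mean (insert d D) \<omega> f)\<^sup>2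
      = (\<Sum>s\<in>UNIV. p d s * mean D (\<omega>(d := s)) (\<lambda>x. (f x)\<^sup>2)) - ?m\<^sup>2"
    by simp
  also have "\<dots> \<le> (\<Sum>s\<in>UNIV. p d s * ((?h s)\<^sup>2
      + (\<Sum>e\<in>D. mean D (\<omega>(d := s)) (\<lambda>x. (f x - f (x(e := s0)))\<^sup>2)))) - ?m\<^sup>2"
    by (intro diff_right_mono sum_mono mult_left_mono 1 p_nonneg)
  also have "\<dots> = ((\<Sum>s\<in>UNIV. p d s * (?h s)\<^sup>2) - ?m\<^sup>2)
      + (\<Sum>e\<in>D. mean (insert d D) \<omega> (\<lambda>x. (f x - f (x(e := s0)))\<^sup>2))"
    by (simp add: ring_distribs sum.distrib sum_distrib_left)
       (rule sum.swap)
  also have "(\<Sum>s\<in>UNIV. p d s * (?h s)\<^sup>2) - ?m\<^sup>2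
      \<le> mean (insert d D) \<omega> (\<lambda>x. (f x - f (x(d := s0)))\<^sup>2)"
  proof -
    note 3
    also have "(\<Sum>s\<in>UNIV. p d s * (?h s - ?h s0)\<^sup>2)
      \<le> (\<Sum>s\<in>UNIV. p d s * mean D (\<omega>(d := s)) (\<lambda>x. (f x - f (x(d := s0)))\<^sup>2))"
      by (intro sum_mono mult_left_mono 2 p_nonneg)
    finally show ?thesis by simp
  qed
  finally show ?case by (simp only: sum.insert[OF insert(1,2)])
qed auto

text \<open>Given the coordinates outside \<open>S\<close> the weights are constants and the square
  can be expanded. Distinct indices contribute at most as if the indicators were independent with
  means \<open>q\<close>; the diagonal adds a term linear in \<open>q\<close>, since an indicator is
  its own square. Applied repeatedly, this exposes a path edge by edge.\<close>

lemma second_moment: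
  assumes "finite D" "S \<subseteq> D" "finite F"
    and w: "\<And>e. e \<in> F \<Longrightarrow> indep_of S (w e)" "\<And>e \<omega>. e \<in> F \<Longrightarrow> 0 \<le> w e \<omega>"
    and Y01: "\<And>e \<omega>. e \<in> F \<Longrightarrow> Y e \<omega> * Y e \<omega> = Y e \<omega>"
    and Y1: "\<And>e \<omega>. e \<in> F \<Longrightarrow> mean S \<omega> (Y e) \<le> q e"
    and Y2: "\<And>e e' \<omega>. e \<in> F \<Longrightarrow> e' \<in> F \<Longrightarrow> e \<noteq> e' \<Longrightarrow>
      mean S \<omega> (\<lambda>x. Y e x * Y e' x) \<le> q e * q e'"
  shows "mean D \<omega> (\<lambda>x. (\<Sum>e\<in>F. Y e x * w e x)\<^sup>2)
    \<le> mean D \<omega> (\<lambda>x. (\<Sum>e\<in>F. q e * w e x)\<^sup>2) + (\<Sum>e\<in>F. q e * mean D \<omega> (\<lambda>x. (w e x)\<^sup>2))"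
proof -
  let ?G = "\<lambda>x. (\<Sum>e\<in>F. q e * w e x)\<^sup>2 + (\<Sum>e\<in>F. q e * (w e x)\<^sup>2)"
  have ind: "indep_of S ?G"
    by (rule indep_of_comp2; intro indep_intros w)
  have "mean S x (\<lambda>x. (\<Sum>e\<in>F. Y e x * w e x)\<^sup>2) \<le> ?G x" for x
  proof -
    have "mean S x (\<lambda>x. (\<Sum>e\<in>F. Y e x * w e x)\<^sup>2)
       = mean S x (\<lambda>x. \<Sum>e\<in>F. \<Sum>e'\<in>F. (w e x * w e' x) * (Y e x * Y e' x))"
      by (simp add: power2_eq_square sum_product mult_ac)
    also have "\<dots> = (\<Sum>e\<in>F. \<Sum>e'\<in>F. (w e x * w e' x) * mean S x (\<lambda>x. Y e x * Y e' x))"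
      unfolding mean_sum by (intro sum.cong refl mean_pull indep_of_mult w)
    also have "\<dots> \<le> (\<Sum>e\<in>F. \<Sum>e'\<in>F. (w e x * w e' x) *
        (q e * q e' + (if e' = e then q e else 0)))"
    proof (intro sum_mono mult_left_mono)
      fix e e' assume e: "e \<in> F" "e' \<in> F"
      show "mean S x (\<lambda>x. Y e x * Y e' x) \<le> q e * q e' + (if e' = e then q e else 0)"
      proof (cases "e = e'")
        case True
        have "(\<lambda>x. Y e x * Y e x) = Y e" using Y01[OF e(1)] by auto
        thus ?thesis using True Y1[OF e(1), of x] by (simp add: add_increasing)
      qed (use Y2[OF e] in auto)
      show "0 \<le> w e x * w e' x" using w e by simp
    qed
    also have "\<dots> = (\<Sum>e\<in>F. \<Sum>e'\<in>F. (q e * w e x) * (q e' * w e' x))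
       + (\<Sum>e\<in>F. \<Sum>e'\<in>F. (if e' = e then q e * (w e x)\<^sup>2 else 0))"
      unfolding sum.distrib[symmetric]
      by (intro sum.cong refl) (auto simp: algebra_simps power2_eq_square)
    also have "\<dots> = ?G x"
      using assms(3) by (simp add: power2_eq_square sum_product)
    finally show ?thesis .
  qed
  hence "mean D \<omega> (\<lambda>x. (\<Sum>e\<in>F. Y e x * w e x)\<^sup>2) \<le> mean (D - S) \<omega> ?G"
    unfolding mean_split[OF assms(1,2), of \<omega> "\<lambda>x. (\<Sum>e\<in>F. Y e x * w e x)\<^sup>2"]
    by (intro mean_mono) auto
  also have "\<dots> = mean D \<omega> ?G" by (rule mean_drop[OF assms(1,2) ind])
  finally show ?thesis by (simp add: mean_add mean_sum mean_cmult)
qed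

section \<open>Exponential moments and Chernoff bounds for sums over independent coordinates\<close>

lemma mean_prod:
  assumes "finite F" "inj_on key F"
  shows "mean (key ` F) \<omega> (\<lambda>x. \<Prod>e\<in>F. \<phi> e (x (key e))) = (\<Prod>e\<in>F. \<Sum>s\<in>UNIV. p (key e) s * \<phi> e s)"
  using assms
proof (induction F rule: finite_induct)
  case (insert e F)
  have ne: "key e \<notin> key ` F" using insert by (auto simp: inj_on_def)
  have ind: "indep_of {key e} (\<lambda>x. \<Prod>e\<in>F. \<phi> e (x (key e)))"
    unfolding indep_of_def cyl_def
  proof (intro allI impI prod.cong refl)
    fix \<omega> \<omega>' :: "'d \<Rightarrow> 's" and i assume "\<omega>' \<in> {\<omega>'. \<forall>d. d \<notin> {key e} \<longrightarrow> \<omega>' d = \<omega> d}" "i \<in> F"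
    moreover from \<open>i \<in> F\<close> ne have "key i \<noteq> key e" by (metis imageI)
    ultimately show "\<phi> i (\<omega>' (key i)) = \<phi> i (\<omega> (key i))" by simp
  qed
  have "mean (key ` insert e F) \<omega> (\<lambda>x. \<Prod>e\<in>insert e F. \<phi> e (x (key e)))
    = mean (insert (key e) (key ` F)) \<omega> (\<lambda>x. \<phi> e (x (key e)) * (\<Prod>e\<in>F. \<phi> e (x (key e))))"
    using insert by simp
  also have "\<dots> = (\<Sum>s\<in>UNIV. p (key e) s * \<phi> e s)
      * mean (insert (key e) (key ` F)) \<omega> (\<lambda>x. \<Prod>e\<in>F. \<phi> e (x (key e)))"
    by (rule mean_coord) (use insert(1) ind in auto)
  also have "mean (insert (key e) (key ` F)) \<omega> (\<lambda>x. \<Prod>e\<in>F. \<phi> e (x (key e)))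
     = mean (key ` F) \<omega> (\<lambda>x. \<Prod>e\<in>F. \<phi> e (x (key e)))"
    using mean_drop[of "insert (key e) (key ` F)" "{key e}" "\<lambda>x. \<Prod>e\<in>F. \<phi> e (x (key e))" \<omega>]
      insert(1) ne ind by simp
  finally show ?case using insert by simp
qed auto

text \<open>The weights may depend on the coordinates outside the block. Their constraints are part of the event, so
  that the bound involves deterministic constants only.\<close>

lemma lower_tail:
  assumes "finite D" "finite F" "inj_on key F" "key ` F \<subseteq> D" "0 < M"
    and w: "\<And>e. e \<in> F \<Longrightarrow> indep_of (key ` F) (w e)"
    and Y: "\<And>e s. e \<in> F \<Longrightarrow> Y e s = 0 \<or> Y e s = 1"
    and q: "\<And>e. e \<in> F \<Longrightarrow> q e \<le> (\<Sum>s\<in>UNIV. p (key e) s * Y e s)"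
  shows "mean D \<omega> (\<lambda>x. of_bool ((\<forall>e\<in>F. 0 \<le> w e x \<and> w e x \<le> M) \<and> m \<le> (\<Sum>e\<in>F. q e * w e x)
            \<and> (\<Sum>e\<in>F. w e x * Y e (x (key e))) < m / 4)) \<le> exp (- (m / (4 * M)))"
proof -
  let ?S = "key ` F"
  let ?A = "\<lambda>x. (\<forall>e\<in>F. 0 \<le> w e x \<and> w e x \<le> M) \<and> m \<le> (\<Sum>e\<in>F. q e * w e x)"
  let ?B = "\<lambda>x. ?A x \<and> (\<Sum>e\<in>F. w e x * Y e (x (key e))) < m / 4"
  have "mean ?S x (\<lambda>x. of_bool (?B x)) \<le> exp (- (m / (4 * M)))" for x
  proof (cases "?A x")
    case False
    have "mean ?S x (\<lambda>x. of_bool (?B x)) = mean ?S x (\<lambda>_. 0)"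
    proof (rule mean_cong)
      fix y assume "y \<in> cyl ?S x"
      hence "w e y = w e x" if "e \<in> F" for e using w[OF that] by (auto dest: indep_ofD)
      hence "?A y = ?A x" by simp
      thus "of_bool (?B y) = 0" using False by auto
    qed
    thus ?thesis using mean_const[of ?S x 0] assms(2) by simp
  next
    case True
    \<comment> \<open>Dividing by the cap \<open>M\<close> brings the exponents into [0, 1], where
      the exponential has linear bounds. The price is the factor \<open>1 / M\<close> in the
      rate.\<close>
    define u where "u = (\<lambda>e. w e x / M)"
    have u: "0 \<le> u e" "u e \<le> 1" if "e \<in> F" for e
      using True that \<open>0 < M\<close> by (auto simp: u_def)
    have mu: "m / M \<le> (\<Sum>e\<in>F. q e * u e)"
      using True \<open>0 < M\<close> by (simp add: u_def sum_divide_distrib[symmetric] divide_right_mono)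
    have "mean ?S x (\<lambda>x. of_bool (?B x))
      \<le> mean ?S x (\<lambda>y. exp (m / (4 * M)) * (\<Prod>e\<in>F. exp (- u e * Y e (y (key e)))))"
    proof (rule mean_mono)
      fix y assume "y \<in> cyl ?S x"
      hence wy: "w e y = w e x" if "e \<in> F" for e using w[OF that] by (auto dest: indep_ofD)
      have eq: "exp (m / (4 * M)) * (\<Prod>e\<in>F. exp (- u e * Y e (y (key e))))
         = exp ((m / 4 - (\<Sum>e\<in>F. w e y * Y e (y (key e)))) / M)"
        using \<open>0 < M\<close>
        by (simp add: exp_sum[OF assms(2), symmetric] exp_add[symmetric] u_def wy sum_negf
              diff_divide_distrib sum_divide_distrib cong: sum.cong)
      show "of_bool (?B y) \<le> exp (m / (4 * M)) * (\<Prod>e\<in>F. exp (- u e * Y e (y (key e))))"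
        unfolding eq using \<open>0 < M\<close> by (auto simp: of_bool_def)
    qed
    also have "\<dots> = exp (m / (4 * M)) * (\<Prod>e\<in>F. \<Sum>s\<in>UNIV. p (key e) s * exp (- u e * Y e s))"
      unfolding mean_cmult by (subst mean_prod[OF assms(2,3)]) simp
    also have "\<dots> \<le> exp (m / (4 * M)) * (\<Prod>e\<in>F. exp (- (q e * u e / 2)))"
    proof (intro mult_left_mono prod_mono conjI)
      fix e assume e: "e \<in> F"
      show "0 \<le> (\<Sum>s\<in>UNIV. p (key e) s * exp (- u e * Y e s))"
        by (intro sum_nonneg mult_nonneg_nonneg p_nonneg) simp
      \<comment> \<open>This yields exp (- q u / 2) per coordinate, hence exp (- m / (2 M)) for the
        product; the Markov factor exp (m / (4 M)) uses up half of the exponent.\<close>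
      have ex: "exp (- u e) \<le> 1 - u e / 2"
      proof -
        have "exp (- u e) \<le> 1 / (1 + u e)"
          using u[OF e] exp_ge_add_one_self[of "u e"] by (simp add: exp_minus field_simps)
        also have "\<dots> \<le> 1 - u e / 2"
        proof -
          have "u e * u e \<le> u e" using u[OF e] by (simp add: mult_left_le_one_le)
          thus ?thesis using u[OF e] by (simp add: field_simps)
        qed
        finally show ?thesis .
      qed
      have "(\<Sum>s\<in>UNIV. p (key e) s * exp (- u e * Y e s))
         \<le> (\<Sum>s\<in>UNIV. p (key e) s - u e / 2 * (p (key e) s * Y e s))"
      proof (rule sum_mono)
        fix s
        have "p (key e) s * exp (- u e * Y e s) \<le> p (key e) s * (1 - u e / 2 * Y e s)"
          using Y[OF e, of s] ex by (intro mult_left_mono p_nonneg) auto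
        thus "p (key e) s * exp (- u e * Y e s) \<le> p (key e) s - u e / 2 * (p (key e) s * Y e s)"
          by (simp add: algebra_simps)
      qed
      also have "\<dots> = 1 - u e / 2 * (\<Sum>s\<in>UNIV. p (key e) s * Y e s)"
        unfolding sum_subtractf p_sum sum_distrib_left ..
      also have "\<dots> \<le> 1 - u e / 2 * q e"
        using q[OF e] u[OF e] by (intro diff_left_mono mult_left_mono) auto
      also have "\<dots> \<le> exp (- (q e * u e / 2))"
        using exp_ge_add_one_self[of "- (q e * u e / 2)"] by (simp add: mult_ac)
      finally show "(\<Sum>s\<in>UNIV. p (key e) s * exp (- u e * Y e s)) \<le> exp (- (q e * u e / 2))" .
    qed auto
    also have "\<dots> = exp (m / (4 * M) - (\<Sum>e\<in>F. q e * u e) / 2)"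
      by (simp add: exp_sum[OF assms(2), symmetric] exp_add[symmetric] sum_negf sum_divide_distrib)
    also have "\<dots> \<le> exp (- (m / (4 * M)))"
      using mu \<open>0 < M\<close> by (simp add: field_simps)
    finally show ?thesis .
  qed
  thus ?thesis
    using mean_mult_le[OF assms(1,4), of "\<lambda>_. 1" "\<lambda>x. of_bool (?B x)" _ \<omega>] by (simp add: mean_const assms(1))
qed

text \<open>Since \<open>exp u \<le> 1 + 2 * u\<close> on [0, 1], a mean of at most a / 4 gives an
  exponential moment of at most exp (a / (2 M)), against the Markov factor exp (- a / M). At four
  times the mean no optimisation of the exponent is needed.\<close>

lemma upper_tail:
  assumes "finite D" "finite F" "inj_on key F" "key ` F \<subseteq> D" "0 < M"
    and w: "\<And>e. e \<in> F \<Longrightarrow> 0 \<le> w e" "\<And>e. e \<in> F \<Longrightarrow> w e \<le> M"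
    and Y: "\<And>e s. e \<in> F \<Longrightarrow> Y e s = 0 \<or> Y e s = 1"
    and q: "\<And>e. e \<in> F \<Longrightarrow> (\<Sum>s\<in>UNIV. p (key e) s * Y e s) \<le> q e"
    and a: "(\<Sum>e\<in>F. q e * w e) \<le> a / 4"
  shows "mean D \<omega> (\<lambda>x. of_bool (a < (\<Sum>e\<in>F. w e * Y e (x (key e))))) \<le> exp (- (a / (2 * M)))"
proof -
  let ?S = "key ` F"
  let ?B = "\<lambda>x. a < (\<Sum>e\<in>F. w e * Y e (x (key e)))"
  define u where "u = (\<lambda>e. w e / M)"
  have u: "0 \<le> u e" "u e \<le> 1" if "e \<in> F" for e
    using w that \<open>0 < M\<close> by (auto simp: u_def)
  have au: "(\<Sum>e\<in>F. q e * u e) \<le> a / (4 * M)"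
    using a \<open>0 < M\<close> by (simp add: u_def sum_divide_distrib[symmetric] field_simps)
  have "mean ?S x (\<lambda>x. of_bool (?B x)) \<le> exp (- (a / (2 * M)))" for x
  proof -
    have "mean ?S x (\<lambda>x. of_bool (?B x))
      \<le> mean ?S x (\<lambda>y. exp (- (a / M)) * (\<Prod>e\<in>F. exp (u e * Y e (y (key e)))))"
    proof (rule mean_mono)
      fix y
      have eq: "exp (- (a / M)) * (\<Prod>e\<in>F. exp (u e * Y e (y (key e))))
         = exp (((\<Sum>e\<in>F. w e * Y e (y (key e))) - a) / M)"
        using \<open>0 < M\<close>
        by (simp add: exp_sum[OF assms(2), symmetric] exp_add[symmetric] u_def
              diff_divide_distrib sum_divide_distrib)
      show "of_bool (?B y) \<le> exp (- (a / M)) * (\<Prod>e\<in>F. exp (u e * Y e (y (key e))))"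
        unfolding eq using \<open>0 < M\<close> by (auto simp: of_bool_def)
    qed
    also have "\<dots> = exp (- (a / M)) * (\<Prod>e\<in>F. \<Sum>s\<in>UNIV. p (key e) s * exp (u e * Y e s))"
      unfolding mean_cmult by (subst mean_prod[OF assms(2,3)]) simp
    also have "\<dots> \<le> exp (- (a / M)) * (\<Prod>e\<in>F. exp (2 * (q e * u e)))"
    proof (intro mult_left_mono prod_mono conjI)
      fix e assume e: "e \<in> F"
      show "0 \<le> (\<Sum>s\<in>UNIV. p (key e) s * exp (u e * Y e s))"
        by (intro sum_nonneg mult_nonneg_nonneg p_nonneg) simp
      have ex: "exp (u e) \<le> 1 + 2 * u e"
      proof -
        have "exp (u e) \<le> 1 + u e + (u e)\<^sup>2" using u[OF e] by (intro exp_bound) auto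
        moreover have "(u e)\<^sup>2 \<le> u e"
          using u[OF e] by (simp add: power2_eq_square mult_left_le_one_le)
        ultimately show ?thesis by linarith
      qed
      have "(\<Sum>s\<in>UNIV. p (key e) s * exp (u e * Y e s))
         \<le> (\<Sum>s\<in>UNIV. p (key e) s + 2 * u e * (p (key e) s * Y e s))"
      proof (rule sum_mono)
        fix s
        have "p (key e) s * exp (u e * Y e s) \<le> p (key e) s * (1 + 2 * u e * Y e s)"
          using Y[OF e, of s] ex by (intro mult_left_mono p_nonneg) auto
        thus "p (key e) s * exp (u e * Y e s) \<le> p (key e) s + 2 * u e * (p (key e) s * Y e s)"
          by (simp add: algebra_simps)
      qed
      also have "\<dots> = 1 + 2 * u e * (\<Sum>s\<in>UNIV. p (key e) s * Y e s)"
        by (simp add: sum.distrib p_sum sum_distrib_left[symmetric])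
      also have "\<dots> \<le> 1 + 2 * u e * q e"
        using q[OF e] u[OF e] by (intro add_left_mono mult_left_mono) auto
      also have "\<dots> \<le> exp (2 * (q e * u e))"
        using exp_ge_add_one_self[of "2 * (q e * u e)"] by (simp add: mult_ac)
      finally show "(\<Sum>s\<in>UNIV. p (key e) s * exp (u e * Y e s)) \<le> exp (2 * (q e * u e))" .
    qed auto
    also have "\<dots> = exp (2 * (\<Sum>e\<in>F. q e * u e) - a / M)"
      by (simp add: exp_sum[OF assms(2), symmetric] exp_add[symmetric] sum_distrib_left)
    also have "\<dots> \<le> exp (- (a / (2 * M)))"
      using au \<open>0 < M\<close> by (simp add: field_simps)
    finally show ?thesis .
  qed
  thus ?thesis
    using mean_mult_le[OF assms(1,4), of "\<lambda>_. 1" "\<lambda>x. of_bool (?B x)" _ \<omega>] by (simp add: mean_const assms(1))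
qed

end

section \<open>Dyads of the \<open>p\<^sub>1\<close> model\<close>

definition dyad :: "nat \<Rightarrow> nat \<Rightarrow> nat \<times> nat" where
  "dyad x y = (if x < y then (x, y) else (y, x))"

definition dyads :: "nat \<Rightarrow> (nat \<times> nat) set" where
  "dyads n = {(i, j). i < j \<and> j < n}"

text \<open>For x < y the state at (x, y) is the pair (edge from x to y, edge from y to x). Values
  at pairs not of this form are ignored, so every configuration decodes to a loopless
  network.\<close>

definition adj :: "(nat \<times> nat \<Rightarrow> bool \<times> bool) \<Rightarrow> adjm" where
  "adj \<omega> x y = (if x < y then fst (\<omega> (x, y)) else if y < x then snd (\<omega> (y, x)) else False)"

text \<open>The one-way edge from \<open>x\<close> to \<open>y\<close> is the state (True, False) if
  \<open>x < y\<close> and (False, True) otherwise; one formula covers both orientations.\<close>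

definition J10 :: "nat \<Rightarrow> nat \<Rightarrow> bool \<times> bool \<Rightarrow> real" where
  "J10 x y s = of_bool (s = (x < y, \<not> x < y))"

definition J11 :: "bool \<times> bool \<Rightarrow> real" where
  "J11 s = of_bool (s = (True, True))"

definition J00 :: "bool \<times> bool \<Rightarrow> real" where
  "J00 s = of_bool (s = (False, False))"

lemma dyad_eq_iff: "dyad x y = dyad u w \<longleftrightarrow> x = u \<and> y = w \<or> x = w \<and> y = u"
  by (auto simp: dyad_def)

lemma dyad_commute: "dyad x y = dyad y x"
  by (auto simp: dyad_def)

lemma dyad_in_dyads [simp]: "dyad x y \<in> dyads n \<longleftrightarrow> x < n \<and> y < n \<and> x \<noteq> y"
  by (auto simp: dyad_def dyads_def)

lemma finite_dyads [simp]: "finite (dyads n)"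
  by (rule finite_subset[of _ "{..<n} \<times> {..<n}"]) (auto simp: dyads_def)

lemma A10_adj: "x \<noteq> y \<Longrightarrow> A10 (adj \<omega>) x y = J10 x y (\<omega> (dyad x y))"
  and A11_adj: "x \<noteq> y \<Longrightarrow> A11 (adj \<omega>) x y = J11 (\<omega> (dyad x y))"
  and A00_adj: "x \<noteq> y \<Longrightarrow> A00 (adj \<omega>) x y = J00 (\<omega> (dyad x y))"
  by (auto simp: A10_def A11_def A00_def J10_def J11_def J00_def adj_def dyad_def
        prod_eq_iff of_bool_def)

lemma A_refl [simp]: "A10 A x x = 0" "A00 A x x = 0" "A11 (adj \<omega>) x x = 0"
  by (auto simp: A10_def A00_def A11_def adj_def)

lemma A_comm: "A11 A x y = A11 A y x" "A00 A x y = A00 A y x"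
  by (auto simp: A11_def A00_def of_bool_def)

lemma A_range: "0 \<le> A10 A x y" "A10 A x y \<le> 1" "0 \<le> A11 A x y" "A11 A x y \<le> 1"
  "0 \<le> A00 A x y" "A00 A x y \<le> 1"
  by (auto simp: A10_def A00_def A11_def)

lemma A_idem: "A10 A x y * A10 A x y = A10 A x y" "A11 A x y * A11 A x y = A11 A x y"
  by (auto simp: A10_def A11_def)

lemma A10_opposite: "A10 A x y * A10 A y x = 0"
  by (auto simp: A10_def)

lemma J_01: "J10 x y s = 0 \<or> J10 x y s = 1" "J11 s = 0 \<or> J11 s = 1" "J00 s = 0 \<or> J00 s = 1"
  by (auto simp: J10_def J11_def J00_def)

lemma indep_adj:
  assumes "dyad x y \<notin> S"
  shows "indep_of S (\<lambda>\<omega>. A10 (adj \<omega>) x y)" "indep_of S (\<lambda>\<omega>. A11 (adj \<omega>) x y)"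
    "indep_of S (\<lambda>\<omega>. A00 (adj \<omega>) x y)"
proof -
  have "adj \<omega>' x y = adj \<omega> x y \<and> adj \<omega>' y x = adj \<omega> y x" if "\<omega>' \<in> cyl S \<omega>" for \<omega> \<omega>'
  proof -
    have "\<omega>' (dyad x y) = \<omega> (dyad x y)"
      using that assms unfolding cyl_def by blast
    thus ?thesis by (auto simp: adj_def dyad_def split: if_splits)
  qed
  thus "indep_of S (\<lambda>\<omega>. A10 (adj \<omega>) x y)" "indep_of S (\<lambda>\<omega>. A11 (adj \<omega>) x y)"
    "indep_of S (\<lambda>\<omega>. A00 (adj \<omega>) x y)"
    by (auto simp: indep_of_def A10_def A11_def A00_def)
qed

lemma sum_bool_pairs: "(\<Sum>s\<in>UNIV. f s) = f (False, False) + f (False, True) + f (True, False) + f (True, True)"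
  for f :: "bool \<times> bool \<Rightarrow> real"
proof -
  have U: "(UNIV :: (bool \<times> bool) set) = {(False, False), (False, True), (True, False), (True, True)}"
    by auto
  show ?thesis unfolding U by (simp add: add_ac)
qed

lemma finite_quads [simp]: "finite (quads n)"
  by (rule finite_subset[of _ "{..<n} \<times> {..<n} \<times> {..<n} \<times> {..<n}"]) (auto simp: quads_def)

lemma p1_K_sym: "p1_K \<rho> \<gamma> \<alpha> \<beta> x y = p1_K \<rho> \<gamma> \<alpha> \<beta> y x"
  by (simp add: p1_K_def add_ac)

locale p1_model =
  fixes n :: nat and \<rho> \<gamma> :: real and \<alpha> \<beta> :: "nat \<Rightarrow> real"
begin

definition pr :: "nat \<times> nat \<Rightarrow> bool \<times> bool \<Rightarrow> real" where
  "pr d s = p1_dyad_prob \<rho> \<gamma> \<alpha> \<beta> (fst d) (snd d) (fst s) (snd s)"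

abbreviation "m \<equiv> mu \<gamma> \<alpha>"
abbreviation "v \<equiv> nu \<gamma> \<beta>"
abbreviation "h \<equiv> eta \<gamma> \<alpha> \<beta>"
abbreviation "K \<equiv> p1_K \<rho> \<gamma> \<alpha> \<beta>"
abbreviation "e \<equiv> exp \<rho>"

lemma pos: "0 < m x" "0 < v x" "0 < h x" "0 < K x y"
  by (auto simp: mu_def nu_def eta_def p1_K_def intro!: add_pos_pos)

lemma nonneg: "0 \<le> m x" "0 \<le> v x" "0 \<le> h x" "0 \<le> K x y"
  using pos[of x] pos(4)[of x y] by (auto intro: less_imp_le)

lemma pr_simps:
  "pr (x, y) (False, False) = K x y"
  "pr (x, y) (True, False) = K x y * (m x * v y)"
  "pr (x, y) (False, True) = K x y * (m y * v x)"
  "pr (x, y) (True, True) = K x y * (e * h x * h y)"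
proof -
  have mv: "exp (\<gamma> + \<alpha> x + \<beta> y) = m x * v y" for x y
    by (simp add: mu_def nu_def exp_add[symmetric])
  have hh: "exp (\<gamma> + \<alpha> x + \<beta> y + (\<gamma> + \<alpha> y + \<beta> x) + \<rho>) = e * h x * h y"
    unfolding exp_add[of _ \<rho>] exp_add[of "\<gamma> + \<alpha> x + \<beta> y" "\<gamma> + \<alpha> y + \<beta> x"] mv eta_def
    by (simp only: mult_ac)
  show "pr (x, y) (False, False) = K x y"
    "pr (x, y) (True, False) = K x y * (m x * v y)"
    "pr (x, y) (False, True) = K x y * (m y * v x)"
    by (simp_all add: pr_def p1_dyad_prob_def mv)
  have "pr (x, y) (True, True) = K x y * exp (\<gamma> + \<alpha> x + \<beta> y + (\<gamma> + \<alpha> y + \<beta> x) + \<rho>)"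
    by (simp only: pr_def p1_dyad_prob_def fst_conv snd_conv of_bool_eq(2) simp_thms mult_1)
  thus "pr (x, y) (True, True) = K x y * (e * h x * h y)"
    by (simp only: hh)
qed

lemma K_eq: "K x y = 1 / (1 + m x * v y + m y * v x + e * h x * h y)"
proof -
  have 1: "m x * v y = exp (\<gamma> + \<alpha> x + \<beta> y)" for x y
    by (simp add: mu_def nu_def exp_add[symmetric])
  have "e * h x * h y = e * (m x * v y) * (m y * v x)"
    by (simp add: eta_def)
  also have "\<dots> = exp (2 * \<gamma> + \<alpha> x + \<beta> y + \<alpha> y + \<beta> x + \<rho>)"
    unfolding 1 exp_add[symmetric] by (rule arg_cong[of _ _ exp]) simp
  finally show ?thesis by (simp only: p1_K_def inverse_eq_divide 1)
qed

lemma K_le_1: "K x y \<le> 1"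
proof -
  have "0 \<le> m x * v y + m y * v x + e * h x * h y"
    by (intro add_nonneg_nonneg mult_nonneg_nonneg nonneg) simp
  thus ?thesis by (simp add: K_eq divide_le_eq_1)
qed

lemma K_sum: "K x y + K x y * (m x * v y) + K x y * (m y * v x) + K x y * (e * h x * h y) = 1"
proof -
  have "0 \<le> m x * v y + m y * v x + e * h x * h y"
    by (intro add_nonneg_nonneg mult_nonneg_nonneg nonneg) simp
  hence "1 + m x * v y + m y * v x + e * h x * h y \<noteq> 0" by linarith
  thus ?thesis by (simp add: K_eq add_divide_distrib[symmetric])
qed

sublocale product_prob pr
proof
  show "0 \<le> pr d s" for d s
    by (simp add: pr_def p1_dyad_prob_def nonneg)
  show "(\<Sum>s\<in>UNIV. pr d s) = 1" for d
    using K_sum[of "fst d" "snd d"] by (cases d) (simp add: sum_bool_pairs pr_simps)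
qed

lemma prob_J:
  shows "x \<noteq> y \<Longrightarrow> (\<Sum>s\<in>UNIV. pr (dyad x y) s * J10 x y s) = K x y * (m x * v y)"
    and "(\<Sum>s\<in>UNIV. pr (dyad x y) s * J11 s) = K x y * (e * h x * h y)"
    and "(\<Sum>s\<in>UNIV. pr (dyad x y) s * J00 s) = K x y"
proof -
  note defs = sum_bool_pairs dyad_def J10_def J11_def J00_def pr_simps p1_K_sym[of \<rho> \<gamma> \<alpha> \<beta> y x]
  show "(\<Sum>s\<in>UNIV. pr (dyad x y) s * J10 x y s) = K x y * (m x * v y)" if "x \<noteq> y"
    by (cases "x < y") (simp_all add: defs)
  show "(\<Sum>s\<in>UNIV. pr (dyad x y) s * J11 s) = K x y * (e * h x * h y)"
    by (cases "x < y") (simp_all add: defs)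
  show "(\<Sum>s\<in>UNIV. pr (dyad x y) s * J00 s) = K x y"
    by (cases "x < y") (simp_all add: defs)
qed

lemma mean_A_mult:
  assumes "finite D" "x \<noteq> y" "dyad x y \<in> D" "indep_of {dyad x y} g"
  shows "mean D \<omega> (\<lambda>\<omega>. A10 (adj \<omega>) x y * g \<omega>) = K x y * (m x * v y) * mean D \<omega> g"
    and "mean D \<omega> (\<lambda>\<omega>. A11 (adj \<omega>) x y * g \<omega>) = K x y * (e * h x * h y) * mean D \<omega> g"
    and "mean D \<omega> (\<lambda>\<omega>. A00 (adj \<omega>) x y * g \<omega>) = K x y * mean D \<omega> g"
  using assms(2) mean_coord[OF assms(1,3,4), of \<omega>]
  by (simp_all add: A10_adj A11_adj A00_adj prob_J)

lemma mean_A: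
  assumes "finite D" "x \<noteq> y" "dyad x y \<in> D"
  shows "mean D \<omega> (\<lambda>\<omega>. A10 (adj \<omega>) x y) = K x y * (m x * v y)"
    and "mean D \<omega> (\<lambda>\<omega>. A11 (adj \<omega>) x y) = K x y * (e * h x * h y)"
    and "mean D \<omega> (\<lambda>\<omega>. A00 (adj \<omega>) x y) = K x y"
  using mean_A_mult[OF assms, of "\<lambda>_. 1" \<omega>] by (simp_all add: mean_const assms)

abbreviation "E f \<equiv> mean (dyads n) (\<lambda>_. (False, False)) (\<lambda>\<omega>. f (adj \<omega>))"

text \<open>Freezing all coordinates outside the dyads at (False, False) makes decoding a bijection
  from the cylinder onto the networks on the nodes, under which the product of the dyad laws becomes
  \<open>p1_prob\<close>.\<close>

lemma p1_E_eq: "p1_E n \<rho> \<gamma> \<alpha> \<beta> f = E f"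
  unfolding p1_E_def mean_def
proof (rule sum.reindex_bij_witness[of _ adj
      "\<lambda>A d. if d \<in> dyads n then (A (fst d) (snd d), A (snd d) (fst d)) else (False, False)"], goal_cases)
  case (1 A)
  then show ?case
    by (intro ext) (auto simp: adj_mats_def adj_def dyads_def)
next
  case (2 A)
  then show ?case by (auto simp: cyl_def)
next
  case (3 \<omega>)
  then show ?case
    by (intro ext) (auto simp: cyl_def adj_def dyads_def prod_eq_iff)
next
  case (4 \<omega>)
  have "y < n" if "fst (\<omega> (x, y)) \<or> snd (\<omega> (x, y))" for x y
  proof (rule ccontr)
    assume "\<not> y < n"
    hence "\<omega> (x, y) = (False, False)" using 4 by (auto simp: cyl_def dyads_def)
    thus False using that by simp
  qed
  then show ?case
    by (fastforce simp: adj_mats_def adj_def dest: less_trans split: if_splits)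
next
  case (5 A)
  have "adj (\<lambda>d. if d \<in> dyads n then (A (fst d) (snd d), A (snd d) (fst d)) else (False, False)) = A"
    using 5 by (intro ext) (auto simp: adj_mats_def adj_def dyads_def)
  moreover have "p1_prob n \<rho> \<gamma> \<alpha> \<beta> A = (\<Prod>d\<in>dyads n. pr d (A (fst d) (snd d), A (snd d) (fst d)))"
    unfolding p1_prob_def dyads_def by (intro prod.cong refl) (auto simp: pr_def)
  ultimately show ?case by simp
qed

text \<open>The product is nested to the right, so that \<open>mean_A_mult\<close> peels off one
  factor at a time; \<open>A01\<close> is replaced by \<open>A10\<close> with swapped
  indices.\<close>

definition Ta :: "adjm \<Rightarrow> nat \<Rightarrow> nat \<Rightarrow> nat \<Rightarrow> nat \<Rightarrow> real" where
  "Ta A i j k l = A11 A i j * (A00 A j k * (A10 A l k * A00 A l i))"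

definition Tb :: "adjm \<Rightarrow> nat \<Rightarrow> nat \<Rightarrow> nat \<Rightarrow> nat \<Rightarrow> real" where
  "Tb A i j k l = A10 A i j * (A10 A j k * (A00 A k l * A10 A l i))"

lemma Qa_eq: "Qa n A = (\<Sum>(i, j, k, l)\<in>quads n. Ta A i j k l)"
  unfolding Qa_def Ta_def A01_def by (intro sum.cong refl) (auto simp: mult_ac)

lemma Qb_eq: "Qb n A = (\<Sum>(i, j, k, l)\<in>quads n. Tb A i j k l)"
  unfolding Qb_def Tb_def by (intro sum.cong refl) (auto simp: mult_ac)

text \<open>Four distinct nodes give four distinct dyads, hence a product of four probabilities. In
  the b-pattern the path from \<open>l\<close> through \<open>i\<close> and \<open>j\<close> to
  \<open>k\<close> collects \<open>m i * v i\<close> and \<open>m j * v j\<close> at its inner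
  nodes, which are \<open>h i\<close> and \<open>h j\<close>; only the factor \<open>e\<close> is
  missing.\<close>

lemma mean_Tab:
  assumes "(i, j, k, l) \<in> quads n"
  shows "E (\<lambda>A. Ta A i j k l) = K i j * K j k * K k l * K l i * (e * h i * h j * m l * v k)"
    and "E (\<lambda>A. Tb A i j k l) = K i j * K j k * K k l * K l i * (h i * h j * m l * v k)"
proof -
  have lt: "i < n" "j < n" "k < n" "l < n" and d: "distinct [i, j, k, l]"
    using assms by (auto simp: quads_def)
  show "E (\<lambda>A. Ta A i j k l) = K i j * K j k * K k l * K l i * (e * h i * h j * m l * v k)"
    unfolding Ta_def using lt d
    by (simp add: mean_A_mult mean_A indep_of_mult indep_adj dyad_eq_iff)
       (simp add: p1_K_sym[of _ _ _ _ l k] mult_ac)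
  show "E (\<lambda>A. Tb A i j k l) = K i j * K j k * K k l * K l i * (h i * h j * m l * v k)"
    unfolding Tb_def using lt d
    by (simp add: mean_A_mult mean_A indep_of_mult indep_adj dyad_eq_iff)
       (simp add: eta_def mult_ac)
qed

lemma mean_Qa: "E (Qa n) = (\<Sum>(i, j, k, l)\<in>quads n. E (\<lambda>A. Ta A i j k l))"
  by (simp add: Qa_eq mean_sum case_prod_beta)

lemma mean_Qb: "E (Qb n) = (\<Sum>(i, j, k, l)\<in>quads n. E (\<lambda>A. Tb A i j k l))"
  by (simp add: Qb_eq mean_sum case_prod_beta)

lemma mean_Qa_eq_Qb: "E (Qa n) = e * E (Qb n)"
  unfolding mean_Qa mean_Qb sum_distrib_left by (intro sum.cong refl) (auto simp: mean_Tab)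

lemma mean_Ustat: "E (Ustat n \<rho>) = 0"
  by (simp add: Ustat_def mean_diff mean_cmult mean_Qa_eq_Qb)

lemma p1_Var_Ustat: "p1_Var n \<rho> \<gamma> \<alpha> \<beta> (Ustat n \<rho>) = E (\<lambda>A. (Ustat n \<rho> A)\<^sup>2)"
  by (simp add: p1_Var_def p1_E_eq mean_Ustat)

end

section \<open>Second moments of path counts\<close>

context p1_model
begin

text \<open>The flag \<open>t\<close> selects the transposed network, in which \<open>\<mu>\<close> and \<open>\<nu>\<close> change roles. Below,
  \<open>F False\<close> and \<open>F True\<close> are the \<open>\<ell>\<^sup>1\<close> norms of \<open>\<mu>\<close> and \<open>\<nu>\<close>, \<open>H\<close> is that of \<open>\<eta>\<close>, and \<open>G False\<close>, \<open>G True\<close>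
  are the inner products of \<open>\<mu>\<close> and \<open>\<nu>\<close> with \<open>\<eta>\<close>.\<close>

definition B :: "bool \<Rightarrow> adjm \<Rightarrow> nat \<Rightarrow> nat \<Rightarrow> real" where
  "B t A x y = (if t then A10 A y x else A10 A x y)"

definition f :: "bool \<Rightarrow> nat \<Rightarrow> real" where
  "f t = (if t then v else m)"

definition F :: "bool \<Rightarrow> real" where
  "F t = (\<Sum>i<n. f t i)"

definition H :: real where
  "H = (\<Sum>i<n. h i)"

definition G :: "bool \<Rightarrow> real" where
  "G t = (\<Sum>i<n. f t i * h i)"

lemma f_nonneg: "0 \<le> f t i"
  by (simp add: f_def nonneg)

lemma f_mult: "f t i * f (\<not> t) i = h i" "f (\<not> t) i * f t i = h i"
  by (auto simp: f_def eta_def)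

lemma B_transpose: "B (\<not> t) A x y = B t A y x"
  by (simp add: B_def)

lemma B_range: "0 \<le> B t A x y" "B t A x y \<le> 1"
  by (auto simp: B_def A_range)

lemma B_idem: "B t A x y * B t A x y = B t A x y"
  by (auto simp: B_def A10_def)

lemma indep_B: "dyad x y \<notin> S \<Longrightarrow> indep_of S (\<lambda>\<omega>. B t (adj \<omega>) x y)"
  unfolding B_def using indep_adj(1)[of x y S] indep_adj(1)[of y x S] by (cases t) (simp_all add: dyad_commute)

lemma sums_nonneg: "0 \<le> F t" "0 \<le> H" "0 \<le> G t"
  by (auto simp: F_def H_def G_def intro!: sum_nonneg mult_nonneg_nonneg f_nonneg nonneg)

lemma mean_B_le:
  assumes "finite D" "x \<noteq> y" "dyad x y \<in> D"
  shows "mean D \<omega> (\<lambda>\<omega>. B t (adj \<omega>) x y) \<le> f t x * f (\<not> t) y"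
proof -
  have "K x y * c \<le> c" "K y x * c \<le> c" if "0 \<le> c" for c
    using K_le_1 that nonneg by (simp_all add: mult_left_le_one_le)
  thus ?thesis
    using mean_A(1)[OF assms, of \<omega>] mean_A(1)[OF assms(1), of y x \<omega>] assms(2,3) nonneg
    by (simp add: B_def f_def dyad_commute[of y x] mult.commute[of "v x"])
qed

text \<open>\<open>Z\<close> may contain both orientations of a dyad: the two one-way edges exclude
  each other, so their joint mean is 0. For different dyads one edge is integrated out after the
  other.\<close>

lemma second_moment_B:
  assumes "finite D" "finite Z" "\<And>x y. (x, y) \<in> Z \<Longrightarrow> x \<noteq> y" "\<And>x y. (x, y) \<in> Z \<Longrightarrow> dyad x y \<in> D"
    and w: "\<And>d. d \<in> Z \<Longrightarrow> indep_of (case_prod dyad ` Z) (w d)" "\<And>d \<omega>. d \<in> Z \<Longrightarrow> 0 \<le> w d \<omega>"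
  shows "mean D \<omega> (\<lambda>\<omega>. (\<Sum>d\<in>Z. B t (adj \<omega>) (fst d) (snd d) * w d \<omega>)\<^sup>2)
    \<le> mean D \<omega> (\<lambda>\<omega>. (\<Sum>d\<in>Z. f t (fst d) * f (\<not> t) (snd d) * w d \<omega>)\<^sup>2)
      + (\<Sum>d\<in>Z. f t (fst d) * f (\<not> t) (snd d) * mean D \<omega> (\<lambda>\<omega>. (w d \<omega>)\<^sup>2))"
proof (rule second_moment[where S = "case_prod dyad ` Z"])
  let ?S = "case_prod dyad ` Z"
  have fin: "finite ?S" using assms(2) by simp
  show "mean ?S \<omega> (\<lambda>\<omega>. B t (adj \<omega>) (fst d) (snd d)) \<le> f t (fst d) * f (\<not> t) (snd d)"
    if "d \<in> Z" for d \<omega>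
    using that assms(3)[of "fst d" "snd d"] by (intro mean_B_le fin) (auto simp: image_iff intro!: bexI[of _ d] split: prod.splits)
  show "B t (adj \<omega>) (fst d) (snd d) * B t (adj \<omega>) (fst d) (snd d) = B t (adj \<omega>) (fst d) (snd d)" for d \<omega>
    by (rule B_idem)
  show "mean ?S \<omega> (\<lambda>\<omega>. B t (adj \<omega>) (fst d) (snd d) * B t (adj \<omega>) (fst d') (snd d'))
     \<le> f t (fst d) * f (\<not> t) (snd d) * (f t (fst d') * f (\<not> t) (snd d'))"
    if d: "d \<in> Z" "d' \<in> Z" "d \<noteq> d'" for d d' \<omega>
  proof (cases "case_prod dyad d = case_prod dyad d'")
    case True
    hence "d' = (snd d, fst d)" using d by (cases d; cases d') (auto simp: dyad_eq_iff)
    hence "B t A (fst d) (snd d) * B t A (fst d') (snd d') = 0" for A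
      using A10_opposite[of A] by (simp add: B_def)
    hence "mean ?S \<omega> (\<lambda>\<omega>. B t (adj \<omega>) (fst d) (snd d) * B t (adj \<omega>) (fst d') (snd d')) = 0"
      using mean_const[OF fin, of \<omega> 0] by (simp only:)
    thus ?thesis by (simp add: f_nonneg)
  next
    case False
    obtain x y where [simp]: "d = (x, y)" by (cases d)
    obtain x' y' where [simp]: "d' = (x', y')" by (cases d')
    have ne: "x \<noteq> y" "x' \<noteq> y'" using assms(3) d by auto
    have "mean ?S \<omega> (\<lambda>\<omega>. B t (adj \<omega>) x' y' * B t (adj \<omega>) x y)
      \<le> f t x * f (\<not> t) y * mean ?S \<omega> (\<lambda>\<omega>. B t (adj \<omega>) x' y')"
    proof (rule mean_mult_le[OF fin, where S = "{dyad x y}"])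
      show "{dyad x y} \<subseteq> ?S" using d by force
      show "indep_of {dyad x y} (\<lambda>\<omega>. B t (adj \<omega>) x' y')" using False by (intro indep_B) auto
    qed (auto intro!: mean_B_le B_range ne)
    also have "\<dots> \<le> f t x * f (\<not> t) y * (f t x' * f (\<not> t) y')"
      using d by (intro mult_left_mono mean_B_le fin ne mult_nonneg_nonneg f_nonneg) force
    finally show ?thesis by (simp add: mult.commute)
  qed
qed (use assms in auto)

text \<open>One step of a path: the edges at \<open>x\<close> are integrated out, and
  \<open>w y\<close> carries the remainder of the path from \<open>y\<close>. The last term accounts
  for pairs of paths with the same first edge.\<close>

lemma second_moment_row:
  assumes "finite D" "finite Y" "x \<notin> Y" "\<And>y. y \<in> Y \<Longrightarrow> dyad x y \<in> D"
    and w: "\<And>y. y \<in> Y \<Longrightarrow> indep_of (dyad x ` Y) (w y)" "\<And>y \<omega>. y \<in> Y \<Longrightarrow> 0 \<le> w y \<omega>"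
  shows "mean D \<omega> (\<lambda>\<omega>. (\<Sum>y\<in>Y. B t (adj \<omega>) x y * w y \<omega>)\<^sup>2)
    \<le> (f t x)\<^sup>2 * mean D \<omega> (\<lambda>\<omega>. (\<Sum>y\<in>Y. f (\<not> t) y * w y \<omega>)\<^sup>2)
      + f t x * (\<Sum>y\<in>Y. f (\<not> t) y * mean D \<omega> (\<lambda>\<omega>. (w y \<omega>)\<^sup>2))"
proof -
  have S: "case_prod dyad ` Pair x ` Y = dyad x ` Y" by (auto simp: image_image)
  have inj: "inj_on (Pair x) Y" by (auto simp: inj_on_def)
  have "mean D \<omega> (\<lambda>\<omega>. (\<Sum>d\<in>Pair x ` Y. B t (adj \<omega>) (fst d) (snd d) * w (snd d) \<omega>)\<^sup>2)
    \<le> mean D \<omega> (\<lambda>\<omega>. (\<Sum>d\<in>Pair x ` Y. f t (fst d) * f (\<not> t) (snd d) * w (snd d) \<omega>)\<^sup>2)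
      + (\<Sum>d\<in>Pair x ` Y. f t (fst d) * f (\<not> t) (snd d) * mean D \<omega> (\<lambda>\<omega>. (w (snd d) \<omega>)\<^sup>2))"
    by (rule second_moment_B) (use assms in \<open>auto simp: S\<close>)
  also have "mean D \<omega> (\<lambda>\<omega>. (\<Sum>d\<in>Pair x ` Y. f t (fst d) * f (\<not> t) (snd d) * w (snd d) \<omega>)\<^sup>2)
    = (f t x)\<^sup>2 * mean D \<omega> (\<lambda>\<omega>. (\<Sum>y\<in>Y. f (\<not> t) y * w y \<omega>)\<^sup>2)"
    by (simp add: sum.reindex[OF inj] mult.assoc sum_distrib_left[symmetric] power_mult_distrib mean_cmult)
  finally show ?thesis
    by (simp add: sum.reindex[OF inj] mult.assoc sum_distrib_left[symmetric])
qed

lemma sum_mult_sum_bound: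
  fixes c d :: "nat \<Rightarrow> real"
  assumes "Z \<subseteq> {..<n} \<times> {..<n}" "\<And>i. 0 \<le> c i" "\<And>i. 0 \<le> d i"
  shows "(\<Sum>z\<in>Z. c (fst z) * d (snd z)) \<le> (\<Sum>i<n. c i) * (\<Sum>i<n. d i)"
proof -
  have "(\<Sum>z\<in>Z. c (fst z) * d (snd z)) \<le> (\<Sum>z\<in>{..<n} \<times> {..<n}. c (fst z) * d (snd z))"
    by (rule sum_mono2) (use assms in auto)
  thus ?thesis by (simp add: sum_product sum.cartesian_product case_prod_beta)
qed

lemma second_moment_edges:
  assumes "finite D" "Z \<subseteq> {..<n} \<times> {..<n}" "\<And>x y. (x, y) \<in> Z \<Longrightarrow> x \<noteq> y" "\<And>x y. (x, y) \<in> Z \<Longrightarrow> dyad x y \<in> D"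
    and c: "\<And>i. 0 \<le> c i" "\<And>i. 0 \<le> d i"
  shows "mean D \<omega> (\<lambda>\<omega>. (\<Sum>z\<in>Z. B t (adj \<omega>) (fst z) (snd z) * (c (fst z) * d (snd z)))\<^sup>2)
    \<le> ((\<Sum>i<n. f t i * c i) * (\<Sum>i<n. f (\<not> t) i * d i))\<^sup>2
      + (\<Sum>i<n. f t i * (c i)\<^sup>2) * (\<Sum>i<n. f (\<not> t) i * (d i)\<^sup>2)"
proof -
  have fin: "finite Z" using assms(2) by (auto intro: finite_subset)
  have "mean D \<omega> (\<lambda>\<omega>. (\<Sum>z\<in>Z. B t (adj \<omega>) (fst z) (snd z) * (c (fst z) * d (snd z)))\<^sup>2)
    \<le> mean D \<omega> (\<lambda>\<omega>. (\<Sum>z\<in>Z. f t (fst z) * f (\<not> t) (snd z) * (c (fst z) * d (snd z)))\<^sup>2)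
      + (\<Sum>z\<in>Z. f t (fst z) * f (\<not> t) (snd z) * mean D \<omega> (\<lambda>\<omega>. (c (fst z) * d (snd z))\<^sup>2))"
    by (rule second_moment_B) (use assms fin in auto)
  also have "\<dots> = (\<Sum>z\<in>Z. (f t (fst z) * c (fst z)) * (f (\<not> t) (snd z) * d (snd z)))\<^sup>2
      + (\<Sum>z\<in>Z. (f t (fst z) * (c (fst z))\<^sup>2) * (f (\<not> t) (snd z) * (d (snd z))\<^sup>2))"
    by (simp add: mean_const assms(1) power_mult_distrib mult_ac)
  also have "\<dots> \<le> ((\<Sum>i<n. f t i * c i) * (\<Sum>i<n. f (\<not> t) i * d i))\<^sup>2
      + (\<Sum>i<n. f t i * (c i)\<^sup>2) * (\<Sum>i<n. f (\<not> t) i * (d i)\<^sup>2)"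
    by (intro add_mono power_mono sum_nonneg sum_mult_sum_bound[where c = "\<lambda>i. f t i * c i"]
         sum_mult_sum_bound[where c = "\<lambda>i. f t i * (c i)\<^sup>2"] mult_nonneg_nonneg f_nonneg c assms(2)) simp_all
  finally show ?thesis .
qed

lemma sum_subset_le: "Y \<subseteq> {..<n} \<Longrightarrow> (\<And>i. 0 \<le> c i) \<Longrightarrow> (\<Sum>i\<in>Y. c i) \<le> (\<Sum>i<n. c i)"
  for c :: "nat \<Rightarrow> real"
  by (rule sum_mono2) auto

lemma second_moment_degree:
  assumes "finite D" "Y \<subseteq> {..<n}" "x \<notin> Y" "\<And>y. y \<in> Y \<Longrightarrow> dyad x y \<in> D" and c: "\<And>i. 0 \<le> c i"
  shows "mean D \<omega> (\<lambda>\<omega>. (\<Sum>y\<in>Y. B t (adj \<omega>) x y * c y)\<^sup>2)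
    \<le> (f t x)\<^sup>2 * (\<Sum>i<n. f (\<not> t) i * c i)\<^sup>2 + f t x * (\<Sum>i<n. f (\<not> t) i * (c i)\<^sup>2)"
proof -
  have fin: "finite Y" using assms(2) by (auto intro: finite_subset)
  have "mean D \<omega> (\<lambda>\<omega>. (\<Sum>y\<in>Y. B t (adj \<omega>) x y * c y)\<^sup>2)
    \<le> (f t x)\<^sup>2 * mean D \<omega> (\<lambda>\<omega>. (\<Sum>y\<in>Y. f (\<not> t) y * c y)\<^sup>2)
      + f t x * (\<Sum>y\<in>Y. f (\<not> t) y * mean D \<omega> (\<lambda>\<omega>. (c y)\<^sup>2))"
    by (rule second_moment_row) (use assms fin in auto)
  also have "\<dots> \<le> (f t x)\<^sup>2 * (\<Sum>i<n. f (\<not> t) i * c i)\<^sup>2 + f t x * (\<Sum>i<n. f (\<not> t) i * (c i)\<^sup>2)"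
    unfolding mean_const[OF assms(1)]
    by (intro add_mono mult_left_mono power_mono sum_nonneg mult_nonneg_nonneg f_nonneg c
        sum_subset_le assms(2)) auto
  finally show ?thesis .
qed

lemma second_moment_degree1:
  assumes "finite D" "Y \<subseteq> {..<n}" "x \<notin> Y" "\<And>y. y \<in> Y \<Longrightarrow> dyad x y \<in> D"
  shows "mean D \<omega> (\<lambda>\<omega>. (\<Sum>y\<in>Y. B t (adj \<omega>) x y)\<^sup>2)
    \<le> (f t x)\<^sup>2 * (F (\<not> t))\<^sup>2 + f t x * F (\<not> t)"
  using second_moment_degree[OF assms, of "\<lambda>_. 1" \<omega> t] by (simp add: F_def)

lemma sums_alt:
  "(\<Sum>i<n. f t i * f (\<not> t) i) = H" "(\<Sum>i<n. f (\<not> t) i * f t i) = H"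
  "(\<Sum>i<n. f t i * (f (\<not> t) i)\<^sup>2) = G (\<not> t)"
  "(\<Sum>i<n. f (\<not> t) i * (f t i)\<^sup>2) = G t"
  by (auto simp: H_def G_def f_def eta_def power2_eq_square mult_ac)

text \<open>\<open>Z y\<close> depends on \<open>y\<close> because the end must avoid
  \<open>x\<close> and \<open>y\<close>. Avoiding \<open>x\<close> keeps the second edges off the
  row at \<open>x\<close>, so the first step can be integrated out while they are held
  fixed.\<close>

lemma second_moment_2path_free:
  assumes "finite Y" "\<And>y. y \<in> Y \<Longrightarrow> finite (Z y)"
    and Y: "Y \<subseteq> {..<n}" "x < n" "x \<notin> Y"
    and Z: "\<And>y. y \<in> Y \<Longrightarrow> Z y \<subseteq> {..<n} - {x, y}"
  shows "mean (dyads n) \<omega> (\<lambda>\<omega>. (\<Sum>y\<in>Y. B t (adj \<omega>) x y * (\<Sum>z\<in>Z y. B t (adj \<omega>) y z))\<^sup>2)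
    \<le> (f t x)\<^sup>2 * (H\<^sup>2 * (F (\<not> t))\<^sup>2 + G (\<not> t) * F (\<not> t))
      + f t x * (G t * (F (\<not> t))\<^sup>2 + H * F (\<not> t))"
proof -
  let ?D = "dyads n"
  have "mean ?D \<omega> (\<lambda>\<omega>. (\<Sum>y\<in>Y. B t (adj \<omega>) x y * (\<Sum>z\<in>Z y. B t (adj \<omega>) y z))\<^sup>2)
    \<le> (f t x)\<^sup>2 * mean ?D \<omega> (\<lambda>\<omega>. (\<Sum>y\<in>Y. f (\<not> t) y * (\<Sum>z\<in>Z y. B t (adj \<omega>) y z))\<^sup>2)
      + f t x * (\<Sum>y\<in>Y. f (\<not> t) y * mean ?D \<omega> (\<lambda>\<omega>. (\<Sum>z\<in>Z y. B t (adj \<omega>) y z)\<^sup>2))"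
  proof (rule second_moment_row)
    fix y assume y: "y \<in> Y"
    show "indep_of (dyad x ` Y) (\<lambda>\<omega>. \<Sum>z\<in>Z y. B t (adj \<omega>) y z)"
      using Y y Z[OF y] by (intro indep_of_sum indep_B) (auto simp: dyad_eq_iff)
  qed (use assms in \<open>auto intro!: sum_nonneg B_range\<close>)
  also have "mean ?D \<omega> (\<lambda>\<omega>. (\<Sum>y\<in>Y. f (\<not> t) y * (\<Sum>z\<in>Z y. B t (adj \<omega>) y z))\<^sup>2)
     \<le> (H * F (\<not> t))\<^sup>2 + G (\<not> t) * F (\<not> t)"
  proof -
    have "(\<Sum>y\<in>Y. f (\<not> t) y * (\<Sum>z\<in>Z y. B t (adj \<omega>) y z))
       = (\<Sum>z\<in>Sigma Y Z. B t (adj \<omega>) (fst z) (snd z) * (f (\<not> t) (fst z) * 1))" for \<omega>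
      using assms(1,2) by (simp add: sum_distrib_left sum.Sigma case_prod_beta mult_ac)
    thus ?thesis
      using second_moment_edges[of ?D "Sigma Y Z" "f (\<not> t)" "\<lambda>_. 1" \<omega> t] Y Z
      by (auto simp: sums_alt F_def f_nonneg dest: subsetD)
  qed
  also have "(\<Sum>y\<in>Y. f (\<not> t) y * mean ?D \<omega> (\<lambda>\<omega>. (\<Sum>z\<in>Z y. B t (adj \<omega>) y z)\<^sup>2))
     \<le> (\<Sum>y\<in>Y. f (\<not> t) y * ((f t y)\<^sup>2 * (F (\<not> t))\<^sup>2 + f t y * F (\<not> t)))"
    using Y Z by (intro sum_mono mult_left_mono second_moment_degree1 f_nonneg) (auto simp: subset_iff)
  also have "\<dots> \<le> (\<Sum>y<n. f (\<not> t) y * ((f t y)\<^sup>2 * (F (\<not> t))\<^sup>2 + f t y * F (\<not> t)))"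
    by (rule sum_subset_le[OF Y(1)]) (auto intro!: mult_nonneg_nonneg add_nonneg_nonneg f_nonneg sums_nonneg)
  also have "\<dots> = G t * (F (\<not> t))\<^sup>2 + H * F (\<not> t)"
    by (simp add: ring_distribs sum.distrib mult.assoc[symmetric] sum_distrib_right[symmetric] sums_alt)
  finally show ?thesis
    by (simp add: f_nonneg mult_left_mono power_mult_distrib)
qed

text \<open>Edges entering \<open>z\<close> leave \<open>z\<close> in the transposed network, so
  this is the degree bound with the flag negated.\<close>

lemma second_moment_column:
  assumes "Y \<subseteq> {..<n} - {z}" "z < n"
  shows "mean (dyads n) \<omega> (\<lambda>\<omega>. (\<Sum>y\<in>Y. f (\<not> t) y * B t (adj \<omega>) y z)\<^sup>2)
    \<le> (f (\<not> t) z)\<^sup>2 * H\<^sup>2 + f (\<not> t) z * G (\<not> t)"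
proof -
  have "mean (dyads n) \<omega> (\<lambda>\<omega>. (\<Sum>y\<in>Y. B (\<not> t) (adj \<omega>) z y * f (\<not> t) y)\<^sup>2)
    \<le> (f (\<not> t) z)\<^sup>2 * (\<Sum>i<n. f (\<not> \<not> t) i * f (\<not> t) i)\<^sup>2
      + f (\<not> t) z * (\<Sum>i<n. f (\<not> \<not> t) i * (f (\<not> t) i)\<^sup>2)"
    by (rule second_moment_degree) (use assms in \<open>auto simp: f_nonneg\<close>)
  thus ?thesis by (simp add: B_transpose mult.commute[of "f (\<not> t) _" "B t _ _ _"] sums_alt)
qed

text \<open>The dyads at \<open>x\<close> and those at \<open>z\<close> are disjoint families
  because the middle node avoids both ends. With both ends fixed, a shared first edge means a shared
  path; hence the term with a single factor \<open>H\<close>.\<close>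

lemma second_moment_2path_fixed:
  assumes "Y \<subseteq> {..<n} - {x, z}" "x < n" "z < n" "x \<noteq> z"
  shows "mean (dyads n) \<omega> (\<lambda>\<omega>. (\<Sum>y\<in>Y. B t (adj \<omega>) x y * B t (adj \<omega>) y z)\<^sup>2)
    \<le> (f t x)\<^sup>2 * ((f (\<not> t) z)\<^sup>2 * H\<^sup>2 + f (\<not> t) z * G (\<not> t)) + f t x * f (\<not> t) z * H"
proof -
  let ?D = "dyads n"
  have "mean ?D \<omega> (\<lambda>\<omega>. (\<Sum>y\<in>Y. B t (adj \<omega>) x y * B t (adj \<omega>) y z)\<^sup>2)
    \<le> (f t x)\<^sup>2 * mean ?D \<omega> (\<lambda>\<omega>. (\<Sum>y\<in>Y. f (\<not> t) y * B t (adj \<omega>) y z)\<^sup>2)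
      + f t x * (\<Sum>y\<in>Y. f (\<not> t) y * mean ?D \<omega> (\<lambda>\<omega>. (B t (adj \<omega>) y z)\<^sup>2))"
    using assms by (intro second_moment_row) (auto intro!: B_range indep_B simp: dyad_eq_iff intro: finite_subset)
  also have "mean ?D \<omega> (\<lambda>\<omega>. (\<Sum>y\<in>Y. f (\<not> t) y * B t (adj \<omega>) y z)\<^sup>2)
     \<le> (f (\<not> t) z)\<^sup>2 * H\<^sup>2 + f (\<not> t) z * G (\<not> t)"
    by (rule second_moment_column) (use assms in auto)
  also have "(\<Sum>y\<in>Y. f (\<not> t) y * mean ?D \<omega> (\<lambda>\<omega>. (B t (adj \<omega>) y z)\<^sup>2))
     \<le> (\<Sum>y\<in>Y. f (\<not> t) y * (f t y * f (\<not> t) z))"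
  proof (intro sum_mono mult_left_mono f_nonneg)
    fix y assume "y \<in> Y"
    have "(\<lambda>\<omega>. (B t (adj \<omega>) y z)\<^sup>2) = (\<lambda>\<omega>. B t (adj \<omega>) y z)"
      by (simp add: power2_eq_square B_idem)
    thus "mean ?D \<omega> (\<lambda>\<omega>. (B t (adj \<omega>) y z)\<^sup>2) \<le> f t y * f (\<not> t) z"
      using \<open>y \<in> Y\<close> assms by (auto intro!: mean_B_le)
  qed
  also have "\<dots> \<le> (\<Sum>y<n. f (\<not> t) y * (f t y * f (\<not> t) z))"
    by (rule sum_subset_le) (use assms in \<open>auto intro!: mult_nonneg_nonneg f_nonneg\<close>)
  also have "\<dots> = f (\<not> t) z * H"
    by (simp add: mult.assoc[symmetric] sum_distrib_right[symmetric] sums_alt)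
  finally show ?thesis by (simp add: f_nonneg mult_left_mono)
qed

lemma sum_off_diagonal_swap:
  "finite I \<Longrightarrow> (\<Sum>i\<in>I. \<Sum>j\<in>I - {i}. g i j) = (\<Sum>j\<in>I. \<Sum>i\<in>I - {j}. g i j)"
  for g :: "nat \<Rightarrow> nat \<Rightarrow> real"
proof -
  assume I: "finite I"
  have "(\<Sum>i\<in>I. \<Sum>j\<in>I - {i}. g i j) = (\<Sum>i\<in>I. \<Sum>j | j \<in> I \<and> i \<noteq> j. g i j)"
    by (intro sum.cong refl) auto
  also have "\<dots> = (\<Sum>j\<in>I. \<Sum>i | i \<in> I \<and> i \<noteq> j. g i j)"
    using I by (intro sum.swap_restrict)
  also have "\<dots> = (\<Sum>j\<in>I. \<Sum>i\<in>I - {j}. g i j)"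
    by (intro sum.cong refl) auto
  finally show ?thesis .
qed

text \<open>The weights \<open>f (\<not> t) i\<close> stem from a first edge that has already been
  integrated out. The edges into \<open>z\<close> come next, so the sums are exchanged to make the
  middle node \<open>j\<close> the outer index.\<close>

lemma second_moment_2path_in:
  assumes "z < n" "I \<subseteq> {..<n} - {z}"
  shows "mean (dyads n) \<omega> (\<lambda>\<omega>. (\<Sum>i\<in>I. f (\<not> t) i
       * (\<Sum>j\<in>I - {i}. B t (adj \<omega>) i j * B t (adj \<omega>) j z))\<^sup>2)
    \<le> (f (\<not> t) z)\<^sup>2 * (H ^ 4 + G t * G (\<not> t)) + f (\<not> t) z * (G (\<not> t) * H\<^sup>2 + G (\<not> t) * H)"
proof -
  let ?D = "dyads n"
  let ?S = "\<lambda>\<omega> j. \<Sum>i\<in>I - {j}. f (\<not> t) i * B t (adj \<omega>) i j"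
  have fin: "finite I" using assms(2) by (auto intro: finite_subset)
  have swap: "(\<Sum>i\<in>I. f (\<not> t) i * (\<Sum>j\<in>I - {i}. B t (adj \<omega>) i j * B t (adj \<omega>) j z))
     = (\<Sum>j\<in>I. B (\<not> t) (adj \<omega>) z j * ?S \<omega> j)" for \<omega>
    using sum_off_diagonal_swap[OF fin, of "\<lambda>i j. f (\<not> t) i * (B t (adj \<omega>) i j * B t (adj \<omega>) j z)"]
    by (simp add: sum_distrib_left B_transpose mult_ac)
  have 0: "mean ?D \<omega> (\<lambda>\<omega>. (\<Sum>j\<in>I. B (\<not> t) (adj \<omega>) z j * ?S \<omega> j)\<^sup>2)
    \<le> (f (\<not> t) z)\<^sup>2 * mean ?D \<omega> (\<lambda>\<omega>. (\<Sum>j\<in>I. f (\<not> \<not> t) j * ?S \<omega> j)\<^sup>2)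
      + f (\<not> t) z * (\<Sum>j\<in>I. f (\<not> \<not> t) j * mean ?D \<omega> (\<lambda>\<omega>. (?S \<omega> j)\<^sup>2))"
  proof (rule second_moment_row)
    fix j assume j: "j \<in> I"
    show "indep_of (dyad z ` I) (\<lambda>\<omega>. ?S \<omega> j)"
      using j assms by (intro indep_of_sum indep_of_mult indep_B indep_of_const) (auto simp: dyad_eq_iff)
    show "0 \<le> ?S \<omega> j" for \<omega>
      by (intro sum_nonneg mult_nonneg_nonneg B_range f_nonneg)
  qed (use assms fin in auto)
  have 1: "mean ?D \<omega> (\<lambda>\<omega>. (\<Sum>j\<in>I. f (\<not> \<not> t) j * ?S \<omega> j)\<^sup>2) \<le> (H * H)\<^sup>2 + G (\<not> t) * G t"
  proof -
    let ?Z = "Sigma I (\<lambda>i. I - {i})"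
    have eq: "(\<Sum>j\<in>I. f (\<not> \<not> t) j * ?S \<omega> j)
        = (\<Sum>z\<in>?Z. B t (adj \<omega>) (fst z) (snd z) * (f (\<not> t) (fst z) * f t (snd z)))" for \<omega>
      using sum_off_diagonal_swap[OF fin, of "\<lambda>i j. B t (adj \<omega>) i j * (f (\<not> t) i * f t j)"] fin
      by (simp add: sum_distrib_left sum.Sigma case_prod_beta mult_ac)
    have "mean ?D \<omega> (\<lambda>\<omega>. (\<Sum>z\<in>?Z. B t (adj \<omega>) (fst z) (snd z) * (f (\<not> t) (fst z) * f t (snd z)))\<^sup>2)
      \<le> ((\<Sum>i<n. f t i * f (\<not> t) i) * (\<Sum>i<n. f (\<not> t) i * f t i))\<^sup>2
        + (\<Sum>i<n. f t i * (f (\<not> t) i)\<^sup>2) * (\<Sum>i<n. f (\<not> t) i * (f t i)\<^sup>2)"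
      by (rule second_moment_edges) (use assms in \<open>auto simp: f_nonneg\<close>)
    thus ?thesis by (simp only: eq sums_alt)
  qed
  have "(\<Sum>j\<in>I. f (\<not> \<not> t) j * mean ?D \<omega> (\<lambda>\<omega>. (?S \<omega> j)\<^sup>2))
    \<le> (\<Sum>j\<in>I. f t j * ((f (\<not> t) j)\<^sup>2 * H\<^sup>2 + f (\<not> t) j * G (\<not> t)))"
  proof (rule sum_mono)
    fix j assume j: "j \<in> I"
    have "mean ?D \<omega> (\<lambda>\<omega>. (?S \<omega> j)\<^sup>2) \<le> (f (\<not> t) j)\<^sup>2 * H\<^sup>2 + f (\<not> t) j * G (\<not> t)"
      by (rule second_moment_column) (use j assms in auto)
    thus "f (\<not> \<not> t) j * mean ?D \<omega> (\<lambda>\<omega>. (?S \<omega> j)\<^sup>2)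
       \<le> f t j * ((f (\<not> t) j)\<^sup>2 * H\<^sup>2 + f (\<not> t) j * G (\<not> t))"
      by (simp add: mult_left_mono f_nonneg)
  qed
  also have "\<dots> \<le> (\<Sum>j<n. f t j * ((f (\<not> t) j)\<^sup>2 * H\<^sup>2 + f (\<not> t) j * G (\<not> t)))"
    by (rule sum_subset_le)
       (use assms in \<open>auto intro!: mult_nonneg_nonneg add_nonneg_nonneg f_nonneg sums_nonneg\<close>)
  also have "\<dots> = G (\<not> t) * H\<^sup>2 + H * G (\<not> t)"
    by (simp add: distrib_left sum.distrib mult.assoc[symmetric] sum_distrib_right[symmetric] sums_alt)
  finally have 2: "f (\<not> t) z * (\<Sum>j\<in>I. f (\<not> \<not> t) j * mean ?D \<omega> (\<lambda>\<omega>. (?S \<omega> j)\<^sup>2))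
      \<le> f (\<not> t) z * (G (\<not> t) * H\<^sup>2 + H * G (\<not> t))"
    by (rule mult_left_mono) (rule f_nonneg)
  have "(f (\<not> t) z)\<^sup>2 * mean ?D \<omega> (\<lambda>\<omega>. (\<Sum>j\<in>I. f (\<not> \<not> t) j * ?S \<omega> j)\<^sup>2)
     \<le> (f (\<not> t) z)\<^sup>2 * ((H * H)\<^sup>2 + G (\<not> t) * G t)"
    by (rule mult_left_mono[OF 1]) simp
  moreover have "(H * H)\<^sup>2 = H ^ 4" by (simp add: power4_eq_xxxx power2_eq_square mult_ac)
  ultimately show ?thesis
    unfolding swap using 0 2 by (simp add: mult.commute[of H "G _"] mult.commute[of "G (\<not> t)" "G t"])
qed

text \<open>Integrating out the edges at \<open>x\<close> leaves two quantities bounded above: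
  weighted two-step paths into \<open>z\<close>, and, for a shared first edge, the two-step paths
  from one fixed node to \<open>z\<close>.\<close>

lemma second_moment_3path:
  assumes "x < n" "z < n" "x \<noteq> z" and I: "I = {..<n} - {x, z}"
  shows "mean (dyads n) \<omega> (\<lambda>\<omega>. (\<Sum>i\<in>I. B t (adj \<omega>) x i
       * (\<Sum>j\<in>I - {i}. B t (adj \<omega>) i j * B t (adj \<omega>) j z))\<^sup>2)
    \<le> (f t x)\<^sup>2 * ((f (\<not> t) z)\<^sup>2 * (H ^ 4 + G t * G (\<not> t)) + f (\<not> t) z * (G (\<not> t) * H\<^sup>2 + G (\<not> t) * H))
      + f t x * (G t * ((f (\<not> t) z)\<^sup>2 * H\<^sup>2 + f (\<not> t) z * G (\<not> t)) + H * (f (\<not> t) z * H))"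
proof -
  let ?D = "dyads n"
  let ?R = "\<lambda>\<omega> i. \<Sum>j\<in>I - {i}. B t (adj \<omega>) i j * B t (adj \<omega>) j z"
  have I': "x \<notin> I" "z \<notin> I" "I \<subseteq> {..<n}" "finite I" using I by auto
  have 0: "mean ?D \<omega> (\<lambda>\<omega>. (\<Sum>i\<in>I. B t (adj \<omega>) x i * ?R \<omega> i)\<^sup>2)
    \<le> (f t x)\<^sup>2 * mean ?D \<omega> (\<lambda>\<omega>. (\<Sum>i\<in>I. f (\<not> t) i * ?R \<omega> i)\<^sup>2)
      + f t x * (\<Sum>i\<in>I. f (\<not> t) i * mean ?D \<omega> (\<lambda>\<omega>. (?R \<omega> i)\<^sup>2))"
  proof (rule second_moment_row)
    fix i assume i: "i \<in> I"
    show "indep_of (dyad x ` I) (\<lambda>\<omega>. ?R \<omega> i)"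
      using i I' assms(3) by (intro indep_of_sum indep_of_mult indep_B) (auto simp: dyad_eq_iff)
    show "0 \<le> ?R \<omega> i" for \<omega>
      by (intro sum_nonneg mult_nonneg_nonneg B_range)
  qed (use assms(1,2) I' in auto)
  have 1: "mean ?D \<omega> (\<lambda>\<omega>. (\<Sum>i\<in>I. f (\<not> t) i * ?R \<omega> i)\<^sup>2)
     \<le> (f (\<not> t) z)\<^sup>2 * (H ^ 4 + G t * G (\<not> t)) + f (\<not> t) z * (G (\<not> t) * H\<^sup>2 + G (\<not> t) * H)"
    by (rule second_moment_2path_in) (use assms(2) I' in auto)
  have "(\<Sum>i\<in>I. f (\<not> t) i * mean ?D \<omega> (\<lambda>\<omega>. (?R \<omega> i)\<^sup>2))
    \<le> (\<Sum>i\<in>I. f (\<not> t) i * ((f t i)\<^sup>2 * ((f (\<not> t) z)\<^sup>2 * H\<^sup>2 + f (\<not> t) z * G (\<not> t)) + f t i * f (\<not> t) z * H))"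
    using assms(2) I' by (intro sum_mono mult_left_mono second_moment_2path_fixed f_nonneg) auto
  also have "\<dots> \<le> (\<Sum>i<n. f (\<not> t) i * ((f t i)\<^sup>2 * ((f (\<not> t) z)\<^sup>2 * H\<^sup>2 + f (\<not> t) z * G (\<not> t)) + f t i * f (\<not> t) z * H))"
    by (rule sum_subset_le[OF I'(3)])
       (intro mult_nonneg_nonneg add_nonneg_nonneg f_nonneg sums_nonneg zero_le_power2)
  also have "\<dots> = (\<Sum>i<n. (f (\<not> t) i * (f t i)\<^sup>2) * ((f (\<not> t) z)\<^sup>2 * H\<^sup>2 + f (\<not> t) z * G (\<not> t))
      + (f (\<not> t) i * f t i) * (f (\<not> t) z * H))"
    by (intro sum.cong refl) (simp only: distrib_left mult_ac)
  also have "\<dots> = G t * ((f (\<not> t) z)\<^sup>2 * H\<^sup>2 + f (\<not> t) z * G (\<not> t)) + H * (f (\<not> t) z * H)"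
    by (simp only: sum.distrib sum_distrib_right[symmetric] sums_alt)
  finally have 2: "(\<Sum>i\<in>I. f (\<not> t) i * mean ?D \<omega> (\<lambda>\<omega>. (?R \<omega> i)\<^sup>2))
    \<le> G t * ((f (\<not> t) z)\<^sup>2 * H\<^sup>2 + f (\<not> t) z * G (\<not> t)) + H * (f (\<not> t) z * H)" .
  show ?thesis
    by (rule order_trans[OF 0]) (intro add_mono mult_left_mono 1 2 f_nonneg zero_le_power2)
qed

text \<open>A reciprocated pair is symmetric, so the two orientations of a dyad would be the same
  indicator; injectivity of \<open>dyad\<close> on \<open>Z\<close> rules this out.\<close>

lemma second_moment_11:
  assumes "finite D" "finite Z" "\<And>x y. (x, y) \<in> Z \<Longrightarrow> x \<noteq> y" "inj_on (case_prod dyad) Z"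
    "\<And>x y. (x, y) \<in> Z \<Longrightarrow> dyad x y \<in> D"
  shows "mean D \<omega> (\<lambda>\<omega>. (\<Sum>z\<in>Z. A11 (adj \<omega>) (fst z) (snd z))\<^sup>2)
    \<le> (\<Sum>z\<in>Z. e * h (fst z) * h (snd z))\<^sup>2 + (\<Sum>z\<in>Z. e * h (fst z) * h (snd z))"
proof -
  let ?S = "case_prod dyad ` Z"
  have fin: "finite ?S" using assms(2) by simp
  have le: "mean ?S \<omega> (\<lambda>\<omega>. A11 (adj \<omega>) x y) \<le> e * h x * h y" if "(x, y) \<in> Z" for x y \<omega>
  proof -
    have "mean ?S \<omega> (\<lambda>\<omega>. A11 (adj \<omega>) x y) = K x y * (e * h x * h y)"
      using that assms(3) by (intro mean_A fin) force+
    also have "\<dots> \<le> e * h x * h y" using K_le_1 nonneg by (intro mult_left_le_one_le) auto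
    finally show ?thesis .
  qed
  have "mean D \<omega> (\<lambda>\<omega>. (\<Sum>z\<in>Z. A11 (adj \<omega>) (fst z) (snd z) * 1)\<^sup>2)
    \<le> mean D \<omega> (\<lambda>\<omega>. (\<Sum>z\<in>Z. e * h (fst z) * h (snd z) * 1)\<^sup>2)
      + (\<Sum>z\<in>Z. e * h (fst z) * h (snd z) * mean D \<omega> (\<lambda>\<omega>. 1\<^sup>2))"
  proof (rule second_moment[where S = ?S])
    show "mean ?S \<omega> (\<lambda>\<omega>. A11 (adj \<omega>) (fst d) (snd d)) \<le> e * h (fst d) * h (snd d)" if "d \<in> Z" for d \<omega>
      using le that by simp
    show "mean ?S \<omega> (\<lambda>\<omega>. A11 (adj \<omega>) (fst d) (snd d) * A11 (adj \<omega>) (fst d') (snd d'))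
     \<le> e * h (fst d) * h (snd d) * (e * h (fst d') * h (snd d'))"
      if d: "d \<in> Z" "d' \<in> Z" "d \<noteq> d'" for d d' \<omega>
    proof -
      obtain x y where [simp]: "d = (x, y)" by (cases d)
      obtain x' y' where [simp]: "d' = (x', y')" by (cases d')
      have ne: "x \<noteq> y" "x' \<noteq> y'" using assms(3) d by auto
      have dd: "dyad x y \<noteq> dyad x' y'" using assms(4) d by (auto simp: inj_on_def)
      have dS: "dyad x y \<in> ?S" using d by force
      have "mean ?S \<omega> (\<lambda>\<omega>. A11 (adj \<omega>) x y * A11 (adj \<omega>) x' y')
        = K x y * (e * h x * h y) * mean ?S \<omega> (\<lambda>\<omega>. A11 (adj \<omega>) x' y')"
        using dd by (intro mean_A_mult fin ne dS indep_adj) auto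
      also have "\<dots> \<le> 1 * (e * h x * h y) * (e * h x' * h y')"
        using d by (intro mult_mono le mult_nonneg_nonneg nonneg K_le_1 mean_nonneg A_range) auto
      finally show ?thesis by simp
    qed
  qed (use assms A_idem in auto)
  thus ?thesis by (simp add: mean_const assms(1))
qed

lemma second_moment_degree11:
  assumes "finite D" "Y \<subseteq> {..<n}" "x \<notin> Y" "\<And>y. y \<in> Y \<Longrightarrow> dyad x y \<in> D"
  shows "mean D \<omega> (\<lambda>\<omega>. (\<Sum>y\<in>Y. A11 (adj \<omega>) x y)\<^sup>2) \<le> (e * h x * H)\<^sup>2 + e * h x * H"
proof -
  have fin: "finite Y" using assms(2) by (auto intro: finite_subset)
  have inj: "inj_on (Pair x) Y" by (auto simp: inj_on_def)
  have "mean D \<omega> (\<lambda>\<omega>. (\<Sum>y\<in>Y. A11 (adj \<omega>) x y)\<^sup>2) \<le> (\<Sum>y\<in>Y. e * h x * h y)\<^sup>2 + (\<Sum>y\<in>Y. e * h x * h y)"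
  proof -
    have "mean D \<omega> (\<lambda>\<omega>. (\<Sum>z\<in>Pair x ` Y. A11 (adj \<omega>) (fst z) (snd z))\<^sup>2)
      \<le> (\<Sum>z\<in>Pair x ` Y. e * h (fst z) * h (snd z))\<^sup>2 + (\<Sum>z\<in>Pair x ` Y. e * h (fst z) * h (snd z))"
      by (rule second_moment_11) (use assms fin in \<open>auto simp: inj_on_def dyad_eq_iff\<close>)
    thus ?thesis by (simp add: sum.reindex[OF inj])
  qed
  also have "\<dots> \<le> (e * h x * H)\<^sup>2 + e * h x * H"
  proof -
    have "(\<Sum>y\<in>Y. e * h x * h y) \<le> e * h x * H"
      unfolding H_def sum_distrib_left by (rule sum_subset_le[OF assms(2)]) (simp add: nonneg)
    thus ?thesis by (intro add_mono power_mono sum_nonneg mult_nonneg_nonneg nonneg) auto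
  qed
  finally show ?thesis .
qed

text \<open>Splitting the ordered pairs by orientation restores injectivity of \<open>dyad\<close>;
  the square of a sum of two parts then costs the factor 4.\<close>

lemma second_moment_count11:
  assumes "finite D" "Z \<subseteq> {..<n} \<times> {..<n}" "\<And>x y. (x, y) \<in> Z \<Longrightarrow> x \<noteq> y" "\<And>x y. (x, y) \<in> Z \<Longrightarrow> dyad x y \<in> D"
  shows "mean D \<omega> (\<lambda>\<omega>. (\<Sum>z\<in>Z. A11 (adj \<omega>) (fst z) (snd z))\<^sup>2) \<le> 4 * ((e * H\<^sup>2)\<^sup>2 + e * H\<^sup>2)"
proof -
  have fin: "finite Z" using assms(2) by (auto intro: finite_subset)
  let ?s = "\<lambda>Z \<omega>. \<Sum>z\<in>Z. A11 (adj \<omega>) (fst z) (snd z)"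
  have half: "mean D \<omega> (\<lambda>\<omega>. (?s Z' \<omega>)\<^sup>2) \<le> (e * H\<^sup>2)\<^sup>2 + e * H\<^sup>2"
    if "Z' \<subseteq> Z" "inj_on (case_prod dyad) Z'" for Z'
  proof -
    have ne: "x \<noteq> y" if "(x, y) \<in> Z'" for x y using assms(3) that \<open>Z' \<subseteq> Z\<close> by blast
    have "mean D \<omega> (\<lambda>\<omega>. (?s Z' \<omega>)\<^sup>2) \<le> (\<Sum>z\<in>Z'. e * h (fst z) * h (snd z))\<^sup>2 + (\<Sum>z\<in>Z'. e * h (fst z) * h (snd z))"
      by (rule second_moment_11) (use assms(1,4) that fin ne in \<open>auto intro: finite_subset\<close>)
    moreover have "(\<Sum>z\<in>Z'. e * h (fst z) * h (snd z)) \<le> e * H\<^sup>2"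
      using sum_mult_sum_bound[of Z' h h] that assms(2) nonneg
      by (auto simp: H_def power2_eq_square mult.assoc sum_distrib_left[symmetric])
    moreover have "0 \<le> (\<Sum>z\<in>Z'. e * h (fst z) * h (snd z))"
      by (intro sum_nonneg mult_nonneg_nonneg nonneg) simp
    ultimately show ?thesis by (smt (verit) power_mono)
  qed
  let ?Z1 = "{z \<in> Z. fst z < snd z}" and ?Z2 = "{z \<in> Z. \<not> fst z < snd z}"
  have split: "?s Z \<omega> = ?s ?Z1 \<omega> + ?s ?Z2 \<omega>" for \<omega>
    using fin by (subst sum.union_disjoint[symmetric]) (auto intro!: sum.cong)
  have "mean D \<omega> (\<lambda>\<omega>. (?s Z \<omega>)\<^sup>2) \<le> mean D \<omega> (\<lambda>\<omega>. 2 * (?s ?Z1 \<omega>)\<^sup>2 + 2 * (?s ?Z2 \<omega>)\<^sup>2)"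
  proof (rule mean_mono)
    show "(?s Z \<omega>)\<^sup>2 \<le> 2 * (?s ?Z1 \<omega>)\<^sup>2 + 2 * (?s ?Z2 \<omega>)\<^sup>2" for \<omega>
      unfolding split using zero_le_power2[of "?s ?Z1 \<omega> - ?s ?Z2 \<omega>"]
      by (simp add: power2_eq_square algebra_simps)
  qed
  also have "\<dots> = 2 * mean D \<omega> (\<lambda>\<omega>. (?s ?Z1 \<omega>)\<^sup>2) + 2 * mean D \<omega> (\<lambda>\<omega>. (?s ?Z2 \<omega>)\<^sup>2)"
    by (simp add: mean_add mean_cmult)
  also have "\<dots> \<le> 4 * ((e * H\<^sup>2)\<^sup>2 + e * H\<^sup>2)"
  proof -
    have "inj_on (case_prod dyad) ?Z1" "inj_on (case_prod dyad) ?Z2"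
      using assms(3) by (auto simp: inj_on_def dyad_eq_iff)
    thus ?thesis using half[of ?Z1] half[of ?Z2] by (simp del: mult_cancel_left)
  qed
  finally show ?thesis .
qed

end

section \<open>Upper bound on the variance\<close>

definition others :: "nat \<Rightarrow> nat \<Rightarrow> nat \<Rightarrow> nat set" where
  "others n x y = {..<n} - {x, y}"

definition ordered_pairs :: "nat \<Rightarrow> (nat \<times> nat) set" where
  "ordered_pairs n = {(x, y). x < n \<and> y < n \<and> x \<noteq> y}"

text \<open>The nodes of the first slot are fixed and the other two are summed. The other slots are
  treated by rotating the arguments of \<open>g\<close>, so that one definition serves all
  four.\<close>

definition completions :: "nat \<Rightarrow> (nat \<Rightarrow> nat \<Rightarrow> nat \<Rightarrow> nat \<Rightarrow> real) \<Rightarrow> nat \<Rightarrow> nat \<Rightarrow> real" where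
  "completions n g x y = (\<Sum>k\<in>others n x y. \<Sum>l\<in>others n x y - {k}. g x y k l)"

definition slot_sum :: "nat \<Rightarrow> nat \<times> nat \<Rightarrow> (nat \<Rightarrow> nat \<Rightarrow> nat \<Rightarrow> nat \<Rightarrow> real) \<Rightarrow> real" where
  "slot_sum n d g = (\<Sum>(i, j, k, l)\<in>quads n. if dyad i j = d then g i j k l else 0)"

lemma finite_others [simp]: "finite (others n x y)"
  by (simp add: others_def)

lemma finite_ordered_pairs [simp]: "finite (ordered_pairs n)"
  by (rule finite_subset[of _ "{..<n} \<times> {..<n}"]) (auto simp: ordered_pairs_def)

lemma sum_quads: "(\<Sum>(i, j, k, l)\<in>quads n. g i j k l) = (\<Sum>z\<in>ordered_pairs n. completions n g (fst z) (snd z))"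
proof -
  have "(\<Sum>z\<in>ordered_pairs n. completions n g (fst z) (snd z))
    = (\<Sum>z\<in>ordered_pairs n. \<Sum>w\<in>(SIGMA k:others n (fst z) (snd z). others n (fst z) (snd z) - {k}).
        g (fst z) (snd z) (fst w) (snd w))"
    by (simp add: completions_def sum.Sigma case_prod_beta)
  also have "\<dots> = (\<Sum>zw\<in>(SIGMA z:ordered_pairs n. SIGMA k:others n (fst z) (snd z). others n (fst z) (snd z) - {k}).
        g (fst (fst zw)) (snd (fst zw)) (fst (snd zw)) (snd (snd zw)))"
    by (subst sum.Sigma) (auto simp: case_prod_beta)
  also have "\<dots> = (\<Sum>(i, j, k, l)\<in>quads n. g i j k l)"
    by (rule sum.reindex_bij_witness[of _ "\<lambda>(i, j, k, l). ((i, j), (k, l))" "\<lambda>((i, j), (k, l)). (i, j, k, l)"])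
       (auto simp: quads_def ordered_pairs_def others_def)
  finally show ?thesis by simp
qed

lemma slot_sum_eq:
  assumes "(x, y) \<in> dyads n"
  shows "slot_sum n (x, y) g = completions n g x y + completions n g y x"
proof -
  have xy: "x < y" "y < n" "x < n" using assms by (auto simp: dyads_def)
  have "slot_sum n (x, y) g = (\<Sum>z\<in>ordered_pairs n.
      if dyad (fst z) (snd z) = (x, y) then completions n g (fst z) (snd z) else 0)"
    unfolding slot_sum_def sum_quads by (intro sum.cong refl) (simp add: completions_def)
  also have "\<dots> = (\<Sum>z\<in>{z \<in> ordered_pairs n. dyad (fst z) (snd z) = (x, y)}. completions n g (fst z) (snd z))"
    by (rule sum.inter_filter[symmetric]) simp
  also have "{z \<in> ordered_pairs n. dyad (fst z) (snd z) = (x, y)} = {(x, y), (y, x)}"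
    using xy by (auto simp: ordered_pairs_def dyad_def split: if_splits)
  finally show ?thesis using xy by simp
qed

lemma sum_ordered_pairs: "(\<Sum>z\<in>ordered_pairs n. g (fst z) (snd z)) = (\<Sum>(x, y)\<in>dyads n. g x y + g y x)"
  for g :: "nat \<Rightarrow> nat \<Rightarrow> real"
proof -
  have eq: "ordered_pairs n = dyads n \<union> prod.swap ` dyads n"
    by (auto simp: ordered_pairs_def dyads_def image_iff)
  have "(\<Sum>z\<in>ordered_pairs n. g (fst z) (snd z))
    = (\<Sum>z\<in>dyads n. g (fst z) (snd z)) + (\<Sum>z\<in>prod.swap ` dyads n. g (fst z) (snd z))"
    unfolding eq by (rule sum.union_disjoint) (simp, simp, auto simp: dyads_def)
  also have "(\<Sum>z\<in>prod.swap ` dyads n. g (fst z) (snd z)) = (\<Sum>z\<in>dyads n. g (snd z) (fst z))"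
    by (subst sum.reindex) auto
  finally show ?thesis by (simp add: sum.distrib case_prod_beta)
qed

text \<open>A cyclic shift of the four nodes is a bijection of \<open>quads n\<close>; the three
  shifts carry the slots jk, kl and li to the slot ij.\<close>

lemma rotate_quads:
  "(\<Sum>(i, j, k, l)\<in>quads n. g i j k l) = (\<Sum>(i, j, k, l)\<in>quads n. g l i j k)" (is ?th1)
  "(\<Sum>(i, j, k, l)\<in>quads n. g i j k l) = (\<Sum>(i, j, k, l)\<in>quads n. g k l i j)" (is ?th2)
  "(\<Sum>(i, j, k, l)\<in>quads n. g i j k l) = (\<Sum>(i, j, k, l)\<in>quads n. g j k l i)" (is ?th3)
proof -
  show ?th1
    by (rule sum.reindex_bij_witness[of _ "\<lambda>(i, j, k, l). (l, i, j, k)" "\<lambda>(i, j, k, l). (j, k, l, i)"])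
       (auto simp: quads_def)
  show ?th2
    by (rule sum.reindex_bij_witness[of _ "\<lambda>(i, j, k, l). (k, l, i, j)" "\<lambda>(i, j, k, l). (k, l, i, j)"])
       (auto simp: quads_def)
  show ?th3
    by (rule sum.reindex_bij_witness[of _ "\<lambda>(i, j, k, l). (j, k, l, i)" "\<lambda>(i, j, k, l). (l, i, j, k)"])
       (auto simp: quads_def)
qed

lemma slot_sums:
  "(\<Sum>(i, j, k, l)\<in>quads n. ((if dyad i j = d then 1 else 0) + (if dyad j k = d then 1 else 0)
      + (if dyad k l = d then 1 else 0) + (if dyad l i = d then 1 else 0)) * g i j k l)
    = slot_sum n d g + slot_sum n d (\<lambda>i j k l. g l i j k)
      + slot_sum n d (\<lambda>i j k l. g k l i j) + slot_sum n d (\<lambda>i j k l. g j k l i)"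
proof -
  have "(\<Sum>(i, j, k, l)\<in>quads n. ((if dyad i j = d then 1 else 0) + (if dyad j k = d then 1 else 0)
      + (if dyad k l = d then 1 else 0) + (if dyad l i = d then 1 else 0)) * g i j k l)
    = (\<Sum>(i, j, k, l)\<in>quads n. if dyad i j = d then g i j k l else 0)
    + (\<Sum>(i, j, k, l)\<in>quads n. if dyad j k = d then g i j k l else 0)
    + (\<Sum>(i, j, k, l)\<in>quads n. if dyad k l = d then g i j k l else 0)
    + (\<Sum>(i, j, k, l)\<in>quads n. if dyad l i = d then g i j k l else 0)"
    unfolding sum.distrib[symmetric] by (intro sum.cong refl) auto
  thus ?thesis
    unfolding slot_sum_def
    by (simp only: rotate_quads(1)[of "\<lambda>i j k l. if dyad j k = d then g i j k l else 0" n]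
      rotate_quads(2)[of "\<lambda>i j k l. if dyad k l = d then g i j k l else 0" n]
      rotate_quads(3)[of "\<lambda>i j k l. if dyad l i = d then g i j k l else 0" n])
qed

context p1_model
begin

lemma clear_dyad_le:
  "A10 (adj (\<omega>(d := (False, False)))) x y \<le> A10 (adj \<omega>) x y"
  "A11 (adj (\<omega>(d := (False, False)))) x y \<le> A11 (adj \<omega>) x y"
  by (cases "x = y"; auto simp: A10_adj A11_adj J10_def J11_def)+

lemma clear_dyad_eq:
  assumes "dyad x y \<noteq> d"
  shows "A10 (adj (\<omega>(d := s))) x y = A10 (adj \<omega>) x y"
    "A11 (adj (\<omega>(d := s))) x y = A11 (adj \<omega>) x y"
    "A00 (adj (\<omega>(d := s))) x y = A00 (adj \<omega>) x y"
  using assms by (cases "x = y"; auto simp: A10_adj A11_adj A00_adj)+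

definition slots :: "nat \<times> nat \<Rightarrow> nat \<Rightarrow> nat \<Rightarrow> nat \<Rightarrow> nat \<Rightarrow> real" where
  "slots d i j k l = (if dyad i j = d then 1 else 0) + (if dyad j k = d then 1 else 0)
      + (if dyad k l = d then 1 else 0) + (if dyad l i = d then 1 else 0)"

text \<open>A pattern that does not use \<open>d\<close> is unchanged. Otherwise both values lie
  between 0 and the product without null factors in the old network: emptying \<open>d\<close>
  lowers \<open>A10\<close> and \<open>A11\<close> at most, whereas \<open>A00\<close> may rise and
  is bounded by 1.\<close>

lemma Tab_diff_le:
  fixes \<omega> and d :: "nat \<times> nat"
  defines "A \<equiv> adj \<omega>" and "A' \<equiv> adj (\<omega>(d := (False, False)))"
  shows "\<bar>Ta A i j k l - Ta A' i j k l\<bar> \<le> slots d i j k l * (A11 A i j * A10 A l k)"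
    and "\<bar>Tb A i j k l - Tb A' i j k l\<bar> \<le> slots d i j k l * (A10 A i j * A10 A j k * A10 A l i)"
proof -
  have a: "0 \<le> Ta X i j k l \<and> Ta X i j k l \<le> A11 X i j * A10 X l k" for X
    by (auto simp: Ta_def A11_def A10_def A00_def)
  have b: "0 \<le> Tb X i j k l \<and> Tb X i j k l \<le> A10 X i j * A10 X j k * A10 X l i" for X
    by (auto simp: Tb_def A10_def A00_def)
  have a': "A11 A' i j * A10 A' l k \<le> A11 A i j * A10 A l k"
    unfolding A_def A'_def by (intro mult_mono clear_dyad_le A_range)
  have b': "A10 A' i j * A10 A' j k * A10 A' l i \<le> A10 A i j * A10 A j k * A10 A l i"
    unfolding A_def A'_def by (intro mult_mono clear_dyad_le A_range mult_nonneg_nonneg)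
  have cases: "slots d i j k l = 0 \<and> dyad i j \<noteq> d \<and> dyad j k \<noteq> d \<and> dyad k l \<noteq> d \<and> dyad l k \<noteq> d
      \<and> dyad l i \<noteq> d \<or> 1 \<le> slots d i j k l"
    unfolding slots_def dyad_commute[of l k] by auto
  consider "slots d i j k l = 0" "dyad i j \<noteq> d" "dyad j k \<noteq> d" "dyad k l \<noteq> d" "dyad l k \<noteq> d" "dyad l i \<noteq> d"
    | "1 \<le> slots d i j k l"
    using cases by blast
  thus "\<bar>Ta A i j k l - Ta A' i j k l\<bar> \<le> slots d i j k l * (A11 A i j * A10 A l k)"
  proof cases
    case 1
    thus ?thesis by (simp add: Ta_def A_def A'_def clear_dyad_eq)
  next
    case 2
    have "\<bar>Ta A i j k l - Ta A' i j k l\<bar> \<le> 1 * (A11 A i j * A10 A l k)"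
      using a[of A] a[of A'] a' by linarith
    also have "\<dots> \<le> slots d i j k l * (A11 A i j * A10 A l k)"
      by (intro mult_right_mono 2 mult_nonneg_nonneg A_range)
    finally show ?thesis .
  qed
  consider "slots d i j k l = 0" "dyad i j \<noteq> d" "dyad j k \<noteq> d" "dyad k l \<noteq> d" "dyad l k \<noteq> d" "dyad l i \<noteq> d"
    | "1 \<le> slots d i j k l"
    using cases by blast
  thus "\<bar>Tb A i j k l - Tb A' i j k l\<bar> \<le> slots d i j k l * (A10 A i j * A10 A j k * A10 A l i)"
  proof cases
    case 1
    thus ?thesis by (simp add: Tb_def A_def A'_def clear_dyad_eq)
  next
    case 2
    have "\<bar>Tb A i j k l - Tb A' i j k l\<bar> \<le> 1 * (A10 A i j * A10 A j k * A10 A l i)"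
      using b[of A] b[of A'] b' by linarith
    also have "\<dots> \<le> slots d i j k l * (A10 A i j * A10 A j k * A10 A l i)"
      by (intro mult_right_mono 2 mult_nonneg_nonneg A_range)
    finally show ?thesis .
  qed
qed

text \<open>The patterns without their null factors: here a reciprocated pair and a separate edge;
  for \<open>gb\<close> the directed path from \<open>l\<close> through \<open>i\<close> and
  \<open>j\<close> to \<open>k\<close>.\<close>

definition ga :: "adjm \<Rightarrow> nat \<Rightarrow> nat \<Rightarrow> nat \<Rightarrow> nat \<Rightarrow> real" where
  "ga A i j k l = A11 A i j * A10 A l k"

definition gb :: "adjm \<Rightarrow> nat \<Rightarrow> nat \<Rightarrow> nat \<Rightarrow> nat \<Rightarrow> real" where
  "gb A i j k l = A10 A i j * A10 A j k * A10 A l i"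

definition slot_energy :: "(adjm \<Rightarrow> nat \<Rightarrow> nat \<Rightarrow> nat \<Rightarrow> nat \<Rightarrow> real) \<Rightarrow> real" where
  "slot_energy g = (\<Sum>z\<in>ordered_pairs n. E (\<lambda>A. (completions n (g A) (fst z) (snd z))\<^sup>2))"

lemma slot_sum_energy:
  "(\<Sum>d\<in>dyads n. E (\<lambda>A. (slot_sum n d (g A))\<^sup>2)) \<le> 2 * slot_energy g"
proof -
  have "E (\<lambda>A. (slot_sum n d (g A))\<^sup>2) \<le> 2 * (E (\<lambda>A. (completions n (g A) (fst d) (snd d))\<^sup>2)
      + E (\<lambda>A. (completions n (g A) (snd d) (fst d))\<^sup>2))" if "d \<in> dyads n" for d
  proof -
    have "E (\<lambda>A. (slot_sum n d (g A))\<^sup>2) \<le> E (\<lambda>A. 2 * ((completions n (g A) (fst d) (snd d))\<^sup>2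
      + (completions n (g A) (snd d) (fst d))\<^sup>2))"
    proof (rule mean_mono)
      have "(a + b)\<^sup>2 \<le> 2 * (a\<^sup>2 + b\<^sup>2)" for a b :: real
        using zero_le_power2[of "a - b"] by (simp add: power2_eq_square algebra_simps)
      thus "(slot_sum n d (g (adj \<omega>)))\<^sup>2 \<le> 2 * ((completions n (g (adj \<omega>)) (fst d) (snd d))\<^sup>2
        + (completions n (g (adj \<omega>)) (snd d) (fst d))\<^sup>2)" for \<omega>
        using slot_sum_eq[of "fst d" "snd d" n] that by simp
    qed
    thus ?thesis by (simp add: mean_cmult mean_add)
  qed
  hence "(\<Sum>d\<in>dyads n. E (\<lambda>A. (slot_sum n d (g A))\<^sup>2))
     \<le> (\<Sum>d\<in>dyads n. 2 * (E (\<lambda>A. (completions n (g A) (fst d) (snd d))\<^sup>2)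
      + E (\<lambda>A. (completions n (g A) (snd d) (fst d))\<^sup>2)))"
    by (rule sum_mono)
  also have "\<dots> = 2 * slot_energy g"
    unfolding slot_energy_def sum_ordered_pairs[of "\<lambda>x y. E (\<lambda>A. (completions n (g A) x y)\<^sup>2)"]
    by (simp add: sum_distrib_left case_prod_beta)
  finally show ?thesis .
qed

lemma sum_power2_le_8:
  fixes a1 :: real
  shows "(a1 + a2 + a3 + a4 + (b1 + b2 + b3 + b4))\<^sup>2
    \<le> 8 * (a1\<^sup>2 + a2\<^sup>2 + a3\<^sup>2 + a4\<^sup>2 + (b1\<^sup>2 + b2\<^sup>2 + b3\<^sup>2 + b4\<^sup>2))"
proof -
  have 2: "(a + b)\<^sup>2 \<le> 2 * (a\<^sup>2 + b\<^sup>2)" for a b :: real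
    using zero_le_power2[of "a - b"] by (simp add: power2_eq_square algebra_simps)
  have 4: "(a + b + c + d)\<^sup>2 \<le> 4 * (a\<^sup>2 + b\<^sup>2 + c\<^sup>2 + d\<^sup>2)" for a b c d :: real
    using 2[of "a + b" "c + d"] 2[of a b] 2[of c d] by (simp add: add_ac)
  show ?thesis
    using 2[of "a1 + a2 + a3 + a4" "b1 + b2 + b3 + b4"] 4[of a1 a2 a3 a4] 4[of b1 b2 b3 b4] by simp
qed

text \<open>Emptying a dyad changes \<open>Qa\<close> and \<open>Qb\<close> by at most four slot
  sums each. The square of a sum of eight terms costs 8, and the two orientations of a dyad cost
  another 2.\<close>

lemma variance_le_energies:
  "E (\<lambda>A. (Ustat n \<rho> A)\<^sup>2) \<le> 16 * (slot_energy ga + slot_energy (\<lambda>A i j k l. ga A l i j k)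
      + slot_energy (\<lambda>A i j k l. ga A k l i j) + slot_energy (\<lambda>A i j k l. ga A j k l i)
      + e\<^sup>2 * (slot_energy gb + slot_energy (\<lambda>A i j k l. gb A l i j k)
      + slot_energy (\<lambda>A i j k l. gb A k l i j) + slot_energy (\<lambda>A i j k l. gb A j k l i)))"
proof -
  let ?sq = "\<lambda>g d. E (\<lambda>A. (slot_sum n d (g A))\<^sup>2)"
  let ?U = "\<lambda>\<omega>. Ustat n \<rho> (adj \<omega>)"
  have diff: "(?U \<omega> - ?U (\<omega>(d := (False, False))))\<^sup>2
     \<le> 8 * ((slot_sum n d (ga (adj \<omega>)))\<^sup>2 + (slot_sum n d (\<lambda>i j k l. ga (adj \<omega>) l i j k))\<^sup>2
        + (slot_sum n d (\<lambda>i j k l. ga (adj \<omega>) k l i j))\<^sup>2 + (slot_sum n d (\<lambda>i j k l. ga (adj \<omega>) j k l i))\<^sup>2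
        + e\<^sup>2 * ((slot_sum n d (gb (adj \<omega>)))\<^sup>2 + (slot_sum n d (\<lambda>i j k l. gb (adj \<omega>) l i j k))\<^sup>2
        + (slot_sum n d (\<lambda>i j k l. gb (adj \<omega>) k l i j))\<^sup>2 + (slot_sum n d (\<lambda>i j k l. gb (adj \<omega>) j k l i))\<^sup>2))"
    for \<omega> d
  proof -
    let ?A = "adj \<omega>" and ?A' = "adj (\<omega>(d := (False, False)))"
    let ?sa = "slot_sum n d (ga ?A) + slot_sum n d (\<lambda>i j k l. ga ?A l i j k)
      + slot_sum n d (\<lambda>i j k l. ga ?A k l i j) + slot_sum n d (\<lambda>i j k l. ga ?A j k l i)"
    let ?sb = "slot_sum n d (gb ?A) + slot_sum n d (\<lambda>i j k l. gb ?A l i j k)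
      + slot_sum n d (\<lambda>i j k l. gb ?A k l i j) + slot_sum n d (\<lambda>i j k l. gb ?A j k l i)"
    have "\<bar>Qa n ?A - Qa n ?A'\<bar> \<le> (\<Sum>(i, j, k, l)\<in>quads n. \<bar>Ta ?A i j k l - Ta ?A' i j k l\<bar>)"
      unfolding Qa_eq sum_subtractf[symmetric] case_prod_beta by (rule sum_abs)
    also have "\<dots> \<le> (\<Sum>(i, j, k, l)\<in>quads n. slots d i j k l * ga ?A i j k l)"
      unfolding ga_def by (intro sum_mono) (auto intro!: Tab_diff_le)
    finally have 1: "\<bar>Qa n ?A - Qa n ?A'\<bar> \<le> ?sa" unfolding slots_def slot_sums .
    have "\<bar>Qb n ?A - Qb n ?A'\<bar> \<le> (\<Sum>(i, j, k, l)\<in>quads n. \<bar>Tb ?A i j k l - Tb ?A' i j k l\<bar>)"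
      unfolding Qb_eq sum_subtractf[symmetric] case_prod_beta by (rule sum_abs)
    also have "\<dots> \<le> (\<Sum>(i, j, k, l)\<in>quads n. slots d i j k l * gb ?A i j k l)"
      unfolding gb_def by (intro sum_mono) (auto intro!: Tab_diff_le)
    finally have 2: "\<bar>Qb n ?A - Qb n ?A'\<bar> \<le> ?sb" unfolding slots_def slot_sums .
    have "\<bar>?U \<omega> - ?U (\<omega>(d := (False, False)))\<bar> \<le> \<bar>Qa n ?A - Qa n ?A'\<bar> + e * \<bar>Qb n ?A - Qb n ?A'\<bar>"
    proof -
      have "?U \<omega> - ?U (\<omega>(d := (False, False))) = (Qa n ?A - Qa n ?A') - e * (Qb n ?A - Qb n ?A')"
        by (simp add: Ustat_def algebra_simps)
      thus ?thesis
        using abs_triangle_ineq4[of "Qa n ?A - Qa n ?A'" "e * (Qb n ?A - Qb n ?A')"]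
        by (simp add: abs_mult)
    qed
    also have "\<dots> \<le> ?sa + e * ?sb" using 1 2 by (intro add_mono mult_left_mono) auto
    finally have "(?U \<omega> - ?U (\<omega>(d := (False, False))))\<^sup>2 \<le> (?sa + e * ?sb)\<^sup>2"
      by (metis power2_abs abs_ge_zero power_mono)
    also have "\<dots> \<le> 8 * ((slot_sum n d (ga ?A))\<^sup>2 + (slot_sum n d (\<lambda>i j k l. ga ?A l i j k))\<^sup>2
        + (slot_sum n d (\<lambda>i j k l. ga ?A k l i j))\<^sup>2 + (slot_sum n d (\<lambda>i j k l. ga ?A j k l i))\<^sup>2
        + ((e * slot_sum n d (gb ?A))\<^sup>2 + (e * slot_sum n d (\<lambda>i j k l. gb ?A l i j k))\<^sup>2
        + (e * slot_sum n d (\<lambda>i j k l. gb ?A k l i j))\<^sup>2 + (e * slot_sum n d (\<lambda>i j k l. gb ?A j k l i))\<^sup>2))"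
      unfolding distrib_left[of e] by (rule sum_power2_le_8)
    finally show ?thesis by (simp only: power_mult_distrib distrib_left)
  qed
  have "E (\<lambda>A. (Ustat n \<rho> A)\<^sup>2) \<le> (\<Sum>d\<in>dyads n. mean (dyads n) (\<lambda>_. (False, False))
      (\<lambda>\<omega>. (?U \<omega> - ?U (\<omega>(d := (False, False))))\<^sup>2))"
    using efron_stein[of "dyads n" "\<lambda>_. (False, False)" ?U "(False, False)"] by (simp add: mean_Ustat)
  also have "\<dots> \<le> (\<Sum>d\<in>dyads n. 8 * (?sq ga d + ?sq (\<lambda>A i j k l. ga A l i j k) d
        + ?sq (\<lambda>A i j k l. ga A k l i j) d + ?sq (\<lambda>A i j k l. ga A j k l i) d
        + e\<^sup>2 * (?sq gb d + ?sq (\<lambda>A i j k l. gb A l i j k) d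
        + ?sq (\<lambda>A i j k l. gb A k l i j) d + ?sq (\<lambda>A i j k l. gb A j k l i) d)))"
    unfolding mean_cmult[symmetric] mean_add[symmetric] by (intro sum_mono mean_mono diff)
  also have "\<dots> = 8 * ((\<Sum>d\<in>dyads n. ?sq ga d) + (\<Sum>d\<in>dyads n. ?sq (\<lambda>A i j k l. ga A l i j k) d)
        + (\<Sum>d\<in>dyads n. ?sq (\<lambda>A i j k l. ga A k l i j) d) + (\<Sum>d\<in>dyads n. ?sq (\<lambda>A i j k l. ga A j k l i) d)
        + e\<^sup>2 * ((\<Sum>d\<in>dyads n. ?sq gb d) + (\<Sum>d\<in>dyads n. ?sq (\<lambda>A i j k l. gb A l i j k) d)
        + (\<Sum>d\<in>dyads n. ?sq (\<lambda>A i j k l. gb A k l i j) d) + (\<Sum>d\<in>dyads n. ?sq (\<lambda>A i j k l. gb A j k l i) d)))"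
    by (simp only: sum_distrib_left[symmetric] sum.distrib)
  also have "\<dots> \<le> 8 * (2 * slot_energy ga + 2 * slot_energy (\<lambda>A i j k l. ga A l i j k)
      + 2 * slot_energy (\<lambda>A i j k l. ga A k l i j) + 2 * slot_energy (\<lambda>A i j k l. ga A j k l i)
      + e\<^sup>2 * (2 * slot_energy gb + 2 * slot_energy (\<lambda>A i j k l. gb A l i j k)
      + 2 * slot_energy (\<lambda>A i j k l. gb A k l i j) + 2 * slot_energy (\<lambda>A i j k l. gb A j k l i)))"
    by (intro mult_left_mono add_mono slot_sum_energy) auto
  finally show ?thesis by (simp add: algebra_simps)
qed

end

section \<open>Mean squares of the completions of a single slot\<close>

lemma others_commute: "others n x y = others n y x"
  by (auto simp: others_def)

context p1_model
begin

lemma A10_mult_mean_le: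
  assumes "x < n" "y < n" "x \<noteq> y" "indep_of {dyad x y} g" "\<And>\<omega>. 0 \<le> g \<omega>"
  shows "mean (dyads n) \<omega> (\<lambda>\<omega>. A10 (adj \<omega>) x y * g \<omega>) \<le> m x * v y * mean (dyads n) \<omega> g"
    and "mean (dyads n) \<omega> (\<lambda>\<omega>. A11 (adj \<omega>) x y * g \<omega>) \<le> e * h x * h y * mean (dyads n) \<omega> g"
proof -
  have "K x y * c \<le> c" if "0 \<le> c" for c
    using K_le_1 that nonneg by (simp add: mult_left_le_one_le)
  hence *: "K x y * c * mean (dyads n) \<omega> g \<le> c * mean (dyads n) \<omega> g" if "0 \<le> c" for c
    using that assms(5) by (intro mult_right_mono mean_nonneg) auto
  show "mean (dyads n) \<omega> (\<lambda>\<omega>. A10 (adj \<omega>) x y * g \<omega>) \<le> m x * v y * mean (dyads n) \<omega> g"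
    using *[of "m x * v y"] assms nonneg by (subst mean_A_mult(1)) auto
  show "mean (dyads n) \<omega> (\<lambda>\<omega>. A11 (adj \<omega>) x y * g \<omega>) \<le> e * h x * h y * mean (dyads n) \<omega> g"
    using *[of "e * h x * h y"] assms nonneg by (subst mean_A_mult(2)) auto
qed

lemma double_sum_power2:
  fixes a b :: "nat \<Rightarrow> real"
  assumes "finite I" "\<And>i. 0 \<le> a i" "\<And>i. 0 \<le> b i"
  shows "(\<Sum>k\<in>I. \<Sum>l\<in>I - {k}. a l * b k)\<^sup>2 \<le> (\<Sum>l\<in>I. a l)\<^sup>2 * (\<Sum>k\<in>I. b k)\<^sup>2"
proof -
  have "(\<Sum>k\<in>I. \<Sum>l\<in>I - {k}. a l * b k) \<le> (\<Sum>k\<in>I. \<Sum>l\<in>I. a l * b k)"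
    using assms by (intro sum_mono sum_mono2) auto
  also have "\<dots> = (\<Sum>l\<in>I. a l) * (\<Sum>k\<in>I. b k)"
    by (simp add: sum_product sum.swap[of "\<lambda>l k. a l * b k" I I])
  finally show ?thesis
    using assms by (subst power_mult_distrib[symmetric], intro power_mono sum_nonneg mult_nonneg_nonneg)
qed

text \<open>If the emptied dyad is a null slot of the a-pattern, what remains is a reciprocated pair
  at one end and an edge at the other. These stars use disjoint dyads, so their second moments
  multiply once the condition that the leaves differ is dropped.\<close>

lemma energy_star:
  assumes "x < n" "y < n" "x \<noteq> y" "I = others n x y"
  shows "E (\<lambda>A. (\<Sum>k\<in>I. \<Sum>l\<in>I - {k}. A11 A x l * B t A y k)\<^sup>2)
    \<le> ((e * h x * H)\<^sup>2 + e * h x * H) * ((f t y)\<^sup>2 * (F (\<not> t))\<^sup>2 + f t y * F (\<not> t))"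
proof -
  let ?D = "dyads n" and ?\<omega> = "\<lambda>_. (False, False)"
  let ?a = "\<lambda>\<omega>. (\<Sum>l\<in>I. A11 (adj \<omega>) x l)\<^sup>2" and ?b = "\<lambda>\<omega>. (\<Sum>k\<in>I. B t (adj \<omega>) y k)\<^sup>2"
  let ?c = "(f t y)\<^sup>2 * (F (\<not> t))\<^sup>2 + f t y * F (\<not> t)"
  have I: "finite I" "I \<subseteq> {..<n}" "x \<notin> I" "y \<notin> I" using assms(4) by (auto simp: others_def)
  have "E (\<lambda>A. (\<Sum>k\<in>I. \<Sum>l\<in>I - {k}. A11 A x l * B t A y k)\<^sup>2) \<le> mean ?D ?\<omega> (\<lambda>\<omega>. ?a \<omega> * ?b \<omega>)"
    by (intro mean_mono double_sum_power2 I A_range B_range)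
  also have "\<dots> \<le> ?c * mean ?D ?\<omega> ?a"
  proof (rule mean_mult_le[where S = "dyad y ` I"])
    show "indep_of (dyad y ` I) ?a"
      using I assms(3) by (intro indep_of_power indep_of_sum indep_adj) (auto simp: dyad_eq_iff)
    show "mean (dyad y ` I) \<omega> ?b \<le> ?c" for \<omega>
      by (rule second_moment_degree1) (use I in auto)
  qed (use I assms in auto)
  also have "\<dots> \<le> ?c * ((e * h x * H)\<^sup>2 + e * h x * H)"
    using I assms by (intro mult_left_mono second_moment_degree11 add_nonneg_nonneg mult_nonneg_nonneg
        f_nonneg sums_nonneg zero_le_power2) auto
  finally show ?thesis by (simp only: mult.commute)
qed

lemma sum_off_diagonal: "finite I \<Longrightarrow> (\<Sum>i\<in>I. \<Sum>j\<in>I - {i}. g i j) = (\<Sum>z\<in>(SIGMA i:I. I - {i}). g (fst z) (snd z))"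
  for g :: "nat \<Rightarrow> nat \<Rightarrow> real"
  by (simp add: sum.Sigma case_prod_beta)

text \<open>Slot ij, the reciprocated pair: its indicator is its own square and does not interact
  with the completing edges, which run among the other nodes.\<close>

lemma energy_ga1:
  assumes "x < n" "y < n" "x \<noteq> y"
  shows "E (\<lambda>A. (completions n (ga A) x y)\<^sup>2)
    \<le> e * h x * h y * ((F True * F False)\<^sup>2 + F True * F False)"
proof -
  let ?I = "others n x y"
  let ?Z = "SIGMA i:?I. ?I - {i}"
  let ?s = "\<lambda>A. \<Sum>z\<in>?Z. B True A (fst z) (snd z) * (1 * 1)"
  have I: "?I \<subseteq> {..<n}" "x \<notin> ?I" "y \<notin> ?I" by (auto simp: others_def)
  have "(completions n (ga A) x y)\<^sup>2 = A11 A x y * (?s A)\<^sup>2" for A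
  proof -
    have "completions n (ga A) x y = A11 A x y * ?s A"
      using sum_off_diagonal[of ?I "\<lambda>i j. A10 A j i"]
      by (simp add: completions_def ga_def sum_distrib_left[symmetric] B_def)
    thus ?thesis by (simp add: power2_eq_square A_idem mult_ac mult.assoc[symmetric, of "A11 _ _ _" "A11 _ _ _"])
  qed
  hence "E (\<lambda>A. (completions n (ga A) x y)\<^sup>2) = E (\<lambda>A. A11 A x y * (?s A)\<^sup>2)" by simp
  also have "\<dots> \<le> e * h x * h y * E (\<lambda>A. (?s A)\<^sup>2)"
    using I assms
    by (intro A10_mult_mean_le indep_of_power indep_of_sum indep_of_mult indep_of_const indep_B)
       (auto simp: dyad_eq_iff)
  also have "E (\<lambda>A. (?s A)\<^sup>2) \<le> ((\<Sum>i<n. f True i * 1) * (\<Sum>i<n. f (\<not> True) i * 1))\<^sup>2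
      + (\<Sum>i<n. f True i * 1\<^sup>2) * (\<Sum>i<n. f (\<not> True) i * 1\<^sup>2)"
    by (rule second_moment_edges) (use I in auto)
  finally show ?thesis by (simp add: F_def nonneg mult_left_mono)
qed

text \<open>Slot kl, the one-way edge from \<open>y\<close> to \<open>x\<close>; it is completed by
  the reciprocated pairs among the other nodes.\<close>

lemma energy_ga2:
  assumes "x < n" "y < n" "x \<noteq> y"
  shows "E (\<lambda>A. (completions n (\<lambda>i j k l. ga A k l i j) x y)\<^sup>2)
    \<le> m y * v x * (4 * ((e * H\<^sup>2)\<^sup>2 + e * H\<^sup>2))"
proof -
  let ?I = "others n x y"
  let ?Z = "SIGMA i:?I. ?I - {i}"
  let ?s = "\<lambda>A. \<Sum>z\<in>?Z. A11 A (fst z) (snd z)"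
  have I: "?I \<subseteq> {..<n}" "x \<notin> ?I" "y \<notin> ?I" by (auto simp: others_def)
  have "(completions n (\<lambda>i j k l. ga A k l i j) x y)\<^sup>2 = A10 A y x * (?s A)\<^sup>2" for A
  proof -
    have "completions n (\<lambda>i j k l. ga A k l i j) x y = A10 A y x * ?s A"
      using sum_off_diagonal[of ?I "\<lambda>i j. A11 A i j"]
      by (simp add: completions_def ga_def sum_distrib_right[symmetric])
    thus ?thesis by (simp add: power2_eq_square A_idem mult_ac mult.assoc[symmetric, of "A10 _ _ _" "A10 _ _ _"])
  qed
  hence "E (\<lambda>A. (completions n (\<lambda>i j k l. ga A k l i j) x y)\<^sup>2) = E (\<lambda>A. A10 A y x * (?s A)\<^sup>2)" by simp
  also have "\<dots> \<le> m y * v x * E (\<lambda>A. (?s A)\<^sup>2)"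
    using I assms
    by (intro A10_mult_mean_le indep_of_power indep_of_sum indep_adj) (auto simp: dyad_eq_iff)
  also have "\<dots> \<le> m y * v x * (4 * ((e * H\<^sup>2)\<^sup>2 + e * H\<^sup>2))"
    by (intro mult_left_mono second_moment_count11 mult_nonneg_nonneg nonneg) (use I in auto)
  finally show ?thesis .
qed

lemma energy_ga3:
  assumes "x < n" "y < n" "x \<noteq> y"
  shows "E (\<lambda>A. (completions n (\<lambda>i j k l. ga A l i j k) x y)\<^sup>2)
    \<le> ((e * h x * H)\<^sup>2 + e * h x * H) * ((f True y)\<^sup>2 * (F False)\<^sup>2 + f True y * F False)"
  using energy_star[OF assms refl, of True]
  by (simp add: completions_def ga_def B_def A_comm(1)[of _ x])

lemma energy_ga4:
  assumes "x < n" "y < n" "x \<noteq> y"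
  shows "E (\<lambda>A. (completions n (\<lambda>i j k l. ga A j k l i) x y)\<^sup>2)
    \<le> ((e * h y * H)\<^sup>2 + e * h y * H) * ((f False x)\<^sup>2 * (F True)\<^sup>2 + f False x * F True)"
proof -
  have "completions n (\<lambda>i j k l. ga A j k l i) x y
    = (\<Sum>k\<in>others n y x. \<Sum>l\<in>others n y x - {k}. A11 A y l * B False A x k)" for A
    using sum_off_diagonal_swap[of "others n x y" "\<lambda>k l. A11 A y k * A10 A x l"]
    by (simp add: completions_def ga_def B_def others_commute[of n x y])
  thus ?thesis using energy_star[of y x "others n y x" False] assms by simp
qed

lemma A10_times_power2: "(A10 A x y * s)\<^sup>2 = A10 A x y * s\<^sup>2"
  by (simp add: power_mult_distrib power2_eq_square[of "A10 A x y"] A_idem)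

text \<open>Slot ij, the middle edge of the path: it is completed by an edge into \<open>x\<close>
  and an edge out of \<open>y\<close>, again two stars on disjoint dyads.\<close>

lemma energy_gb1:
  assumes "x < n" "y < n" "x \<noteq> y"
  shows "E (\<lambda>A. (completions n (gb A) x y)\<^sup>2)
    \<le> m x * v y * (((f True x)\<^sup>2 * (F False)\<^sup>2 + f True x * F False)
      * ((f False y)\<^sup>2 * (F True)\<^sup>2 + f False y * F True))"
proof -
  let ?I = "others n x y"
  let ?D = "dyads n" and ?\<omega> = "\<lambda>_. (False, False)"
  let ?a = "\<lambda>\<omega>. (\<Sum>l\<in>?I. B True (adj \<omega>) x l)\<^sup>2" and ?b = "\<lambda>\<omega>. (\<Sum>k\<in>?I. B False (adj \<omega>) y k)\<^sup>2"
  let ?c = "(f False y)\<^sup>2 * (F (\<not> False))\<^sup>2 + f False y * F (\<not> False)"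
  let ?c' = "(f True x)\<^sup>2 * (F (\<not> True))\<^sup>2 + f True x * F (\<not> True)"
  have I: "finite ?I" "?I \<subseteq> {..<n}" "x \<notin> ?I" "y \<notin> ?I" by (auto simp: others_def)
  have "(completions n (gb A) x y)\<^sup>2
    \<le> A10 A x y * ((\<Sum>l\<in>?I. B True A x l)\<^sup>2 * (\<Sum>k\<in>?I. B False A y k)\<^sup>2)" for A
  proof -
    have "completions n (gb A) x y = A10 A x y * (\<Sum>k\<in>?I. \<Sum>l\<in>?I - {k}. B True A x l * B False A y k)"
      by (simp add: completions_def gb_def sum_distrib_left B_def mult_ac)
    thus ?thesis
      unfolding A10_times_power2[symmetric]
      using double_sum_power2[of ?I "B True A x" "B False A y"]
      by (simp add: A10_times_power2 A_range B_range mult_left_mono)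
  qed
  hence "E (\<lambda>A. (completions n (gb A) x y)\<^sup>2) \<le> mean ?D ?\<omega> (\<lambda>\<omega>. A10 (adj \<omega>) x y * (?a \<omega> * ?b \<omega>))"
    by (intro mean_mono)
  also have "\<dots> \<le> m x * v y * mean ?D ?\<omega> (\<lambda>\<omega>. ?a \<omega> * ?b \<omega>)"
    using I assms
    by (intro A10_mult_mean_le indep_of_mult indep_of_power indep_of_sum indep_B) (auto simp: dyad_eq_iff)
  also have "\<dots> \<le> m x * v y * (?c * ?c')"
  proof (intro mult_left_mono mult_nonneg_nonneg nonneg)
    have "mean ?D ?\<omega> (\<lambda>\<omega>. ?a \<omega> * ?b \<omega>) \<le> ?c * mean ?D ?\<omega> ?a"
    proof (rule mean_mult_le[where S = "dyad y ` ?I"])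
      show "indep_of (dyad y ` ?I) ?a"
        using I assms(3) by (intro indep_of_power indep_of_sum indep_B) (auto simp: dyad_eq_iff)
      show "mean (dyad y ` ?I) \<omega> ?b \<le> ?c" for \<omega>
        by (rule second_moment_degree1) (use I in auto)
    qed (use I assms in auto)
    also have "\<dots> \<le> ?c * ?c'"
      using I assms by (intro mult_left_mono second_moment_degree1 add_nonneg_nonneg mult_nonneg_nonneg
          f_nonneg sums_nonneg zero_le_power2) auto
    finally show "mean ?D ?\<omega> (\<lambda>\<omega>. ?a \<omega> * ?b \<omega>) \<le> ?c * ?c'" .
  qed
  finally show ?thesis by (simp add: mult_ac)
qed

text \<open>Covers the slots jk and li, the last and the first edge of the path: the other two edges
  form a path from an end \<open>u\<close> of the slot, followed backwards (\<open>t\<close> true)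
  or forwards (\<open>t\<close> false).\<close>

lemma energy_2path:
  assumes "x < n" "y < n" "x \<noteq> y" "u \<in> {x, y}" "I = others n x y"
  shows "E (\<lambda>A. (A10 A x y * (\<Sum>i\<in>I. B t A u i * (\<Sum>j\<in>I - {i}. B t A i j)))\<^sup>2)
    \<le> m x * v y * ((f t u)\<^sup>2 * (H\<^sup>2 * (F (\<not> t))\<^sup>2 + G (\<not> t) * F (\<not> t))
      + f t u * (G t * (F (\<not> t))\<^sup>2 + H * F (\<not> t)))"
proof -
  have I: "finite I" "I \<subseteq> {..<n}" "x \<notin> I" "y \<notin> I" using assms(5) by (auto simp: others_def)
  have "E (\<lambda>A. (A10 A x y * (\<Sum>i\<in>I. B t A u i * (\<Sum>j\<in>I - {i}. B t A i j)))\<^sup>2)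
    \<le> m x * v y * E (\<lambda>A. (\<Sum>i\<in>I. B t A u i * (\<Sum>j\<in>I - {i}. B t A i j))\<^sup>2)"
    unfolding A10_times_power2
    using I assms
    by (intro A10_mult_mean_le indep_of_mult indep_of_power indep_of_sum indep_B) (auto simp: dyad_eq_iff)
  also have "\<dots> \<le> m x * v y * ((f t u)\<^sup>2 * (H\<^sup>2 * (F (\<not> t))\<^sup>2 + G (\<not> t) * F (\<not> t))
      + f t u * (G t * (F (\<not> t))\<^sup>2 + H * F (\<not> t)))"
    by (intro mult_left_mono second_moment_2path_free mult_nonneg_nonneg nonneg) (use I assms in auto)
  finally show ?thesis .
qed

lemma energy_gb2:
  assumes "x < n" "y < n" "x \<noteq> y"
  shows "E (\<lambda>A. (completions n (\<lambda>i j k l. gb A l i j k) x y)\<^sup>2)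
    \<le> m x * v y * ((f True x)\<^sup>2 * (H\<^sup>2 * (F False)\<^sup>2 + G False * F False)
      + f True x * (G True * (F False)\<^sup>2 + H * F False))"
proof -
  let ?I = "others n x y"
  have "completions n (\<lambda>i j k l. gb A l i j k) x y
    = A10 A x y * (\<Sum>i\<in>?I. B True A x i * (\<Sum>j\<in>?I - {i}. B True A i j))" for A
    using sum_off_diagonal_swap[of ?I "\<lambda>k l. A10 A l x * A10 A x y * A10 A k l"]
    by (simp add: completions_def gb_def B_def sum_distrib_left mult_ac)
  thus ?thesis using energy_2path[of x y x ?I True] assms by simp
qed

lemma energy_gb4:
  assumes "x < n" "y < n" "x \<noteq> y"
  shows "E (\<lambda>A. (completions n (\<lambda>i j k l. gb A j k l i) x y)\<^sup>2)
    \<le> m x * v y * ((f False y)\<^sup>2 * (H\<^sup>2 * (F True)\<^sup>2 + G True * F True)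
      + f False y * (G False * (F True)\<^sup>2 + H * F True))"
proof -
  let ?I = "others n x y"
  have "completions n (\<lambda>i j k l. gb A j k l i) x y
    = A10 A x y * (\<Sum>i\<in>?I. B False A y i * (\<Sum>j\<in>?I - {i}. B False A i j))" for A
    by (simp add: completions_def gb_def B_def sum_distrib_left mult_ac)
  thus ?thesis using energy_2path[of x y y ?I False] assms by simp
qed

text \<open>Slot kl, the null slot of the b-pattern: it is completed by the three-edge paths from
  \<open>y\<close> to \<open>x\<close>.\<close>

lemma energy_gb3:
  assumes "x < n" "y < n" "x \<noteq> y"
  shows "E (\<lambda>A. (completions n (\<lambda>i j k l. gb A k l i j) x y)\<^sup>2)
    \<le> (f False y)\<^sup>2 * ((f True x)\<^sup>2 * (H ^ 4 + G False * G True) + f True x * (G True * H\<^sup>2 + G True * H))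
      + f False y * (G False * ((f True x)\<^sup>2 * H\<^sup>2 + f True x * G True) + H * (f True x * H))"
proof -
  let ?I = "others n x y"
  have "completions n (\<lambda>i j k l. gb A k l i j) x y
    = (\<Sum>i\<in>?I. B False A y i * (\<Sum>j\<in>?I - {i}. B False A i j * B False A j x))" for A
    by (simp add: completions_def gb_def B_def sum_distrib_left mult_ac)
  thus ?thesis using second_moment_3path[of y x ?I "\<lambda>_. (False, False)" False] assms
    by (simp add: others_def insert_commute)
qed

end

section \<open>Summation of the energies under explicit smallness conditions\<close>

locale p1_regime = p1_model +
  assumes m_le: "i < n \<Longrightarrow> m i \<le> 1 / 8" and v_le: "i < n \<Longrightarrow> v i \<le> 1 / 8"
    and eta_le: "i < n \<Longrightarrow> j < n \<Longrightarrow> e * h i * h j \<le> 1 / 2"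
    and H_ge: "32 \<le> H" and R_ge: "1 \<le> e * H\<^sup>2"
begin

lemma f_le: "i < n \<Longrightarrow> f t i \<le> 1 / 8"
  using m_le v_le by (simp add: f_def)

lemma H_le_F: "8 * H \<le> F t"
proof -
  have "8 * h i \<le> f t i" if "i < n" for i
    using mult_left_mono[OF f_le[OF that, of "\<not> t"] f_nonneg[of t i]] by (simp add: f_mult)
  thus ?thesis unfolding H_def F_def sum_distrib_left by (intro sum_mono) auto
qed

lemma F_ge_1: "1 \<le> F t"
  using H_le_F[of t] H_ge by linarith

text \<open>The Cauchy--Schwarz inequality \<open>(\<Sum> f f')\<^sup>2 \<le> (\<Sum> f\<^sup>2 f') (\<Sum> f')\<close>.\<close>

lemma H_power2_le: "H\<^sup>2 \<le> G t * F (\<not> t)"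
proof -
  define c where "c = H / F (\<not> t)"
  have F: "0 < F (\<not> t)" using F_ge_1[of "\<not> t"] by linarith
  have "0 \<le> (\<Sum>i<n. f (\<not> t) i * (f t i - c)\<^sup>2)"
    by (intro sum_nonneg mult_nonneg_nonneg f_nonneg) auto
  also have "\<dots> = (\<Sum>i<n. f (\<not> t) i * (f t i)\<^sup>2 + (- 2 * c) * (f (\<not> t) i * f t i) + c\<^sup>2 * f (\<not> t) i)"
    by (intro sum.cong refl) (simp add: power2_eq_square algebra_simps)
  also have "\<dots> = G t - 2 * c * H + c\<^sup>2 * F (\<not> t)"
    unfolding sum.distrib sum_distrib_left[symmetric] sums_alt F_def by simp
  also have "\<dots> = G t - H\<^sup>2 / F (\<not> t)"
    using F by (simp add: c_def power2_eq_square field_simps)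
  finally show ?thesis using F by (simp add: field_simps)
qed

lemma sum_h_power2_le: "(\<Sum>i<n. (h i)\<^sup>2) \<le> G t"
  unfolding G_def
proof (rule sum_mono)
  fix i assume "i \<in> {..<n}"
  hence "f (\<not> t) i \<le> 1" using f_le[of i "\<not> t"] by simp
  hence "f t i * f (\<not> t) i \<le> f t i * 1" by (intro mult_left_mono f_nonneg)
  thus "(h i)\<^sup>2 \<le> f t i * h i"
    by (simp add: power2_eq_square f_mult mult_right_mono nonneg)
qed

lemma f_power2_le: "i < n \<Longrightarrow> (f t i)\<^sup>2 \<le> f t i"
  using f_le[of i t] f_nonneg[of t i] by (simp add: power2_eq_square mult_left_le_one_le)

lemma sum_f_power2_le: "(\<Sum>i<n. (f t i)\<^sup>2) \<le> F t"
  unfolding F_def by (rule sum_mono) (simp add: f_power2_le)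

text \<open>Up to constants, \<open>E (Qa n)\<close> is \<open>e * H\<^sup>2 * (F False * F True)\<close>; dividing by its square turns \<open>X\<close> and
  \<open>Y\<close> into the two terms of \<open>r_n\<close>.\<close>

definition X where "X = e\<^sup>2 * (G False * G True) * (F False * F True)\<^sup>2"
definition Y where "Y = e * H\<^sup>2 * (F False * F True)\<^sup>2"

lemma X_nonneg: "0 \<le> X" and Y_nonneg: "0 \<le> Y"
  by (auto simp: X_def Y_def sums_nonneg)

lemma pairs_subset: "ordered_pairs n \<subseteq> {..<n} \<times> {..<n}"
  by (auto simp: ordered_pairs_def)

lemma slot_energy_le:
  assumes "\<And>x y. x < n \<Longrightarrow> y < n \<Longrightarrow> x \<noteq> y \<Longrightarrow> E (\<lambda>A. (completions n (g A) x y)\<^sup>2) \<le> c x * d y"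
    and "\<And>i. 0 \<le> c i" "\<And>i. 0 \<le> d i"
  shows "slot_energy g \<le> (\<Sum>i<n. c i) * (\<Sum>i<n. d i)"
proof -
  have "slot_energy g \<le> (\<Sum>z\<in>ordered_pairs n. c (fst z) * d (snd z))"
    unfolding slot_energy_def by (intro sum_mono assms(1)) (auto simp: ordered_pairs_def)
  also have "\<dots> \<le> (\<Sum>i<n. c i) * (\<Sum>i<n. d i)"
    using assms(2,3) by (rule sum_mult_sum_bound[OF pairs_subset])
  finally show ?thesis .
qed

lemma F_mult_ge_1: "1 \<le> F False * F True"
  using mult_mono[OF F_ge_1[of False] F_ge_1[of True]] sums_nonneg(1)[of False] by simp

text \<open>The product of both versions of the Cauchy-Schwarz bound; it trades powers of
  \<open>H\<close> for the inner products that occur in \<open>X\<close>.\<close>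

lemma H4_le: "H ^ 4 \<le> G False * G True * (F False * F True)"
  using mult_mono[OF H_power2_le[of False] H_power2_le[of True]] sums_nonneg
  by (simp add: power4_eq_xxxx power2_eq_square mult_ac)

lemma energy_total_ga1: "slot_energy ga \<le> 2 * Y"
proof -
  let ?M = "F False * F True"
  have "slot_energy ga \<le> (\<Sum>i<n. e * h i) * (\<Sum>i<n. h i * (?M\<^sup>2 + ?M))"
  proof (rule slot_energy_le)
    show "E (\<lambda>A. (completions n (ga A) x y)\<^sup>2) \<le> e * h x * (h y * (?M\<^sup>2 + ?M))"
      if "x < n" "y < n" "x \<noteq> y" for x y
      using energy_ga1[OF that] by (simp add: mult_ac)
  qed (auto intro!: mult_nonneg_nonneg nonneg add_nonneg_nonneg sums_nonneg)
  also have "\<dots> = e * H\<^sup>2 * (?M\<^sup>2 + ?M)"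
    by (simp add: H_def sum_distrib_left[symmetric] sum_distrib_right[symmetric] power2_eq_square mult_ac)
  also have "\<dots> \<le> e * H\<^sup>2 * (?M\<^sup>2 + ?M\<^sup>2)"
    using self_le_power[OF F_mult_ge_1, of 2] by (intro mult_left_mono) auto
  finally show ?thesis by (simp add: Y_def)
qed

lemma energy_total_ga2: "slot_energy (\<lambda>A i j k l. ga A k l i j) \<le> 8 * X"
proof -
  let ?R = "e * H\<^sup>2"
  have "slot_energy (\<lambda>A i j k l. ga A k l i j) \<le> (\<Sum>i<n. v i) * (\<Sum>i<n. m i * (4 * (?R\<^sup>2 + ?R)))"
  proof (rule slot_energy_le)
    show "E (\<lambda>A. (completions n (\<lambda>i j k l. ga A k l i j) x y)\<^sup>2) \<le> v x * (m y * (4 * (?R\<^sup>2 + ?R)))"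
      if "x < n" "y < n" "x \<noteq> y" for x y
      using energy_ga2[OF that] by (simp add: mult_ac)
  qed (auto intro!: mult_nonneg_nonneg nonneg add_nonneg_nonneg)
  also have "\<dots> = F False * F True * (4 * (?R\<^sup>2 + ?R))"
    by (simp add: F_def f_def sum_distrib_right[symmetric] mult_ac)
  also have "\<dots> \<le> F False * F True * (8 * ?R\<^sup>2)"
    using self_le_power[OF R_ge, of 2] by (intro mult_left_mono) (auto simp: sums_nonneg)
  also have "\<dots> = 8 * e\<^sup>2 * (F False * F True) * H ^ 4"
    by (simp add: power2_eq_square power4_eq_xxxx mult_ac)
  also have "\<dots> \<le> 8 * e\<^sup>2 * (F False * F True) * (G False * G True * (F False * F True))"
    using H4_le by (intro mult_left_mono) (auto simp: sums_nonneg)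
  also have "\<dots> = 8 * X" by (simp add: X_def power2_eq_square mult_ac)
  finally show ?thesis .
qed

text \<open>The part of the first sum that is quadratic in \<open>e\<close> leads to
  \<open>X\<close>, by Cauchy-Schwarz for \<open>H\<^sup>2\<close> and by bounding the sum of the
  squares of \<open>h\<close> by an inner product; the linear part leads to
  \<open>Y\<close>.\<close>

lemma star_sums_le:
  "(\<Sum>i<n. (e * h i * H)\<^sup>2 + e * h i * H) * (\<Sum>i<n. (f t i)\<^sup>2 * (F (\<not> t))\<^sup>2 + f t i * F (\<not> t)) \<le> 2 * X + 2 * Y"
proof -
  have "(\<Sum>i<n. (e * h i * H)\<^sup>2 + e * h i * H) = e\<^sup>2 * H\<^sup>2 * (\<Sum>i<n. (h i)\<^sup>2) + e * H\<^sup>2"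
    by (simp add: sum.distrib power_mult_distrib sum_distrib_left[symmetric] sum_distrib_right[symmetric]
        H_def[symmetric] mult_ac)
       (simp add: power2_eq_square)
  also have "\<dots> \<le> e\<^sup>2 * (G (\<not> t) * F t) * G t + e * H\<^sup>2"
    using H_power2_le[of "\<not> t"] sum_h_power2_le[of t]
    by (intro add_mono mult_mono order_refl) (auto intro!: sum_nonneg mult_nonneg_nonneg sums_nonneg)
  finally have 1: "(\<Sum>i<n. (e * h i * H)\<^sup>2 + e * h i * H) \<le> e\<^sup>2 * (G (\<not> t) * F t) * G t + e * H\<^sup>2" .
  have "(\<Sum>i<n. (f t i)\<^sup>2 * (F (\<not> t))\<^sup>2 + f t i * F (\<not> t)) = (\<Sum>i<n. (f t i)\<^sup>2) * (F (\<not> t))\<^sup>2 + F t * F (\<not> t)"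
    by (simp add: sum.distrib sum_distrib_right[symmetric] F_def[symmetric])
  also have "\<dots> \<le> F t * (F (\<not> t))\<^sup>2 + F t * (F (\<not> t))\<^sup>2"
    using sum_f_power2_le[of t] self_le_power[OF F_ge_1, of 2 "\<not> t"]
    by (intro add_mono mult_right_mono mult_left_mono) (auto simp: sums_nonneg)
  finally have 2: "(\<Sum>i<n. (f t i)\<^sup>2 * (F (\<not> t))\<^sup>2 + f t i * F (\<not> t)) \<le> 2 * (F t * (F (\<not> t))\<^sup>2)" by simp
  have "(\<Sum>i<n. (e * h i * H)\<^sup>2 + e * h i * H) * (\<Sum>i<n. (f t i)\<^sup>2 * (F (\<not> t))\<^sup>2 + f t i * F (\<not> t))
    \<le> (e\<^sup>2 * (G (\<not> t) * F t) * G t + e * H\<^sup>2) * (2 * (F t * (F (\<not> t))\<^sup>2))"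
    by (intro mult_mono 1 2)
       (auto intro!: sum_nonneg mult_nonneg_nonneg add_nonneg_nonneg f_nonneg nonneg sums_nonneg)
  also have "\<dots> = 2 * (e\<^sup>2 * (G t * G (\<not> t)) * (F t * F (\<not> t))\<^sup>2) + 2 * (e * H\<^sup>2 * (F t * (F (\<not> t))\<^sup>2))"
    by (simp add: power2_eq_square algebra_simps)
  also have "\<dots> \<le> 2 * (e\<^sup>2 * (G t * G (\<not> t)) * (F t * F (\<not> t))\<^sup>2) + 2 * (e * H\<^sup>2 * ((F t)\<^sup>2 * (F (\<not> t))\<^sup>2))"
    using self_le_power[OF F_ge_1, of 2 t] by (intro add_left_mono mult_left_mono mult_right_mono) auto
  also have "\<dots> = 2 * X + 2 * Y"
    by (cases t) (simp_all add: X_def Y_def power_mult_distrib mult_ac)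
  finally show ?thesis .
qed

lemma energy_total_ga3: "slot_energy (\<lambda>A i j k l. ga A l i j k) \<le> 2 * X + 2 * Y"
proof -
  have "slot_energy (\<lambda>A i j k l. ga A l i j k)
    \<le> (\<Sum>i<n. (e * h i * H)\<^sup>2 + e * h i * H) * (\<Sum>i<n. (f True i)\<^sup>2 * (F False)\<^sup>2 + f True i * F False)"
    by (rule slot_energy_le, rule energy_ga3)
       (auto intro!: mult_nonneg_nonneg nonneg add_nonneg_nonneg f_nonneg sums_nonneg)
  thus ?thesis using star_sums_le[of True] by simp
qed

lemma energy_total_ga4: "slot_energy (\<lambda>A i j k l. ga A j k l i) \<le> 2 * X + 2 * Y"
proof -
  have "slot_energy (\<lambda>A i j k l. ga A j k l i)
    \<le> (\<Sum>i<n. (f False i)\<^sup>2 * (F True)\<^sup>2 + f False i * F True) * (\<Sum>i<n. (e * h i * H)\<^sup>2 + e * h i * H)"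
    by (rule slot_energy_le, subst mult.commute, rule energy_ga4)
       (auto intro!: mult_nonneg_nonneg nonneg add_nonneg_nonneg f_nonneg sums_nonneg)
  thus ?thesis using star_sums_le[of False] by (simp add: mult.commute)
qed

lemma one_le_H: "1 \<le> H" using H_ge by simp

lemma H_le_GF: "H \<le> G t * F (\<not> t)"
  using self_le_power[OF one_le_H, of 2] H_power2_le[of t] by simp

lemma GF_ge_1: "1 \<le> G t * F (\<not> t)"
  using H_le_GF[of t] one_le_H by linarith

lemma energy_total_gb1: "e\<^sup>2 * slot_energy gb \<le> 4 * X"
proof -
  have le: "(\<Sum>i<n. f (\<not> t) i * ((f t i)\<^sup>2 * (F (\<not> t))\<^sup>2 + f t i * F (\<not> t))) \<le> 2 * (G t * (F (\<not> t))\<^sup>2)" for t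
  proof -
    have "(\<Sum>i<n. f (\<not> t) i * ((f t i)\<^sup>2 * (F (\<not> t))\<^sup>2 + f t i * F (\<not> t))) = G t * (F (\<not> t))\<^sup>2 + H * F (\<not> t)"
      by (simp add: distrib_left sum.distrib mult.assoc[symmetric] sum_distrib_right[symmetric] sums_alt)
    moreover have "H * F (\<not> t) \<le> G t * F (\<not> t) * F (\<not> t)"
      by (intro mult_right_mono H_le_GF sums_nonneg)
    ultimately show ?thesis by (simp add: power2_eq_square)
  qed
  have "slot_energy gb \<le> (\<Sum>i<n. f False i * ((f True i)\<^sup>2 * (F False)\<^sup>2 + f True i * F False))
     * (\<Sum>i<n. f True i * ((f False i)\<^sup>2 * (F True)\<^sup>2 + f False i * F True))"
  proof (rule slot_energy_le)
    show "E (\<lambda>A. (completions n (gb A) x y)\<^sup>2) \<le> f False x * ((f True x)\<^sup>2 * (F False)\<^sup>2 + f True x * F False)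
        * (f True y * ((f False y)\<^sup>2 * (F True)\<^sup>2 + f False y * F True))"
      if "x < n" "y < n" "x \<noteq> y" for x y
      using energy_gb1[OF that] by (simp add: f_def mult_ac)
  qed (auto intro!: mult_nonneg_nonneg add_nonneg_nonneg f_nonneg sums_nonneg)
  also have "\<dots> \<le> 2 * (G True * (F False)\<^sup>2) * (2 * (G False * (F True)\<^sup>2))"
    using le[of True] le[of False]
    by (intro mult_mono) (auto intro!: sum_nonneg mult_nonneg_nonneg add_nonneg_nonneg f_nonneg sums_nonneg)
  finally have "e\<^sup>2 * slot_energy gb \<le> e\<^sup>2 * (2 * (G True * (F False)\<^sup>2) * (2 * (G False * (F True)\<^sup>2)))"
    by (rule mult_left_mono) simp
  also have "\<dots> = 4 * X" by (simp add: X_def power2_eq_square mult_ac)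
  finally show ?thesis .
qed

text \<open>Each of the four terms is at most the product on the right: \<open>H\<^sup>2\<close> and
  \<open>H\<close> are replaced by products of the form \<open>G * F\<close>, and missing factors
  are filled in with quantities that are at least 1.\<close>

lemma path_sums_le:
  "F t * (G t * (H\<^sup>2 * (F (\<not> t))\<^sup>2 + G (\<not> t) * F (\<not> t)) + H * (G t * (F (\<not> t))\<^sup>2 + H * F (\<not> t)))
    \<le> 4 * (G False * G True * (F False * F True)\<^sup>2)"
proof -
  let ?a = "G t" and ?b = "G (\<not> t)" and ?p = "F t" and ?q = "F (\<not> t)"
  have nn: "0 \<le> ?a" "0 \<le> ?b" "0 \<le> ?p" "0 \<le> ?q" by (auto simp: sums_nonneg)
  have bp: "H\<^sup>2 \<le> ?b * ?p" "H \<le> ?b * ?p" "1 \<le> ?b * ?p" "H\<^sup>2 \<le> ?a * ?q" "1 \<le> ?p" "1 \<le> ?q"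
    using H_power2_le[of "\<not> t"] H_le_GF[of "\<not> t"] GF_ge_1[of "\<not> t"] H_power2_le[of t] F_ge_1 by auto
  have 1: "?p * ?a * ?q\<^sup>2 * H\<^sup>2 \<le> ?p * ?a * ?q\<^sup>2 * (?b * ?p)"
    by (intro mult_left_mono bp) (auto simp: nn)
  have 2: "?p * ?a * ?b * ?q * 1 \<le> ?p * ?a * ?b * ?q * (?p * ?q)"
    using mult_mono[OF bp(5,6)] nn by (intro mult_left_mono) (auto simp: nn)
  have 3: "?p * ?a * ?q\<^sup>2 * H \<le> ?p * ?a * ?q\<^sup>2 * (?b * ?p)"
    by (intro mult_left_mono bp) (auto simp: nn)
  have "H\<^sup>2 * 1 \<le> ?a * ?q * (?b * ?p)"
    by (intro mult_mono bp) (auto simp: nn)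
  hence 4: "?p * ?q * H\<^sup>2 \<le> ?p * ?q * (?a * ?q * (?b * ?p))"
    by (intro mult_left_mono) (auto simp: nn)
  have "?p * (?a * (H\<^sup>2 * ?q\<^sup>2 + ?b * ?q) + H * (?a * ?q\<^sup>2 + H * ?q))
      = ?p * ?a * ?q\<^sup>2 * H\<^sup>2 + ?p * ?a * ?b * ?q * 1 + ?p * ?a * ?q\<^sup>2 * H + ?p * ?q * H\<^sup>2"
    by (simp add: power2_eq_square algebra_simps)
  also have "\<dots> \<le> ?p * ?a * ?q\<^sup>2 * (?b * ?p) + ?p * ?a * ?b * ?q * (?p * ?q)
      + ?p * ?a * ?q\<^sup>2 * (?b * ?p) + ?p * ?q * (?a * ?q * (?b * ?p))"
    by (intro add_mono 1 2 3 4)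
  also have "\<dots> = 4 * (?a * ?b * (?p * ?q)\<^sup>2)" by (simp add: power2_eq_square algebra_simps)
  also have "\<dots> = 4 * (G False * G True * (F False * F True)\<^sup>2)"
    by (cases t) (simp_all add: mult_ac)
  finally show ?thesis .
qed

lemma path_weight_sum:
  "(\<Sum>i<n. f (\<not> t) i * ((f t i)\<^sup>2 * c + f t i * d)) = G t * c + H * d"
  by (simp add: distrib_left sum.distrib mult.assoc[symmetric] sum_distrib_right[symmetric] sums_alt)

lemma energy_total_gb2: "e\<^sup>2 * slot_energy (\<lambda>A i j k l. gb A l i j k) \<le> 4 * X"
proof -
  let ?c = "H\<^sup>2 * (F False)\<^sup>2 + G False * F False" and ?d = "G True * (F False)\<^sup>2 + H * F False"
  have "slot_energy (\<lambda>A i j k l. gb A l i j k)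
    \<le> (\<Sum>i<n. f (\<not> True) i * ((f True i)\<^sup>2 * ?c + f True i * ?d)) * (\<Sum>i<n. f True i)"
  proof (rule slot_energy_le)
    show "E (\<lambda>A. (completions n (\<lambda>i j k l. gb A l i j k) x y)\<^sup>2)
      \<le> f (\<not> True) x * ((f True x)\<^sup>2 * ?c + f True x * ?d) * f True y"
      if "x < n" "y < n" "x \<noteq> y" for x y
      using energy_gb2[OF that] by (simp add: f_def mult_ac)
  qed (auto intro!: mult_nonneg_nonneg add_nonneg_nonneg f_nonneg sums_nonneg)
  also have "\<dots> \<le> 4 * (G False * G True * (F False * F True)\<^sup>2)"
    unfolding path_weight_sum using path_sums_le[of True] by (simp add: F_def[symmetric] mult.commute)
  finally have "e\<^sup>2 * slot_energy (\<lambda>A i j k l. gb A l i j k) \<le> e\<^sup>2 * (4 * (G False * G True * (F False * F True)\<^sup>2))"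
    by (rule mult_left_mono) simp
  thus ?thesis by (simp add: X_def mult_ac)
qed

lemma energy_total_gb4: "e\<^sup>2 * slot_energy (\<lambda>A i j k l. gb A j k l i) \<le> 4 * X"
proof -
  let ?c = "H\<^sup>2 * (F True)\<^sup>2 + G True * F True" and ?d = "G False * (F True)\<^sup>2 + H * F True"
  have "slot_energy (\<lambda>A i j k l. gb A j k l i)
    \<le> (\<Sum>i<n. f False i) * (\<Sum>i<n. f (\<not> False) i * ((f False i)\<^sup>2 * ?c + f False i * ?d))"
  proof (rule slot_energy_le)
    show "E (\<lambda>A. (completions n (\<lambda>i j k l. gb A j k l i) x y)\<^sup>2)
      \<le> f False x * (f (\<not> False) y * ((f False y)\<^sup>2 * ?c + f False y * ?d))"
      if "x < n" "y < n" "x \<noteq> y" for x y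
      using energy_gb4[OF that] by (simp add: f_def mult_ac)
  qed (auto intro!: mult_nonneg_nonneg add_nonneg_nonneg f_nonneg sums_nonneg)
  also have "\<dots> \<le> 4 * (G False * G True * (F False * F True)\<^sup>2)"
    unfolding path_weight_sum using path_sums_le[of False] by (simp add: F_def[symmetric])
  finally have "e\<^sup>2 * slot_energy (\<lambda>A i j k l. gb A j k l i) \<le> e\<^sup>2 * (4 * (G False * G True * (F False * F True)\<^sup>2))"
    by (rule mult_left_mono) simp
  thus ?thesis by (simp add: X_def mult_ac)
qed

lemma energy_total_gb3: "e\<^sup>2 * slot_energy (\<lambda>A i j k l. gb A k l i j) \<le> 7 * X"
proof -
  let ?a = "G False" and ?b = "G True" and ?p = "F False" and ?q = "F True"
  let ?W = "H ^ 4 + ?a * ?b + (?b * H\<^sup>2 + ?b * H) + (?a * H\<^sup>2 + ?a * ?b + H\<^sup>2)"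
  have nn: "0 \<le> ?a" "0 \<le> ?b" "0 \<le> ?p" "0 \<le> ?q" "0 \<le> H" by (auto simp: sums_nonneg)
  have ge: "1 \<le> ?p" "1 \<le> ?q" "1 \<le> ?p * ?q" "?p \<le> ?p * ?q" "?q \<le> ?p * ?q"
    using F_ge_1[of False] F_ge_1[of True] F_mult_ge_1
    by (auto simp: mult_le_cancel_left1 mult_le_cancel_right1)
  have HH: "H \<le> H\<^sup>2" "H\<^sup>2 \<le> H ^ 4"
    using self_le_power[OF one_le_H, of 2] power_increasing[OF _ one_le_H, of 2 4] by auto
  \<comment> \<open>Seven summands, each at most the same product; this is the 7 of the final
    bound.\<close>
  have W: "?W \<le> 7 * (?a * ?b * (?p * ?q))"
  proof -
    have 1: "?a * ?b * 1 \<le> ?a * ?b * (?p * ?q)" by (intro mult_left_mono ge) (auto simp: nn)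
    have "?b * H\<^sup>2 \<le> ?b * (?a * ?q)" using H_power2_le[of False] by (intro mult_left_mono nn) simp
    also have "\<dots> \<le> ?b * (?a * (?p * ?q))" by (intro mult_left_mono ge nn)
    finally have 2: "?b * H\<^sup>2 \<le> ?a * ?b * (?p * ?q)" by (simp add: mult_ac)
    have "?a * H\<^sup>2 \<le> ?a * (?b * ?p)" using H_power2_le[of True] by (intro mult_left_mono nn) simp
    also have "\<dots> \<le> ?a * (?b * (?p * ?q))" by (intro mult_left_mono ge nn)
    finally have 3: "?a * H\<^sup>2 \<le> ?a * ?b * (?p * ?q)" by (simp add: mult_ac)
    have 4: "?b * H \<le> ?b * H\<^sup>2" by (intro mult_left_mono HH nn)
    show ?thesis using 1 2 3 4 HH H4_le by linarith
  qed
  have "slot_energy (\<lambda>A i j k l. gb A k l i j) \<le> (\<Sum>i<n. f True i) * (\<Sum>i<n. f False i * ?W)"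
  proof (rule slot_energy_le)
    show "E (\<lambda>A. (completions n (\<lambda>i j k l. gb A k l i j) x y)\<^sup>2) \<le> f True x * (f False y * ?W)"
      if xy: "x < n" "y < n" "x \<noteq> y" for x y
    proof -
      let ?u = "f True x" and ?w = "f False y"
      have u: "?u\<^sup>2 \<le> ?u" "0 \<le> ?u" "?w\<^sup>2 \<le> ?w" "0 \<le> ?w"
        using xy by (auto simp: f_power2_le f_nonneg)
      have "E (\<lambda>A. (completions n (\<lambda>i j k l. gb A k l i j) x y)\<^sup>2)
        \<le> ?w\<^sup>2 * (?u\<^sup>2 * (H ^ 4 + ?a * ?b) + ?u * (?b * H\<^sup>2 + ?b * H))
          + ?w * (?a * (?u\<^sup>2 * H\<^sup>2 + ?u * ?b) + H * (?u * H))"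
        by (rule energy_gb3[OF xy])
      also have "\<dots> \<le> ?w * (?u * (H ^ 4 + ?a * ?b) + ?u * (?b * H\<^sup>2 + ?b * H))
          + ?w * (?a * (?u * H\<^sup>2 + ?u * ?b) + H * (?u * H))"
        by (intro add_mono mult_mono u mult_nonneg_nonneg add_nonneg_nonneg nn zero_le_power order_refl)
      also have "\<dots> = ?u * (?w * ?W)" by (simp add: power2_eq_square algebra_simps)
      finally show ?thesis .
    qed
  qed (auto intro!: mult_nonneg_nonneg add_nonneg_nonneg f_nonneg nn)
  also have "\<dots> = ?p * ?q * ?W" by (simp add: F_def sum_distrib_right[symmetric] mult_ac)
  also have "\<dots> \<le> ?p * ?q * (7 * (?a * ?b * (?p * ?q)))" by (intro mult_left_mono W) (auto simp: nn)
  finally have "e\<^sup>2 * slot_energy (\<lambda>A i j k l. gb A k l i j) \<le> e\<^sup>2 * (?p * ?q * (7 * (?a * ?b * (?p * ?q))))"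
    by (rule mult_left_mono) simp
  also have "\<dots> = 7 * X" by (simp add: X_def power2_eq_square mult_ac)
  finally show ?thesis .
qed

text \<open>The energies add up to 31 X + 6 Y, and 16 * 31 = 496.\<close>

lemma variance_upper: "E (\<lambda>A. (Ustat n \<rho> A)\<^sup>2) \<le> 500 * (X + Y)"
proof -
  have "E (\<lambda>A. (Ustat n \<rho> A)\<^sup>2) \<le> 16 * (2 * Y + (2 * X + 2 * Y) + 8 * X + (2 * X + 2 * Y)
      + (4 * X + 4 * X + 7 * X + 4 * X))"
    by (rule order_trans[OF variance_le_energies])
       (unfold distrib_left[of "e\<^sup>2"], intro mult_left_mono add_mono energy_total_ga1 energy_total_ga2
        energy_total_ga3 energy_total_ga4 energy_total_gb1 energy_total_gb2 energy_total_gb3 energy_total_gb4, simp)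
  also have "\<dots> \<le> 500 * (X + Y)" using X_nonneg Y_nonneg by simp
  finally show ?thesis .
qed

end

section \<open>Balanced groups of nodes and the lower bound on the variance\<close>

text \<open>Signs are chosen one element at a time so that the cross terms are nonpositive.\<close>

lemma balanced_split:
  fixes g :: "'t \<Rightarrow> 'i \<Rightarrow> real"
  assumes "finite V"
  shows "\<exists>S\<subseteq>V. (\<Sum>t\<in>T. ((\<Sum>i\<in>S. g t i) - (\<Sum>i\<in>V - S. g t i))\<^sup>2) \<le> (\<Sum>t\<in>T. \<Sum>i\<in>V. (g t i)\<^sup>2)"
  using assms
proof (induction V rule: finite_induct)
  case (insert x V)
  then obtain S where S: "S \<subseteq> V"
    "(\<Sum>t\<in>T. ((\<Sum>i\<in>S. g t i) - (\<Sum>i\<in>V - S. g t i))\<^sup>2) \<le> (\<Sum>t\<in>T. \<Sum>i\<in>V. (g t i)\<^sup>2)" by blast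
  define D where "D t = (\<Sum>i\<in>S. g t i) - (\<Sum>i\<in>V - S. g t i)" for t
  have fin: "finite S" "finite (V - S)" "x \<notin> S" using S insert by (auto intro: finite_subset)
  have e1: "(\<Sum>i\<in>insert x S. g t i) - (\<Sum>i\<in>insert x V - insert x S. g t i) = D t + g t x" for t
  proof -
    have "insert x V - insert x S = V - S" using insert by auto
    thus ?thesis using fin by (simp add: D_def)
  qed
  have e2: "(\<Sum>i\<in>S. g t i) - (\<Sum>i\<in>insert x V - S. g t i) = D t - g t x" for t
  proof -
    have "insert x V - S = insert x (V - S)" using fin by auto
    thus ?thesis using fin insert by (simp add: D_def)
  qed
  have sq: "(D t + g t x)\<^sup>2 + (D t - g t x)\<^sup>2 = 2 * (D t)\<^sup>2 + 2 * (g t x)\<^sup>2" for t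
    by (simp add: power2_eq_square algebra_simps)
  have "(\<Sum>t\<in>T. (D t + g t x)\<^sup>2) + (\<Sum>t\<in>T. (D t - g t x)\<^sup>2)
      = 2 * (\<Sum>t\<in>T. (D t)\<^sup>2) + 2 * (\<Sum>t\<in>T. (g t x)\<^sup>2)"
    unfolding sum.distrib[symmetric] sum_distrib_left by (simp only: sq)
  also have "\<dots> \<le> 2 * (\<Sum>t\<in>T. \<Sum>i\<in>insert x V. (g t i)\<^sup>2)"
    using S(2) insert by (simp add: D_def sum.distrib)
  finally consider "(\<Sum>t\<in>T. (D t + g t x)\<^sup>2) \<le> (\<Sum>t\<in>T. \<Sum>i\<in>insert x V. (g t i)\<^sup>2)"
    | "(\<Sum>t\<in>T. (D t - g t x)\<^sup>2) \<le> (\<Sum>t\<in>T. \<Sum>i\<in>insert x V. (g t i)\<^sup>2)" by linarith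
  thus ?case
  proof cases
    case 1
    thus ?thesis using S(1) by (intro exI[of _ "insert x S"] conjI) (blast, unfold e1)
  next
    case 2
    thus ?thesis using S(1) by (intro exI[of _ S] conjI) (blast, unfold e2)
  qed
qed auto

text \<open>After normalising each family by its total, the relative imbalances have squares summing
  to at most 1/4. Each is thus at most 1/2, which leaves a quarter on either side. One set must
  serve all families, since a node heavy in one weight may be light in another.\<close>

lemma split_weights:
  fixes w :: "'t \<Rightarrow> 'i \<Rightarrow> real" and \<delta> :: real
  assumes "finite V" "finite T"
    and pos: "\<And>t. t \<in> T \<Longrightarrow> 0 < (\<Sum>i\<in>V. w t i)"
    and small: "\<And>t. t \<in> T \<Longrightarrow> (\<Sum>i\<in>V. (w t i)\<^sup>2) \<le> \<delta> * (\<Sum>i\<in>V. w t i)\<^sup>2"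
    and \<delta>: "card T * \<delta> \<le> 1 / 4"
  obtains S where "S \<subseteq> V" "\<And>t. t \<in> T \<Longrightarrow> (\<Sum>i\<in>V. w t i) / 4 \<le> (\<Sum>i\<in>S. w t i)"
    "\<And>t. t \<in> T \<Longrightarrow> (\<Sum>i\<in>V. w t i) / 4 \<le> (\<Sum>i\<in>V - S. w t i)"
proof -
  define W where "W t = (\<Sum>i\<in>V. w t i)" for t
  obtain S where S: "S \<subseteq> V" "(\<Sum>t\<in>T. ((\<Sum>i\<in>S. w t i / W t) - (\<Sum>i\<in>V - S. w t i / W t))\<^sup>2)
    \<le> (\<Sum>t\<in>T. \<Sum>i\<in>V. (w t i / W t)\<^sup>2)"
    using balanced_split[OF assms(1), where T = T and g = "\<lambda>t i. w t i / W t"] by blast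
  have "(\<Sum>t\<in>T. \<Sum>i\<in>V. (w t i / W t)\<^sup>2) \<le> (\<Sum>t\<in>T. \<delta>)"
  proof (rule sum_mono)
    fix t assume t: "t \<in> T"
    have "(\<Sum>i\<in>V. (w t i / W t)\<^sup>2) = (\<Sum>i\<in>V. (w t i)\<^sup>2) / (W t)\<^sup>2"
      by (simp add: power_divide sum_divide_distrib)
    also have "\<dots> \<le> \<delta>" using small[OF t] pos[OF t] by (simp add: W_def field_simps)
    finally show "(\<Sum>i\<in>V. (w t i / W t)\<^sup>2) \<le> \<delta>" .
  qed
  hence le: "(\<Sum>t\<in>T. ((\<Sum>i\<in>S. w t i / W t) - (\<Sum>i\<in>V - S. w t i / W t))\<^sup>2) \<le> (1 / 2)\<^sup>2"
    using S(2) \<delta> by (simp add: power2_eq_square)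
  have "W t / 4 \<le> (\<Sum>i\<in>S. w t i) \<and> W t / 4 \<le> (\<Sum>i\<in>V - S. w t i)" if t: "t \<in> T" for t
  proof -
    let ?a = "\<Sum>i\<in>S. w t i" and ?b = "\<Sum>i\<in>V - S. w t i"
    have W: "0 < W t" "?a + ?b = W t"
      using pos[OF t] sum.subset_diff[OF S(1) assms(1), of "w t"] by (auto simp: W_def)
    have "((\<Sum>i\<in>S. w t i / W t) - (\<Sum>i\<in>V - S. w t i / W t))\<^sup>2
       \<le> (\<Sum>t\<in>T. ((\<Sum>i\<in>S. w t i / W t) - (\<Sum>i\<in>V - S. w t i / W t))\<^sup>2)"
      by (rule member_le_sum[OF t]) (auto simp: assms(2))
    hence "((\<Sum>i\<in>S. w t i / W t) - (\<Sum>i\<in>V - S. w t i / W t))\<^sup>2 \<le> (1 / 2)\<^sup>2" using le by linarith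
    hence "\<bar>(\<Sum>i\<in>S. w t i / W t) - (\<Sum>i\<in>V - S. w t i / W t)\<bar> \<le> 1 / 2"
      by (simp add: abs_le_square_iff[symmetric])
    hence "\<bar>(?a - ?b) / W t\<bar> \<le> 1 / 2"
      by (simp add: sum_divide_distrib[symmetric] diff_divide_distrib)
    hence "\<bar>?a - ?b\<bar> \<le> W t / 2" using W(1) by (simp add: abs_divide field_simps)
    thus ?thesis using W(2) by linarith
  qed
  thus ?thesis using that S(1) unfolding W_def by blast
qed

lemma sum_prod4:
  fixes a b c d :: "nat \<Rightarrow> real"
  shows "(\<Sum>(i, j, k, l)\<in>X \<times> Y \<times> Z \<times> W. a i * b j * c k * d l)
    = (\<Sum>i\<in>X. a i) * (\<Sum>j\<in>Y. b j) * (\<Sum>k\<in>Z. c k) * (\<Sum>l\<in>W. d l)"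
proof -
  have "(\<Sum>i\<in>X. a i) * (\<Sum>j\<in>Y. b j) * (\<Sum>k\<in>Z. c k) * (\<Sum>l\<in>W. d l)
    = (\<Sum>i\<in>X. a i) * ((\<Sum>j\<in>Y. b j) * ((\<Sum>k\<in>Z. c k) * (\<Sum>l\<in>W. d l)))" by (simp add: mult_ac)
  also have "\<dots> = (\<Sum>(i, j, k, l)\<in>X \<times> Y \<times> Z \<times> W. a i * (b j * (c k * d l)))"
    by (simp only: sum_product sum.cartesian_product) (simp add: case_prod_beta sum_product sum.cartesian_product)
  finally show ?thesis by (simp add: mult.assoc)
qed

context p1_regime
begin

lemma K_ge_half: "x < n \<Longrightarrow> y < n \<Longrightarrow> 1 / 2 \<le> K x y"
proof -
  assume xy: "x < n" "y < n"
  have "m x * v y \<le> 1 / 8 * (1 / 8)" "m y * v x \<le> 1 / 8 * (1 / 8)"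
    by (intro mult_mono m_le v_le xy nonneg; simp)+
  hence "1 + m x * v y + m y * v x + e * h x * h y \<le> 2" using eta_le[OF xy] by simp
  moreover have "0 < 1 + m x * v y + m y * v x + e * h x * h y"
    using nonneg by (intro add_pos_nonneg mult_nonneg_nonneg) auto
  ultimately show ?thesis unfolding K_eq by (simp add: field_simps)
qed

text \<open>The nodes are split in two and both parts are split again, so each group keeps 1/16 of
  each of the three weights. Totals of 32 leave at least 8 after the first split, enough for the
  second.\<close>

lemma blocks_exist:
  obtains V1 V2 V3 V4 where "V1 \<subseteq> {..<n}" "V2 \<subseteq> {..<n}" "V3 \<subseteq> {..<n}" "V4 \<subseteq> {..<n}"
    "V1 \<inter> V2 = {}" "V1 \<inter> V3 = {}" "V1 \<inter> V4 = {}" "V2 \<inter> V3 = {}" "V2 \<inter> V4 = {}" "V3 \<inter> V4 = {}"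
    "H / 16 \<le> (\<Sum>i\<in>V1. h i)" "H / 16 \<le> (\<Sum>i\<in>V2. h i)"
    "F True / 16 \<le> (\<Sum>i\<in>V3. v i)" "F False / 16 \<le> (\<Sum>i\<in>V4. m i)"
proof -
  define w where "w t = (if t = 0 then h else f (t = 1))" for t :: nat
  let ?T = "{0, 1, 2 :: nat}"
  have w: "0 \<le> w t i" "i < n \<Longrightarrow> w t i \<le> 1 / 8" for t i
  proof -
    show "0 \<le> w t i" by (simp add: w_def f_nonneg nonneg)
    assume i: "i < n"
    have "h i \<le> 1 / 8 * 1" unfolding f_mult(1)[of False i, symmetric]
      using f_le[OF i, of False] f_le[OF i, of "\<not> False"] by (intro mult_mono) (auto simp: f_nonneg)
    thus "w t i \<le> 1 / 8" using f_le[OF i] by (simp add: w_def)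
  qed
  have W: "32 \<le> (\<Sum>i<n. w t i)" if "t \<in> ?T" for t
  proof -
    have "32 \<le> F t" for t using H_ge H_le_F[of t] by linarith
    thus ?thesis using H_ge by (simp add: w_def F_def H_def)
  qed
  \<comment> \<open>Single weights are at most 1/8, so the squares are small relative to the squared
    total. The constant 1/16 is admissible for three families because 3/16 is at most 1/4.\<close>
  have sq: "(\<Sum>i\<in>V. (w t i)\<^sup>2) \<le> 1 / 16 * (\<Sum>i\<in>V. w t i)\<^sup>2"
    if "V \<subseteq> {..<n}" "8 \<le> (\<Sum>i\<in>V. w t i)" for V t
  proof -
    have "(\<Sum>i\<in>V. (w t i)\<^sup>2) \<le> (\<Sum>i\<in>V. w t i * (1 / 8))"
      unfolding power2_eq_square using that(1) w by (intro sum_mono mult_left_mono) auto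
    also have "\<dots> = 1 / 8 * 1 * (\<Sum>i\<in>V. w t i)" by (simp add: sum_divide_distrib)
    also have "\<dots> \<le> 1 / 8 * ((\<Sum>i\<in>V. w t i) / 2) * (\<Sum>i\<in>V. w t i)"
      using that(2) by (intro mult_right_mono mult_left_mono) auto
    finally show ?thesis by (simp add: power2_eq_square)
  qed
  obtain S where S: "S \<subseteq> {..<n}" "\<And>t. t \<in> ?T \<Longrightarrow> (\<Sum>i<n. w t i) / 4 \<le> (\<Sum>i\<in>S. w t i)"
    "\<And>t. t \<in> ?T \<Longrightarrow> (\<Sum>i<n. w t i) / 4 \<le> (\<Sum>i\<in>{..<n} - S. w t i)"
  proof (rule split_weights[of "{..<n}" ?T w "1 / 16"])
    show "0 < (\<Sum>i<n. w t i)" if "t \<in> ?T" for t using W[OF that] by linarith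
    show "(\<Sum>i<n. (w t i)\<^sup>2) \<le> 1 / 16 * (\<Sum>i<n. w t i)\<^sup>2" if "t \<in> ?T" for t
      using W[OF that] by (intro sq) auto
  qed (use that in auto)
  have half: "\<exists>S\<subseteq>V. (\<forall>t\<in>?T. (\<Sum>i<n. w t i) / 16 \<le> (\<Sum>i\<in>S. w t i))
      \<and> (\<forall>t\<in>?T. (\<Sum>i<n. w t i) / 16 \<le> (\<Sum>i\<in>V - S. w t i))"
    if V: "V \<subseteq> {..<n}" "\<And>t. t \<in> ?T \<Longrightarrow> (\<Sum>i<n. w t i) / 4 \<le> (\<Sum>i\<in>V. w t i)" for V
  proof -
    have 8: "8 \<le> (\<Sum>i\<in>V. w t i)" if "t \<in> ?T" for t using W[OF that] V(2)[OF that] by linarith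
    obtain S where S: "S \<subseteq> V" "\<And>t. t \<in> ?T \<Longrightarrow> (\<Sum>i\<in>V. w t i) / 4 \<le> (\<Sum>i\<in>S. w t i)"
      "\<And>t. t \<in> ?T \<Longrightarrow> (\<Sum>i\<in>V. w t i) / 4 \<le> (\<Sum>i\<in>V - S. w t i)"
    proof (rule split_weights[of V ?T w "1 / 16"])
      show "0 < (\<Sum>i\<in>V. w t i)" if "t \<in> ?T" for t using 8[OF that] by linarith
      show "(\<Sum>i\<in>V. (w t i)\<^sup>2) \<le> 1 / 16 * (\<Sum>i\<in>V. w t i)\<^sup>2" if "t \<in> ?T" for t
        using 8[OF that] V by (intro sq) auto
    qed (use that V in \<open>auto intro: finite_subset\<close>)
    have "(\<Sum>i<n. w t i) / 16 \<le> (\<Sum>i\<in>S. w t i) \<and> (\<Sum>i<n. w t i) / 16 \<le> (\<Sum>i\<in>V - S. w t i)"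
      if "t \<in> ?T" for t
      using V(2)[OF that] S(2)[OF that] S(3)[OF that] by linarith
    thus ?thesis using S(1) by blast
  qed
  obtain V1 where V1: "V1 \<subseteq> S" "\<forall>t\<in>?T. (\<Sum>i<n. w t i) / 16 \<le> (\<Sum>i\<in>V1. w t i)"
    "\<forall>t\<in>?T. (\<Sum>i<n. w t i) / 16 \<le> (\<Sum>i\<in>S - V1. w t i)"
    using half[OF S(1,2)] by blast
  obtain V3 where V3: "V3 \<subseteq> {..<n} - S" "\<forall>t\<in>?T. (\<Sum>i<n. w t i) / 16 \<le> (\<Sum>i\<in>V3. w t i)"
    "\<forall>t\<in>?T. (\<Sum>i<n. w t i) / 16 \<le> (\<Sum>i\<in>{..<n} - S - V3. w t i)"
    using half[of "{..<n} - S"] S(3) by blast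
  show ?thesis
    by (rule that[of V1 "S - V1" V3 "{..<n} - S - V3"])
       (use S(1) V1 V3 in \<open>auto simp: w_def f_def F_def H_def\<close>)
qed

end

section \<open>Expected cycle counts and the covariance with a count of reciprocated pairs\<close>

locale p1_blocks = p1_regime +
  fixes V1 V2 V3 V4 :: "nat set"
  assumes sub: "V1 \<subseteq> {..<n}" "V2 \<subseteq> {..<n}" "V3 \<subseteq> {..<n}" "V4 \<subseteq> {..<n}"
    and disj: "V1 \<inter> V2 = {}" "V1 \<inter> V3 = {}" "V1 \<inter> V4 = {}" "V2 \<inter> V3 = {}" "V2 \<inter> V4 = {}" "V3 \<inter> V4 = {}"
    and weights: "H / 16 \<le> (\<Sum>i\<in>V1. h i)" "H / 16 \<le> (\<Sum>i\<in>V2. h i)"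
      "F True / 16 \<le> (\<Sum>i\<in>V3. v i)" "F False / 16 \<le> (\<Sum>i\<in>V4. m i)"
begin

lemma finite_blocks: "finite V1" "finite V2" "finite V3" "finite V4"
  using sub by (auto intro: finite_subset)

lemma blocks_quads: "V1 \<times> V2 \<times> V3 \<times> V4 \<subseteq> quads n"
  using sub disj by (auto simp: quads_def)

definition R where "R = e * H\<^sup>2"
definition M where "M = F False * F True"

lemma mean_Ta_nonneg: "0 \<le> E (\<lambda>A. Ta A i j k l)"
  by (intro mean_nonneg) (simp add: Ta_def A_range)

lemma mean_Qa_upper: "E (Qa n) \<le> R * M"
proof -
  have "E (Qa n) \<le> (\<Sum>(i, j, k, l)\<in>quads n. (e * h i) * h j * v k * m l)"
    unfolding mean_Qa
  proof (intro sum_mono, clarify)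
    fix i j k l assume q: "(i, j, k, l) \<in> quads n"
    have "K i j * K j k * K k l * K l i \<le> 1 * 1 * 1 * 1"
      by (intro mult_mono K_le_1 nonneg mult_nonneg_nonneg) auto
    hence "K i j * K j k * K k l * K l i * (e * h i * h j * m l * v k) \<le> 1 * (e * h i * h j * m l * v k)"
      by (intro mult_right_mono mult_nonneg_nonneg nonneg) auto
    thus "E (\<lambda>A. Ta A i j k l) \<le> e * h i * h j * v k * m l"
      unfolding mean_Tab(1)[OF q] by (simp add: mult_ac)
  qed
  also have "\<dots> \<le> (\<Sum>(i, j, k, l)\<in>{..<n} \<times> {..<n} \<times> {..<n} \<times> {..<n}. (e * h i) * h j * v k * m l)"
    by (rule sum_mono2) (auto simp: quads_def nonneg)
  also have "\<dots> = (\<Sum>i<n. e * h i) * (\<Sum>j<n. h j) * (\<Sum>k<n. v k) * (\<Sum>l<n. m l)"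
    by (rule sum_prod4)
  also have "\<dots> = R * M"
    by (simp add: R_def M_def F_def f_def H_def[symmetric] sum_distrib_left[symmetric] power2_eq_square mult_ac)
  finally show ?thesis .
qed

text \<open>The constant is 16 for four normalisers \<open>K\<close> of at least 1/2, times the
  fourth power of 16 for the four groups.\<close>

lemma mean_Ta_blocks: "R * M / 2 ^ 20 \<le> (\<Sum>(i, j, k, l)\<in>V1 \<times> V2 \<times> V3 \<times> V4. E (\<lambda>A. Ta A i j k l))"
proof -
  have pos: "0 \<le> H" "0 \<le> F False" "0 \<le> F True" by (auto simp: sums_nonneg)
  have "R * M / 2 ^ 20 = 1 / 16 * e * (H / 16) * (H / 16) * (F True / 16) * (F False / 16)"
    by (simp add: R_def M_def power2_eq_square)
  also have "\<dots> \<le> 1 / 16 * e * (\<Sum>i\<in>V1. h i) * (\<Sum>i\<in>V2. h i) * (\<Sum>i\<in>V3. v i) * (\<Sum>i\<in>V4. m i)"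
    by (intro mult_mono weights order_refl mult_nonneg_nonneg sum_nonneg nonneg) (auto simp: pos)
  also have "\<dots> = (\<Sum>(i, j, k, l)\<in>V1 \<times> V2 \<times> V3 \<times> V4. 1 / 16 * e * h i * h j * v k * m l)"
    unfolding sum_prod4[of "\<lambda>i. 1 / 16 * e * h i"] by (simp add: sum_distrib_left sum_divide_distrib)
  also have "\<dots> \<le> (\<Sum>(i, j, k, l)\<in>V1 \<times> V2 \<times> V3 \<times> V4. E (\<lambda>A. Ta A i j k l))"
  proof (intro sum_mono, clarify)
    fix i j k l assume "i \<in> V1" "j \<in> V2" "k \<in> V3" "l \<in> V4"
    hence q: "(i, j, k, l) \<in> quads n" using blocks_quads by auto
    hence lt: "i < n" "j < n" "k < n" "l < n" by (auto simp: quads_def)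
    have "1 / 2 * (1 / 2) * (1 / 2) * (1 / 2) \<le> K i j * K j k * K k l * K l i"
      by (intro mult_mono K_ge_half lt mult_nonneg_nonneg nonneg) auto
    hence "1 / 16 * (e * h i * h j * m l * v k) \<le> K i j * K j k * K k l * K l i * (e * h i * h j * m l * v k)"
      by (intro mult_right_mono mult_nonneg_nonneg nonneg) auto
    thus "1 / 16 * e * h i * h j * v k * m l \<le> E (\<lambda>A. Ta A i j k l)"
      unfolding mean_Tab(1)[OF q] by (simp add: mult_ac)
  qed
  finally show ?thesis .
qed

lemma mean_Qa_lower: "R * M / 2 ^ 20 \<le> E (Qa n)"
proof -
  have "(\<Sum>(i, j, k, l)\<in>V1 \<times> V2 \<times> V3 \<times> V4. E (\<lambda>A. Ta A i j k l)) \<le> E (Qa n)"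
    unfolding mean_Qa by (rule sum_mono2) (auto simp: blocks_quads mean_Ta_nonneg)
  thus ?thesis using mean_Ta_blocks by linarith
qed

text \<open>The test variable of the covariance argument. Between two disjoint groups its summands
  belong to different dyads, and each such pair is slot ij of the block patterns.\<close>

definition S11 :: "adjm \<Rightarrow> real" where
  "S11 A = (\<Sum>z\<in>V1 \<times> V2. A11 A (fst z) (snd z))"

lemma inj_dyad: "P \<inter> Q = {} \<Longrightarrow> inj_on (case_prod dyad) (P \<times> Q)"
  by (auto simp: inj_on_def dyad_eq_iff)

text \<open>At most one pair of \<open>V1 \<times> V2\<close> has the dyad \<open>d\<close>, so
  emptying it changes the count by 0 or 1, and such a number equals its square.\<close>

lemma S11_diff:
  "(S11 (adj \<omega>) - S11 (adj (\<omega>(d := (False, False)))))\<^sup>2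
     = (\<Sum>z\<in>V1 \<times> V2. if dyad (fst z) (snd z) = d then A11 (adj \<omega>) (fst z) (snd z) else 0)"
proof -
  let ?t = "\<lambda>z. if dyad (fst z) (snd z) = d then A11 (adj \<omega>) (fst z) (snd z) else 0"
  have fin: "finite (V1 \<times> V2)" using finite_blocks by simp
  have "S11 (adj \<omega>) - S11 (adj (\<omega>(d := (False, False)))) = (\<Sum>z\<in>V1 \<times> V2. ?t z)"
    unfolding S11_def sum_subtractf[symmetric]
  proof (rule sum.cong[OF refl])
    fix z assume z: "z \<in> V1 \<times> V2"
    have ne: "fst z \<noteq> snd z" using z disj by auto
    show "A11 (adj \<omega>) (fst z) (snd z) - A11 (adj (\<omega>(d := (False, False)))) (fst z) (snd z) = ?t z"
    proof (cases "dyad (fst z) (snd z) = d")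
      case True
      thus ?thesis by (simp add: A11_adj[OF ne] J11_def)
    next
      case False
      thus ?thesis by (simp add: clear_dyad_eq(2)[OF False])
    qed
  qed
  moreover have "(\<Sum>z\<in>V1 \<times> V2. ?t z)\<^sup>2 = (\<Sum>z\<in>V1 \<times> V2. ?t z)"
  proof (cases "\<exists>z0\<in>V1 \<times> V2. dyad (fst z0) (snd z0) = d")
    case True
    then obtain z0 where z0: "z0 \<in> V1 \<times> V2" "dyad (fst z0) (snd z0) = d" by blast
    have "?t z = (if z = z0 then A11 (adj \<omega>) (fst z0) (snd z0) else 0)" if z: "z \<in> V1 \<times> V2" for z
    proof (cases "z = z0")
      case False
      have "dyad (fst z) (snd z) \<noteq> d"
        using inj_onD[OF inj_dyad[OF disj(1)] _ z z0(1)] z0(2) False by (auto simp: case_prod_beta)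
      thus ?thesis using False by simp
    qed (use z0 in simp)
    hence "(\<Sum>z\<in>V1 \<times> V2. ?t z) = (\<Sum>z\<in>V1 \<times> V2. if z = z0 then A11 (adj \<omega>) (fst z0) (snd z0) else 0)"
      by (rule sum.cong[OF refl])
    also have "\<dots> = A11 (adj \<omega>) (fst z0) (snd z0)"
      using z0(1) by (simp only: sum.delta[OF fin] if_True)
    finally show ?thesis by (simp only: power2_eq_square A_idem)
  next
    case False
    hence "(\<Sum>z\<in>V1 \<times> V2. ?t z) = 0" by (intro sum.neutral) auto
    thus ?thesis by (simp only: power2_eq_square mult_zero_left)
  qed
  ultimately show ?thesis by simp
qed

text \<open>With increments in {0, 1}, Efron-Stein bounds the variance by the mean, as for a Poisson
  variable.\<close>

lemma variance_S11: "E (\<lambda>A. (S11 A - E S11)\<^sup>2) \<le> R"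
proof -
  let ?D = "dyads n" and ?\<omega> = "\<lambda>_. (False, False)"
  let ?Z = "V1 \<times> V2"
  have Z: "fst z \<noteq> snd z" "dyad (fst z) (snd z) \<in> ?D" if "z \<in> ?Z" for z
    using that sub disj by auto
  define c where "c = E S11"
  have "E (\<lambda>A. (S11 A - c)\<^sup>2) = E (\<lambda>A. (S11 A)\<^sup>2 + (- 2 * c) * S11 A + c\<^sup>2)"
    by (simp add: power2_eq_square algebra_simps)
  also have "\<dots> = E (\<lambda>A. (S11 A)\<^sup>2) - c\<^sup>2"
    unfolding mean_add mean_cmult mean_const[OF finite_dyads] c_def[symmetric]
    by (simp add: power2_eq_square)
  also have "\<dots> \<le> (\<Sum>d\<in>?D. mean ?D ?\<omega> (\<lambda>\<omega>. (S11 (adj \<omega>) - S11 (adj (\<omega>(d := (False, False)))))\<^sup>2))"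
    unfolding c_def by (rule efron_stein[OF finite_dyads])
  also have "\<dots> = (\<Sum>d\<in>?D. \<Sum>z\<in>?Z. if dyad (fst z) (snd z) = d then E (\<lambda>A. A11 A (fst z) (snd z)) else 0)"
    unfolding S11_diff mean_sum
    by (intro sum.cong refl) (simp add: mean_const)
  also have "\<dots> = (\<Sum>z\<in>?Z. \<Sum>d\<in>?D. if dyad (fst z) (snd z) = d then E (\<lambda>A. A11 A (fst z) (snd z)) else 0)"
    by (rule sum.swap)
  also have "\<dots> = (\<Sum>z\<in>?Z. E (\<lambda>A. A11 A (fst z) (snd z)))"
    by (rule sum.cong[OF refl]) (simp only: sum.delta'[OF finite_dyads] Z if_True)
  also have "\<dots> = (\<Sum>z\<in>?Z. K (fst z) (snd z) * (e * h (fst z) * h (snd z)))"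
    by (intro sum.cong refl mean_A Z finite_dyads)
  also have "\<dots> \<le> (\<Sum>z\<in>?Z. (e * h (fst z)) * h (snd z))"
    by (intro sum_mono mult_left_le_one_le mult_nonneg_nonneg K_le_1 nonneg) simp
  also have "\<dots> \<le> (\<Sum>i<n. e * h i) * (\<Sum>i<n. h i)"
    using sub by (intro sum_mult_sum_bound[where c = "\<lambda>i. e * h i"]) (auto simp: nonneg)
  also have "\<dots> = R"
    by (simp add: R_def H_def[symmetric] sum_distrib_left[symmetric] power2_eq_square)
  finally show ?thesis by (simp only: c_def)
qed

text \<open>Patterns avoiding the dyad of \<open>x\<close> and \<open>y\<close> are independent of
  it, and their a- and b-parts cancel in the mean. In patterns using it the b-part vanishes when the
  pair is reciprocated, while the a-part is nonnegative and keeps its full mean if the pair fills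
  slot ij.\<close>

lemma mean_Ustat_A11:
  assumes xy: "x \<in> V1" "y \<in> V2"
  shows "(\<Sum>(i, j, k, l)\<in>{x} \<times> {y} \<times> V3 \<times> V4. E (\<lambda>A. Ta A i j k l)) \<le> E (\<lambda>A. A11 A x y * Ustat n \<rho> A)"
proof -
  have ne: "x \<noteq> y" "x < n" "y < n" using xy sub disj by auto
  have Qsub: "{x} \<times> {y} \<times> V3 \<times> V4 \<subseteq> quads n" using xy blocks_quads by auto
  have "(\<Sum>(i, j, k, l)\<in>{x} \<times> {y} \<times> V3 \<times> V4. E (\<lambda>A. Ta A i j k l))
    = (\<Sum>q\<in>quads n. if q \<in> {x} \<times> {y} \<times> V3 \<times> V4 then (case q of (i, j, k, l) \<Rightarrow> E (\<lambda>A. Ta A i j k l)) else 0)"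
    using Qsub by (subst sum.inter_restrict[symmetric]) (auto intro!: sum.cong)
  also have "\<dots> \<le> (\<Sum>(i, j, k, l)\<in>quads n. E (\<lambda>A. A11 A x y * (Ta A i j k l - e * Tb A i j k l)))"
  proof (rule sum_mono, clarify)
    fix i j k l assume q: "(i, j, k, l) \<in> quads n"
    let ?rhs = "E (\<lambda>A. A11 A x y * (Ta A i j k l - e * Tb A i j k l))"
    have d: "distinct [i, j, k, l]" using q by (auto simp: quads_def)
    show "(if (i, j, k, l) \<in> {x} \<times> {y} \<times> V3 \<times> V4 then E (\<lambda>A. Ta A i j k l) else 0) \<le> ?rhs"
    proof (cases "dyad x y \<in> {dyad i j, dyad j k, dyad k l, dyad l i}")
      case False
      have "indep_of {dyad x y} (\<lambda>\<omega>. Ta (adj \<omega>) i j k l - e * Tb (adj \<omega>) i j k l)"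
        unfolding Ta_def Tb_def using False
        by (intro indep_of_comp2[where h = "\<lambda>a b. a - e * b"] indep_of_mult indep_adj)
           (auto simp: dyad_commute[of l k])
      hence "?rhs = K x y * (e * h x * h y) * E (\<lambda>A. Ta A i j k l - e * Tb A i j k l)"
        using ne by (intro mean_A_mult) auto
      also have "\<dots> = 0"
        by (simp add: mean_diff mean_cmult mean_Tab[OF q])
      finally have "?rhs = 0" .
      moreover have "(i, j, k, l) \<notin> {x} \<times> {y} \<times> V3 \<times> V4" using False by auto
      ultimately show ?thesis by (simp only: if_False order_refl)
    next
      case True
      have Tb0: "A11 A x y * Tb A i j k l = 0" for A
        using True by (auto simp: dyad_eq_iff Tb_def A11_def A10_def A00_def)
      have Ta0: "0 \<le> A11 A x y * Ta A i j k l" for A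
        by (simp add: Ta_def A_range)
      have rhs: "?rhs = E (\<lambda>A. A11 A x y * Ta A i j k l)"
        by (simp add: right_diff_distrib mult.left_commute[of _ e] Tb0)
      show ?thesis
      proof (cases "(i, j, k, l) \<in> {x} \<times> {y} \<times> V3 \<times> V4")
        case True
        hence "A11 A x y * Ta A i j k l = Ta A i j k l" for A
          by (simp add: Ta_def mult.assoc[symmetric] A_idem)
        hence "?rhs = E (\<lambda>A. Ta A i j k l)" unfolding rhs by (simp only:)
        thus ?thesis using True by (simp only: if_True order_refl)
      next
        case False
        have "0 \<le> ?rhs" unfolding rhs by (intro mean_nonneg Ta0)
        thus ?thesis using False by (simp only: if_False)
      qed
    qed
  qed
  also have "\<dots> = E (\<lambda>A. A11 A x y * Ustat n \<rho> A)"
  proof -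
    have "A11 A x y * Ustat n \<rho> A = (\<Sum>q\<in>quads n. A11 A x y * (case q of (i, j, k, l) \<Rightarrow> Ta A i j k l - e * Tb A i j k l))" for A
      unfolding Ustat_def Qa_eq Qb_eq
      by (simp add: sum_distrib_left[symmetric] sum_subtractf case_prod_beta)
    thus ?thesis by (simp add: mean_sum case_prod_beta)
  qed
  finally show ?thesis .
qed

text \<open>The covariance with \<open>S11\<close> is at least \<open>R * M / 2 ^ 20\<close> and
  \<open>S11\<close> has variance at most \<open>R\<close>; Cauchy-Schwarz divides the square of the
  one by the other. Centring \<open>S11\<close> changes nothing because \<open>Ustat\<close> has
  mean 0.\<close>

lemma variance_lower: "R * M\<^sup>2 / 2 ^ 40 \<le> E (\<lambda>A. (Ustat n \<rho> A)\<^sup>2)"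
proof -
  have R: "1 \<le> R" using R_ge by (simp add: R_def)
  have "R * M / 2 ^ 20 \<le> (\<Sum>(i, j, k, l)\<in>V1 \<times> V2 \<times> V3 \<times> V4. E (\<lambda>A. Ta A i j k l))"
    by (rule mean_Ta_blocks)
  also have "\<dots> = (\<Sum>x\<in>V1. \<Sum>y\<in>V2. (\<Sum>(i, j, k, l)\<in>{x} \<times> {y} \<times> V3 \<times> V4. E (\<lambda>A. Ta A i j k l)))"
  proof -
    have 1: "(\<Sum>(i, j, k, l)\<in>{x} \<times> {y} \<times> V3 \<times> V4. E (\<lambda>A. Ta A i j k l))
       = (\<Sum>(k, l)\<in>V3 \<times> V4. E (\<lambda>A. Ta A x y k l))" for x y
      by (rule sum.reindex_bij_witness[of _ "\<lambda>(k, l). (x, y, k, l)" "\<lambda>(i, j, k, l). (k, l)"]) auto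
    show ?thesis unfolding 1 sum.cartesian_product by (simp add: case_prod_beta)
  qed
  also have "\<dots> \<le> (\<Sum>x\<in>V1. \<Sum>y\<in>V2. E (\<lambda>A. A11 A x y * Ustat n \<rho> A))"
    by (intro sum_mono mean_Ustat_A11)
  also have "\<dots> = E (\<lambda>A. S11 A * Ustat n \<rho> A)"
    by (simp add: S11_def sum_distrib_right mean_sum sum.cartesian_product case_prod_beta)
  also have "\<dots> = E (\<lambda>A. Ustat n \<rho> A * (S11 A - E S11))"
  proof -
    have "E (\<lambda>A. Ustat n \<rho> A * (S11 A - E S11)) = E (\<lambda>A. S11 A * Ustat n \<rho> A - E S11 * Ustat n \<rho> A)"
      by (simp add: algebra_simps)
    thus ?thesis by (simp only: mean_diff mean_cmult mean_Ustat)
  qed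
  finally have "R * M / 2 ^ 20 \<le> E (\<lambda>A. Ustat n \<rho> A * (S11 A - E S11))" .
  hence "(R * M / 2 ^ 20)\<^sup>2 \<le> (E (\<lambda>A. Ustat n \<rho> A * (S11 A - E S11)))\<^sup>2"
    using R by (intro power_mono) (auto simp: M_def sums_nonneg)
  also have "\<dots> \<le> R * E (\<lambda>A. (Ustat n \<rho> A)\<^sup>2)"
    using R by (intro mean_Cauchy_Schwarz variance_S11) auto
  finally have "R * (R * M\<^sup>2 / 2 ^ 40) \<le> R * E (\<lambda>A. (Ustat n \<rho> A)\<^sup>2)"
    by (simp add: power2_eq_square mult_ac)
  thus ?thesis using R by (simp only: mult_le_cancel_left_pos[of R])
qed

end

section \<open>Lower tails of the cycle counts\<close>

context p1_model
begin

definition prob :: "(adjm \<Rightarrow> bool) \<Rightarrow> real" where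
  "prob P = E (\<lambda>A. of_bool (P A))"

lemma prob_mono: "(\<And>A. P A \<Longrightarrow> Q A) \<Longrightarrow> prob P \<le> prob Q"
  unfolding prob_def by (intro mean_mono) (auto simp: of_bool_def)

lemma prob_or_le: "prob P \<le> a \<Longrightarrow> prob Q \<le> b \<Longrightarrow> prob (\<lambda>A. P A \<or> Q A) \<le> a + b"
proof -
  have "prob (\<lambda>A. P A \<or> Q A) \<le> prob P + prob Q"
    unfolding prob_def mean_add[symmetric] by (intro mean_mono) (auto simp: of_bool_def)
  thus "prob P \<le> a \<Longrightarrow> prob Q \<le> b \<Longrightarrow> prob (\<lambda>A. P A \<or> Q A) \<le> a + b" by linarith
qed

lemma prob_ex_le:
  fixes c :: real
  assumes "S \<subseteq> {..<n}" "\<And>x. x \<in> S \<Longrightarrow> prob (P x) \<le> c" "0 \<le> c"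
  shows "prob (\<lambda>A. \<exists>x\<in>S. P x A) \<le> n * c"
proof -
  have fin: "finite S" using assms(1) by (auto intro: finite_subset)
  have "prob (\<lambda>A. \<exists>x\<in>S. P x A) \<le> (\<Sum>x\<in>S. prob (P x))"
    unfolding prob_def mean_sum[symmetric]
  proof (rule mean_mono)
    fix \<omega>
    show "of_bool (\<exists>x\<in>S. P x (adj \<omega>)) \<le> (\<Sum>x\<in>S. of_bool (P x (adj \<omega>)) :: real)"
    proof (cases "\<exists>x\<in>S. P x (adj \<omega>)")
      case True
      then obtain x where "x \<in> S" "P x (adj \<omega>)" by blast
      hence "of_bool (P x (adj \<omega>)) \<le> (\<Sum>x\<in>S. of_bool (P x (adj \<omega>)) :: real)"
        using fin by (intro member_le_sum) auto
      thus ?thesis using True \<open>P x (adj \<omega>)\<close> by simp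
    qed (auto intro: sum_nonneg)
  qed
  also have "\<dots> \<le> card S * c" using assms(2) by (rule sum_bounded_above)
  also have "\<dots> \<le> n * c"
    using card_mono[OF _ assms(1)] assms(3) by (intro mult_right_mono) auto
  finally show ?thesis .
qed

text \<open>Pairs between two disjoint sets have distinct dyads, so a block is a family of
  independent coordinates. The entry \<open>a\<close> and its reading \<open>J\<close> of the dyad
  state are parameters, so that one proof covers one-way, reciprocated and null pairs.\<close>

lemma block_lower_tail:
  assumes PQ: "P \<subseteq> {..<n}" "Q \<subseteq> {..<n}" "P \<inter> Q = {}" and "0 < L"
    and w: "\<And>z. z \<in> P \<times> Q \<Longrightarrow> indep_of (case_prod dyad ` (P \<times> Q)) (\<lambda>\<omega>. w z (adj \<omega>))"
    and a: "\<And>x y \<omega>. x \<noteq> y \<Longrightarrow> a (adj \<omega>) x y = J x y (\<omega> (dyad x y))"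
    and J: "\<And>x y s. J x y s = 0 \<or> J x y s = 1"
    and q: "\<And>x y. x \<in> P \<Longrightarrow> y \<in> Q \<Longrightarrow> q x y \<le> (\<Sum>s\<in>UNIV. pr (dyad x y) s * J x y s)"
  shows "prob (\<lambda>A. (\<forall>z\<in>P \<times> Q. 0 \<le> w z A \<and> w z A \<le> L) \<and> c \<le> (\<Sum>z\<in>P \<times> Q. q (fst z) (snd z) * w z A)
      \<and> (\<Sum>z\<in>P \<times> Q. w z A * a A (fst z) (snd z)) < c / 4) \<le> exp (- (c / (4 * L)))"
proof -
  have inj: "inj_on (case_prod dyad) (P \<times> Q)" using PQ by (auto simp: inj_on_def dyad_eq_iff)
  have "mean (dyads n) (\<lambda>_. (False, False)) (\<lambda>\<omega>. of_bool ((\<forall>z\<in>P \<times> Q. 0 \<le> w z (adj \<omega>) \<and> w z (adj \<omega>) \<le> L)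
      \<and> c \<le> (\<Sum>z\<in>P \<times> Q. q (fst z) (snd z) * w z (adj \<omega>))
      \<and> (\<Sum>z\<in>P \<times> Q. w z (adj \<omega>) * J (fst z) (snd z) (\<omega> (case_prod dyad z))) < c / 4)) \<le> exp (- (c / (4 * L)))"
  proof (rule lower_tail)
    show "finite (P \<times> Q)" using PQ by (auto intro: finite_subset)
    show "case_prod dyad ` (P \<times> Q) \<subseteq> dyads n" using PQ by auto
    show "q (fst z) (snd z) \<le> (\<Sum>s\<in>UNIV. pr (case_prod dyad z) s * J (fst z) (snd z) s)"
      if "z \<in> P \<times> Q" for z using q that by (cases z) auto
  qed (use assms inj in auto)
  moreover have "(\<Sum>z\<in>P \<times> Q. w z (adj \<omega>) * J (fst z) (snd z) (\<omega> (case_prod dyad z)))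
     = (\<Sum>z\<in>P \<times> Q. w z (adj \<omega>) * a (adj \<omega>) (fst z) (snd z))" for \<omega>
  proof (rule sum.cong[OF refl])
    fix z assume "z \<in> P \<times> Q"
    hence "fst z \<noteq> snd z" using PQ by auto
    thus "w z (adj \<omega>) * J (fst z) (snd z) (\<omega> (case_prod dyad z)) = w z (adj \<omega>) * a (adj \<omega>) (fst z) (snd z)"
      using a by (simp add: case_prod_beta)
  qed
  ultimately show ?thesis unfolding prob_def by simp
qed

lemma block_upper_tail:
  assumes PQ: "P \<subseteq> {..<n}" "Q \<subseteq> {..<n}" "P \<inter> Q = {}" and "0 < L"
    and w: "\<And>x y. x \<in> P \<Longrightarrow> y \<in> Q \<Longrightarrow> 0 \<le> w x y \<and> w x y \<le> L"
    and a: "\<And>x y \<omega>. x \<noteq> y \<Longrightarrow> a (adj \<omega>) x y = J x y (\<omega> (dyad x y))"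
    and J: "\<And>x y s. J x y s = 0 \<or> J x y s = 1"
    and q: "\<And>x y. x \<in> P \<Longrightarrow> y \<in> Q \<Longrightarrow> (\<Sum>s\<in>UNIV. pr (dyad x y) s * J x y s) \<le> q x y"
    and c: "(\<Sum>z\<in>P \<times> Q. q (fst z) (snd z) * w (fst z) (snd z)) \<le> c / 4"
  shows "prob (\<lambda>A. c < (\<Sum>z\<in>P \<times> Q. w (fst z) (snd z) * a A (fst z) (snd z))) \<le> exp (- (c / (2 * L)))"
proof -
  have inj: "inj_on (case_prod dyad) (P \<times> Q)" using PQ by (auto simp: inj_on_def dyad_eq_iff)
  have "mean (dyads n) (\<lambda>_. (False, False)) (\<lambda>\<omega>. of_bool (c <
      (\<Sum>z\<in>P \<times> Q. w (fst z) (snd z) * J (fst z) (snd z) (\<omega> (case_prod dyad z))))) \<le> exp (- (c / (2 * L)))"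
  proof (rule upper_tail)
    show "finite (P \<times> Q)" using PQ by (auto intro: finite_subset)
    show "case_prod dyad ` (P \<times> Q) \<subseteq> dyads n" using PQ by auto
    show "(\<Sum>s\<in>UNIV. pr (case_prod dyad z) s * J (fst z) (snd z) s) \<le> q (fst z) (snd z)"
      if "z \<in> P \<times> Q" for z using q that by (cases z) auto
    show "(\<Sum>z\<in>P \<times> Q. q (fst z) (snd z) * w (fst z) (snd z)) \<le> c / 4" by (rule c)
  qed (use assms inj in auto)
  moreover have "(\<Sum>z\<in>P \<times> Q. w (fst z) (snd z) * J (fst z) (snd z) (\<omega> (case_prod dyad z)))
     = (\<Sum>z\<in>P \<times> Q. w (fst z) (snd z) * a (adj \<omega>) (fst z) (snd z))" for \<omega>
  proof (rule sum.cong[OF refl])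
    fix z assume "z \<in> P \<times> Q"
    hence "fst z \<noteq> snd z" using PQ by auto
    thus "w (fst z) (snd z) * J (fst z) (snd z) (\<omega> (case_prod dyad z))
      = w (fst z) (snd z) * a (adj \<omega>) (fst z) (snd z)"
      using a by (simp add: case_prod_beta)
  qed
  ultimately show ?thesis unfolding prob_def by simp
qed

end

context p1_regime
begin

lemma lower_tail_10:
  assumes "P \<subseteq> {..<n}" "Q \<subseteq> {..<n}" "P \<inter> Q = {}" "0 < L"
    and "\<And>z. z \<in> P \<times> Q \<Longrightarrow> indep_of (case_prod dyad ` (P \<times> Q)) (\<lambda>\<omega>. w z (adj \<omega>))"
  shows "prob (\<lambda>A. (\<forall>z\<in>P \<times> Q. 0 \<le> w z A \<and> w z A \<le> L)
      \<and> c \<le> (\<Sum>z\<in>P \<times> Q. 1 / 2 * (m (fst z) * v (snd z)) * w z A)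
      \<and> (\<Sum>z\<in>P \<times> Q. w z A * A10 A (fst z) (snd z)) < c / 4) \<le> exp (- (c / (4 * L)))"
proof (rule block_lower_tail[where a = A10 and J = "J10" and q = "\<lambda>x y. 1 / 2 * (m x * v y)" and w = w,
      OF assms(1-5) A10_adj J_01(1)])
  fix x y assume xy: "x \<in> P" "y \<in> Q"
  hence "x \<noteq> y" "x < n" "y < n" using assms by auto
  thus "1 / 2 * (m x * v y) \<le> (\<Sum>s\<in>UNIV. pr (dyad x y) s * J10 x y s)"
    unfolding prob_J(1)[OF \<open>x \<noteq> y\<close>] by (intro mult_right_mono K_ge_half mult_nonneg_nonneg nonneg)
qed auto

lemma lower_tail_11:
  assumes "P \<subseteq> {..<n}" "Q \<subseteq> {..<n}" "P \<inter> Q = {}" "0 < L"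
    and "\<And>z. z \<in> P \<times> Q \<Longrightarrow> indep_of (case_prod dyad ` (P \<times> Q)) (\<lambda>\<omega>. w z (adj \<omega>))"
  shows "prob (\<lambda>A. (\<forall>z\<in>P \<times> Q. 0 \<le> w z A \<and> w z A \<le> L)
      \<and> c \<le> (\<Sum>z\<in>P \<times> Q. 1 / 2 * (e * h (fst z) * h (snd z)) * w z A)
      \<and> (\<Sum>z\<in>P \<times> Q. w z A * A11 A (fst z) (snd z)) < c / 4) \<le> exp (- (c / (4 * L)))"
proof (rule block_lower_tail[where a = A11 and J = "\<lambda>_ _. J11" and q = "\<lambda>x y. 1 / 2 * (e * h x * h y)" and w = w,
      OF assms(1-5) A11_adj J_01(2)])
  fix x y assume xy: "x \<in> P" "y \<in> Q"
  hence "x < n" "y < n" using assms by auto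
  thus "1 / 2 * (e * h x * h y) \<le> (\<Sum>s\<in>UNIV. pr (dyad x y) s * J11 s)"
    unfolding prob_J(2) by (intro mult_right_mono K_ge_half mult_nonneg_nonneg nonneg) auto
qed auto

lemma lower_tail_00:
  assumes "P \<subseteq> {..<n}" "Q \<subseteq> {..<n}" "P \<inter> Q = {}" "0 < L"
    and "\<And>z. z \<in> P \<times> Q \<Longrightarrow> indep_of (case_prod dyad ` (P \<times> Q)) (\<lambda>\<omega>. w z (adj \<omega>))"
  shows "prob (\<lambda>A. (\<forall>z\<in>P \<times> Q. 0 \<le> w z A \<and> w z A \<le> L)
      \<and> c \<le> (\<Sum>z\<in>P \<times> Q. 1 / 2 * w z A)
      \<and> (\<Sum>z\<in>P \<times> Q. w z A * A00 A (fst z) (snd z)) < c / 4) \<le> exp (- (c / (4 * L)))"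
proof (rule block_lower_tail[where a = A00 and J = "\<lambda>_ _. J00" and q = "\<lambda>_ _. 1 / 2" and w = w,
      OF assms(1-5) A00_adj J_01(3)])
  fix x y assume xy: "x \<in> P" "y \<in> Q"
  hence "x < n" "y < n" using assms by auto
  thus "1 / 2 \<le> (\<Sum>s\<in>UNIV. pr (dyad x y) s * J00 s)"
    unfolding prob_J(3) by (rule K_ge_half)
qed auto

lemma upper_tail_10:
  assumes "P \<subseteq> {..<n}" "Q \<subseteq> {..<n}" "P \<inter> Q = {}"
    and "\<And>x y. x \<in> P \<Longrightarrow> y \<in> Q \<Longrightarrow> 0 \<le> w x y \<and> w x y \<le> 1"
    and c: "(\<Sum>z\<in>P \<times> Q. m (fst z) * v (snd z) * w (fst z) (snd z)) \<le> c / 4"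
  shows "prob (\<lambda>A. c < (\<Sum>z\<in>P \<times> Q. w (fst z) (snd z) * A10 A (fst z) (snd z))) \<le> exp (- (c / 2))"
proof -
  have "prob (\<lambda>A. c < (\<Sum>z\<in>P \<times> Q. w (fst z) (snd z) * A10 A (fst z) (snd z))) \<le> exp (- (c / (2 * 1)))"
  proof (rule block_upper_tail[where a = A10 and J = J10 and q = "\<lambda>x y. m x * v y" and w = w, OF assms(1-3) _ assms(4) A10_adj J_01(1) _ c])
    fix x y assume xy: "x \<in> P" "y \<in> Q"
    hence "x \<noteq> y" using assms by auto
    thus "(\<Sum>s\<in>UNIV. pr (dyad x y) s * J10 x y s) \<le> m x * v y"
      unfolding prob_J(1)[OF \<open>x \<noteq> y\<close>] by (intro mult_left_le_one_le K_le_1 mult_nonneg_nonneg nonneg)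
  qed auto
  thus ?thesis by simp
qed

lemma upper_tail_11:
  assumes "P \<subseteq> {..<n}" "Q \<subseteq> {..<n}" "P \<inter> Q = {}"
    and c: "(\<Sum>z\<in>P \<times> Q. e * h (fst z) * h (snd z)) \<le> c / 4"
  shows "prob (\<lambda>A. c < (\<Sum>z\<in>P \<times> Q. A11 A (fst z) (snd z))) \<le> exp (- (c / 2))"
proof -
  have "prob (\<lambda>A. c < (\<Sum>z\<in>P \<times> Q. 1 * A11 A (fst z) (snd z))) \<le> exp (- (c / (2 * 1)))"
  proof (rule block_upper_tail[where a = A11 and J = "\<lambda>_ _. J11" and q = "\<lambda>x y. e * h x * h y" and w = "\<lambda>_ _. 1",
        OF assms(1-3) _ _ A11_adj J_01(2)])
    fix x y assume xy: "x \<in> P" "y \<in> Q"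
    show "(\<Sum>s\<in>UNIV. pr (dyad x y) s * J11 s) \<le> e * h x * h y"
      unfolding prob_J(2) by (intro mult_left_le_one_le K_le_1 mult_nonneg_nonneg nonneg) auto
  qed (use c in auto)
  thus ?thesis by simp
qed

text \<open>The factor \<open>m x \<le> 1 / 8\<close> in the edge probabilities brings the mean down
  to c / 8, within the range of the upper tail. Hence \<open>c\<close> only has to dominate the
  weighted sum, and the rate is c / 2 however small the mean degree is.\<close>

lemma out_degree_tail:
  assumes "x < n" "S \<subseteq> {..<n}" "x \<notin> S" "\<And>i. i \<in> S \<Longrightarrow> 0 \<le> w i \<and> w i \<le> 1"
    and c: "(\<Sum>i\<in>S. v i * w i) \<le> c"
  shows "prob (\<lambda>A. c < (\<Sum>i\<in>S. w i * A10 A x i)) \<le> exp (- (c / 2))"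
proof -
  have s0: "0 \<le> (\<Sum>i\<in>S. v i * w i)"
    by (intro sum_nonneg mult_nonneg_nonneg nonneg) (use assms(4) in auto)
  have "(\<Sum>z\<in>{x} \<times> S. m (fst z) * v (snd z) * w (snd z)) = m x * (\<Sum>i\<in>S. v i * w i)"
    unfolding sum_distrib_left by (rule sum.reindex_bij_witness[of _ "\<lambda>i. (x, i)" snd]) auto
  also have "\<dots> \<le> 1 / 8 * c"
    by (intro mult_mono m_le assms(1) c s0) auto
  also have "\<dots> \<le> c / 4" using s0 c by linarith
  finally have "prob (\<lambda>A. c < (\<Sum>z\<in>{x} \<times> S. w (snd z) * A10 A (fst z) (snd z))) \<le> exp (- (c / 2))"
    by (intro upper_tail_10[where w = "\<lambda>_. w"]) (use assms in auto)
  moreover have "(\<Sum>z\<in>{x} \<times> S. w (snd z) * A10 A (fst z) (snd z)) = (\<Sum>i\<in>S. w i * A10 A x i)" for A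
    by (rule sum.reindex_bij_witness[of _ "\<lambda>i. (x, i)" snd]) auto
  ultimately show ?thesis by simp
qed

lemma in_degree_tail:
  assumes "x < n" "S \<subseteq> {..<n}" "x \<notin> S" "\<And>i. i \<in> S \<Longrightarrow> 0 \<le> w i \<and> w i \<le> 1"
    and c: "(\<Sum>i\<in>S. m i * w i) \<le> c"
  shows "prob (\<lambda>A. c < (\<Sum>i\<in>S. w i * A10 A i x)) \<le> exp (- (c / 2))"
proof -
  have s0: "0 \<le> (\<Sum>i\<in>S. m i * w i)"
    by (intro sum_nonneg mult_nonneg_nonneg nonneg) (use assms(4) in auto)
  have "(\<Sum>z\<in>S \<times> {x}. m (fst z) * v (snd z) * w (fst z)) = v x * (\<Sum>i\<in>S. m i * w i)"
    unfolding sum_distrib_left by (rule sum.reindex_bij_witness[of _ "\<lambda>i. (i, x)" fst]) auto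
  also have "\<dots> \<le> 1 / 8 * c"
    by (intro mult_mono v_le assms(1) c s0) auto
  also have "\<dots> \<le> c / 4" using s0 c by linarith
  finally have "prob (\<lambda>A. c < (\<Sum>z\<in>S \<times> {x}. w (fst z) * A10 A (fst z) (snd z))) \<le> exp (- (c / 2))"
    by (intro upper_tail_10[where w = "\<lambda>i _. w i"]) (use assms in auto)
  moreover have "(\<Sum>z\<in>S \<times> {x}. w (fst z) * A10 A (fst z) (snd z)) = (\<Sum>i\<in>S. w i * A10 A i x)" for A
    by (rule sum.reindex_bij_witness[of _ "\<lambda>i. (i, x)" fst]) auto
  ultimately show ?thesis by simp
qed

lemma sum_product_pairs:
  "(\<Sum>z\<in>P \<times> Q. a (fst z) * b (snd z)) = (\<Sum>x\<in>P. a x) * (\<Sum>y\<in>Q. b y)" for a b :: "nat \<Rightarrow> real"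
  by (simp add: sum_product sum.cartesian_product case_prod_beta)

lemma sum_product_pairs_scaled:
  "(\<Sum>z\<in>P \<times> Q. c * (a (fst z) * b (snd z))) = c * ((\<Sum>x\<in>P. a x) * (\<Sum>y\<in>Q. b y))" for a b :: "nat \<Rightarrow> real"
  unfolding sum_distrib_left[symmetric] sum_product_pairs ..

end

context p1_blocks
begin

text \<open>All exponents in the Chernoff bounds below are at least \<open>\<tau> / 2 ^ 30\<close>.\<close>

definition \<tau> where "\<tau> = min H R"

definition q0 where "q0 = exp (- (\<tau> / 2 ^ 30))"

lemma exp_le_q0: "\<tau> \<le> 2 ^ 30 * u \<Longrightarrow> exp (- u) \<le> q0"
  by (simp add: q0_def)

text \<open>The quantities listed are those to which the Chernoff rates are proportional; they
  dominate \<open>\<tau>\<close> because \<open>H\<close> is at least 1 and at most each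
  \<open>F t\<close>.\<close>

lemma \<tau>_le: "\<tau> \<le> H" "\<tau> \<le> R" "\<tau> \<le> F t" "\<tau> \<le> M" "\<tau> \<le> H\<^sup>2" "\<tau> \<le> F t * H"
proof -
  show 1: "\<tau> \<le> H" "\<tau> \<le> R" by (auto simp: \<tau>_def)
  have F: "H \<le> F t" "1 \<le> F t" for t using H_le_F[of t] F_ge_1[of t] one_le_H by linarith+
  show "\<tau> \<le> F t" using F[of t] 1 by linarith
  have "H * 1 \<le> F False * F True" by (intro mult_mono F) (auto simp: sums_nonneg)
  thus "\<tau> \<le> M" using 1 by (simp add: M_def)
  show "\<tau> \<le> H\<^sup>2" using self_le_power[OF one_le_H, of 2] 1 by simp
  have "1 * H \<le> F t * H" by (intro mult_right_mono F) (auto simp: sums_nonneg)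
  thus "\<tau> \<le> F t * H" using 1 by simp
qed

lemma pos_consts: "0 < H" "0 < R" "0 < F t" "0 < M"
proof -
  have F: "1 \<le> F t" for t by (rule F_ge_1)
  show "0 < H" using one_le_H by linarith
  show "0 < R" using R_ge by (simp add: R_def)
  show "0 < F t" using F[of t] by linarith
  show "0 < M" unfolding M_def using F[of False] F[of True] by (intro mult_pos_pos) linarith+
qed

lemma dyad_notin_block:
  "\<lbrakk>x \<notin> P \<and> x \<notin> Q \<or> y \<notin> P \<and> y \<notin> Q\<rbrakk> \<Longrightarrow> dyad x y \<notin> case_prod dyad ` (P \<times> Q)"
  by (auto simp: dyad_eq_iff)

lemma block_lt: "x \<in> V1 \<Longrightarrow> x < n" "x \<in> V2 \<Longrightarrow> x < n" "x \<in> V3 \<Longrightarrow> x < n" "x \<in> V4 \<Longrightarrow> x < n"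
  using sub by auto

lemma m_unit: "i < n \<Longrightarrow> 0 \<le> m i \<and> m i \<le> 1" and v_unit: "i < n \<Longrightarrow> 0 \<le> v i \<and> v i \<le> 1"
  using m_le[of i] v_le[of i] nonneg[of i] by auto

lemma sums_le:
  assumes "S \<subseteq> {..<n}"
  shows "(\<Sum>i\<in>S. h i) \<le> H" "(\<Sum>i\<in>S. m i) \<le> F False" "(\<Sum>i\<in>S. v i) \<le> F True"
  using sum_subset_le[OF assms, of h] sum_subset_le[OF assms, of m] sum_subset_le[OF assms, of v]
  by (auto simp: H_def F_def f_def nonneg)

text \<open>The edge in slot ij of the b-pattern is exposed last. Its probability is about
  \<open>m i * v j\<close>, and these factors are passed on to the edges at \<open>i\<close> and at
  \<open>j\<close>; hence the weights in \<open>wl\<close> and \<open>wk\<close>. \<open>wij\<close>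
  counts the completions of the pair (i, j).\<close>

definition wl :: "adjm \<Rightarrow> nat \<Rightarrow> real" where "wl A l = (\<Sum>i\<in>V1. m i * A10 A l i)"
definition wk :: "adjm \<Rightarrow> nat \<Rightarrow> real" where "wk A k = (\<Sum>j\<in>V2. v j * A10 A j k)"
definition wij :: "adjm \<Rightarrow> nat \<Rightarrow> nat \<Rightarrow> real" where
  "wij A i j = (\<Sum>z\<in>V3 \<times> V4. A10 A (snd z) i * A10 A j (fst z) * A00 A (fst z) (snd z))"

lemma sum_swap4:
  "(\<Sum>(i, j, k, l)\<in>P \<times> P' \<times> Q \<times> Q'. g i j k l) = (\<Sum>z\<in>P \<times> P'. \<Sum>u\<in>Q \<times> Q'. g (fst z) (snd z) (fst u) (snd u))"
  for g :: "nat \<Rightarrow> nat \<Rightarrow> nat \<Rightarrow> nat \<Rightarrow> real"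
  unfolding sum.cartesian_product
  by (rule sum.reindex_bij_witness[of _ "\<lambda>((i, j), (k, l)). (i, j, k, l)" "\<lambda>(i, j, k, l). ((i, j), (k, l))"]) auto

lemma Qb_ge: "(\<Sum>z\<in>V1 \<times> V2. wij A (fst z) (snd z) * A10 A (fst z) (snd z)) \<le> Qb n A"
proof -
  have "(\<Sum>z\<in>V1 \<times> V2. wij A (fst z) (snd z) * A10 A (fst z) (snd z))
    = (\<Sum>(i, j, k, l)\<in>V1 \<times> V2 \<times> V3 \<times> V4. Tb A i j k l)"
    unfolding sum_swap4 by (simp add: wij_def Tb_def sum_distrib_left sum_distrib_right mult_ac)
  also have "\<dots> \<le> Qb n A"
    unfolding Qb_eq by (rule sum_mono2) (auto simp: blocks_quads Tb_def A_range)
  finally show ?thesis .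
qed

text \<open>Up to normalisers the left side is the conditional mean of the number of block
  b-patterns given all dyads outside \<open>V1 \<times> V2\<close>. For fixed \<open>k\<close> and
  \<open>l\<close> the sum factorises into a sum over \<open>i\<close> and one over
  \<open>j\<close>.\<close>

lemma wij_sum: "(\<Sum>z\<in>V1 \<times> V2. m (fst z) * v (snd z) * wij A (fst z) (snd z))
   = (\<Sum>z\<in>V3 \<times> V4. wk A (fst z) * wl A (snd z) * A00 A (fst z) (snd z))"
proof -
  have "(\<Sum>z\<in>V1 \<times> V2. m (fst z) * v (snd z) * wij A (fst z) (snd z))
    = (\<Sum>z\<in>V1 \<times> V2. \<Sum>u\<in>V3 \<times> V4. m (fst z) * v (snd z) * (A10 A (snd u) (fst z) * A10 A (snd z) (fst u) * A00 A (fst u) (snd u)))"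
    by (simp add: wij_def sum_distrib_left)
  also have "\<dots> = (\<Sum>u\<in>V3 \<times> V4. \<Sum>z\<in>V1 \<times> V2. m (fst z) * v (snd z) * (A10 A (snd u) (fst z) * A10 A (snd z) (fst u) * A00 A (fst u) (snd u)))"
    by (rule sum.swap)
  also have "\<dots> = (\<Sum>z\<in>V3 \<times> V4. wk A (fst z) * wl A (snd z) * A00 A (fst z) (snd z))"
  proof (rule sum.cong[OF refl])
    fix u
    have "(\<Sum>z\<in>V1 \<times> V2. m (fst z) * v (snd z) * (A10 A (snd u) (fst z) * A10 A (snd z) (fst u) * A00 A (fst u) (snd u)))
      = (\<Sum>z\<in>V1 \<times> V2. (m (fst z) * A10 A (snd u) (fst z)) * (v (snd z) * A10 A (snd z) (fst u))) * A00 A (fst u) (snd u)"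
      unfolding sum_distrib_right by (intro sum.cong refl) (simp only: mult_ac)
    also have "\<dots> = wl A (snd u) * wk A (fst u) * A00 A (fst u) (snd u)"
      unfolding sum_product_pairs[of "\<lambda>i. m i * A10 A (snd u) i" "\<lambda>j. v j * A10 A j (fst u)"] wl_def wk_def ..
    finally show "(\<Sum>z\<in>V1 \<times> V2. m (fst z) * v (snd z) * (A10 A (snd u) (fst z) * A10 A (snd z) (fst u) * A00 A (fst u) (snd u)))
      = wk A (fst u) * wl A (snd u) * A00 A (fst u) (snd u)" by (simp only: mult_ac)
  qed
  finally show ?thesis .
qed

text \<open>The mean is at least half of F False / 16 times H / 16, which gives 2 ^ 9; the lower
  tail gives up another factor 4.\<close>

lemma wl_total_tail: "prob (\<lambda>A. (\<Sum>l\<in>V4. wl A l) < F False * H / 2 ^ 11) \<le> q0"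
proof -
  let ?c = "F False * H / 2 ^ 9"
  have "prob (\<lambda>A. (\<Sum>l\<in>V4. wl A l) < F False * H / 2 ^ 11)
    \<le> prob (\<lambda>A. (\<forall>z\<in>V4 \<times> V1. 0 \<le> m (snd z) \<and> m (snd z) \<le> 1)
      \<and> ?c \<le> (\<Sum>z\<in>V4 \<times> V1. 1 / 2 * (m (fst z) * v (snd z)) * m (snd z))
      \<and> (\<Sum>z\<in>V4 \<times> V1. m (snd z) * A10 A (fst z) (snd z)) < ?c / 4)"
  proof (rule prob_mono, intro conjI)
    have "F False / 16 * (H / 16) \<le> (\<Sum>l\<in>V4. m l) * (\<Sum>i\<in>V1. h i)"
      using pos_consts by (intro mult_mono weights sum_nonneg nonneg) (auto intro: less_imp_le)
    also have "\<dots> = (\<Sum>z\<in>V4 \<times> V1. m (fst z) * (m (snd z) * v (snd z)))"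
      by (simp only: sum_product_pairs[of m "\<lambda>x. m x * v x"] eta_def)
    also have "\<dots> = 2 * (\<Sum>z\<in>V4 \<times> V1. 1 / 2 * (m (fst z) * v (snd z)) * m (snd z))"
      by (simp add: sum_distrib_left mult_ac)
    finally show "?c \<le> (\<Sum>z\<in>V4 \<times> V1. 1 / 2 * (m (fst z) * v (snd z)) * m (snd z))" by simp
    fix A assume "(\<Sum>l\<in>V4. wl A l) < F False * H / 2 ^ 11"
    thus "(\<Sum>z\<in>V4 \<times> V1. m (snd z) * A10 A (fst z) (snd z)) < ?c / 4"
      by (simp add: wl_def sum.cartesian_product case_prod_beta)
  qed (use block_lt m_unit in auto)
  also have "\<dots> \<le> exp (- (?c / (4 * 1)))"
    using sub disj by (intro lower_tail_10) auto
  also have "\<dots> \<le> q0" using \<tau>_le(6)[of False] mult_pos_pos[OF pos_consts(3)[of False] pos_consts(1)]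
    by (intro exp_le_q0) (simp add: mult.commute)
  finally show ?thesis .
qed

lemma wk_total_tail: "prob (\<lambda>A. (\<Sum>k\<in>V3. wk A k) < F True * H / 2 ^ 11) \<le> q0"
proof -
  let ?c = "F True * H / 2 ^ 9"
  have "prob (\<lambda>A. (\<Sum>k\<in>V3. wk A k) < F True * H / 2 ^ 11)
    \<le> prob (\<lambda>A. (\<forall>z\<in>V2 \<times> V3. 0 \<le> v (fst z) \<and> v (fst z) \<le> 1)
      \<and> ?c \<le> (\<Sum>z\<in>V2 \<times> V3. 1 / 2 * (m (fst z) * v (snd z)) * v (fst z))
      \<and> (\<Sum>z\<in>V2 \<times> V3. v (fst z) * A10 A (fst z) (snd z)) < ?c / 4)"
  proof (rule prob_mono, intro conjI)
    have "H / 16 * (F True / 16) \<le> (\<Sum>i\<in>V2. h i) * (\<Sum>l\<in>V3. v l)"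
      using pos_consts by (intro mult_mono weights sum_nonneg nonneg) (auto intro: less_imp_le)
    also have "\<dots> = (\<Sum>z\<in>V2 \<times> V3. (m (fst z) * v (fst z)) * v (snd z))"
      by (simp only: sum_product_pairs[of "\<lambda>x. m x * v x" v] eta_def)
    also have "\<dots> = 2 * (\<Sum>z\<in>V2 \<times> V3. 1 / 2 * (m (fst z) * v (snd z)) * v (fst z))"
      by (simp add: sum_distrib_left mult_ac)
    finally show "?c \<le> (\<Sum>z\<in>V2 \<times> V3. 1 / 2 * (m (fst z) * v (snd z)) * v (fst z))"
      by (simp add: mult.commute)
    fix A assume "(\<Sum>k\<in>V3. wk A k) < F True * H / 2 ^ 11"
    moreover have "(\<Sum>k\<in>V3. wk A k) = (\<Sum>z\<in>V2 \<times> V3. v (fst z) * A10 A (fst z) (snd z))"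
      unfolding wk_def by (subst sum.swap) (simp add: sum.cartesian_product case_prod_beta)
    ultimately show "(\<Sum>z\<in>V2 \<times> V3. v (fst z) * A10 A (fst z) (snd z)) < ?c / 4"
      by simp
  qed (use block_lt v_unit in auto)
  also have "\<dots> \<le> exp (- (?c / (4 * 1)))"
    using sub disj by (intro lower_tail_10) auto
  also have "\<dots> \<le> q0" using \<tau>_le(6)[of True] mult_pos_pos[OF pos_consts(3)[of True] pos_consts(1)]
    by (intro exp_le_q0) (simp add: mult.commute)
  finally show ?thesis .
qed

lemma q0_pos: "0 \<le> q0"
  by (simp add: q0_def)

text \<open>These provide the caps on the weights of the blocks exposed later, where the rate of a
  lower tail is inversely proportional to the cap.\<close>

lemma degree_tails:
  "l \<in> V4 \<Longrightarrow> prob (\<lambda>A. H < wl A l) \<le> q0"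
  "k \<in> V3 \<Longrightarrow> prob (\<lambda>A. H < wk A k) \<le> q0"
  "x < n \<Longrightarrow> S \<subseteq> {..<n} \<Longrightarrow> x \<notin> S \<Longrightarrow> prob (\<lambda>A. F True < (\<Sum>i\<in>S. A10 A x i)) \<le> q0"
  "x < n \<Longrightarrow> S \<subseteq> {..<n} \<Longrightarrow> x \<notin> S \<Longrightarrow> prob (\<lambda>A. F False < (\<Sum>i\<in>S. A10 A i x)) \<le> q0"
proof -
  have q: "exp (- (H / 2)) \<le> q0" "exp (- (F t / 2)) \<le> q0" for t
    using \<tau>_le(1) \<tau>_le(3)[of t] pos_consts(1) pos_consts(3)[of t] by (auto intro!: exp_le_q0)
  show "prob (\<lambda>A. H < wl A l) \<le> q0" if "l \<in> V4"
  proof (rule order_trans[OF _ q(1)], unfold wl_def, rule out_degree_tail)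
    show "(\<Sum>i\<in>V1. v i * m i) \<le> H" using sums_le(1)[OF sub(1)] by (simp add: eta_def mult.commute)
  qed (use that sub disj m_unit in auto)
  show "prob (\<lambda>A. H < wk A k) \<le> q0" if "k \<in> V3"
  proof (rule order_trans[OF _ q(1)], unfold wk_def, rule in_degree_tail)
    show "(\<Sum>i\<in>V2. m i * v i) \<le> H" using sums_le(1)[OF sub(2)] by (simp add: eta_def)
  qed (use that sub disj v_unit in auto)
  show "prob (\<lambda>A. F True < (\<Sum>i\<in>S. A10 A x i)) \<le> q0" if "x < n" "S \<subseteq> {..<n}" "x \<notin> S"
    using out_degree_tail[of x S "\<lambda>_. 1" "F True"] that sums_le(3)[OF that(2)] q(2)[of True] by simp
  show "prob (\<lambda>A. F False < (\<Sum>i\<in>S. A10 A i x)) \<le> q0" if "x < n" "S \<subseteq> {..<n}" "x \<notin> S"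
    using in_degree_tail[of x S "\<lambda>_. 1" "F False"] that sums_le(2)[OF that(2)] q(2)[of False] by simp
qed

lemma w_nonneg: "0 \<le> wl A l" "0 \<le> wk A k" "0 \<le> wij A i j"
  by (auto simp: wl_def wk_def wij_def intro!: sum_nonneg mult_nonneg_nonneg nonneg A_range)

lemma indep_w:
  assumes "l \<in> V4" "k \<in> V3"
  shows "indep_of (case_prod dyad ` (V3 \<times> V4)) (\<lambda>\<omega>. wk (adj \<omega>) k * wl (adj \<omega>) l)"
  unfolding wk_def wl_def
  by (intro indep_intros indep_adj dyad_notin_block) (use assms disj in blast)+

lemma indep_wij:
  assumes "i \<in> V1" "j \<in> V2"
  shows "indep_of (case_prod dyad ` (V1 \<times> V2)) (\<lambda>\<omega>. wij (adj \<omega>) i j)"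
  unfolding wij_def
  by (intro indep_intros indep_adj dyad_notin_block; unfold mem_Times_iff) (use assms disj in blast)+

lemma wij_le: "wij A i j \<le> (\<Sum>l\<in>V4. A10 A l i) * (\<Sum>k\<in>V3. A10 A j k)"
proof -
  have "wij A i j \<le> (\<Sum>z\<in>V3 \<times> V4. A10 A j (fst z) * A10 A (snd z) i)"
    unfolding wij_def
  proof (rule sum_mono)
    fix z
    have "A10 A (snd z) i * A10 A j (fst z) * A00 A (fst z) (snd z) \<le> A10 A (snd z) i * A10 A j (fst z) * 1"
      by (intro mult_left_mono A_range mult_nonneg_nonneg)
    thus "A10 A (snd z) i * A10 A j (fst z) * A00 A (fst z) (snd z) \<le> A10 A j (fst z) * A10 A (snd z) i"
      by (simp add: mult.commute)
  qed
  thus ?thesis by (simp only: sum_product_pairs[of "\<lambda>k. A10 A j k" "\<lambda>l. A10 A l i"] mult.commute)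
qed

text \<open>The blocks \<open>V4 \<times> V1\<close> and \<open>V2 \<times> V3\<close> are exposed first, then \<open>V3 \<times> V4\<close>, and \<open>V1 \<times> V2\<close> last.\<close>

lemma Qb_tail: "prob (\<lambda>A. Qb n A < H\<^sup>2 * M / 2 ^ 28) \<le> (4 * n + 4) * q0"
proof -
  \<comment> \<open>Half the product of the two bounds with 2 ^ 11 gives 2 ^ 23. The lower tail in
    block \<open>V3 \<times> V4\<close> costs 4 and the normaliser of the last block 2, giving 2 ^
    26; the last tail leads to 2 ^ 28.\<close>
  let ?c7 = "H\<^sup>2 * M / 2 ^ 23" and ?c8 = "H\<^sup>2 * M / 2 ^ 26"
  define N7 where "N7 A \<longleftrightarrow> (\<forall>z\<in>V3 \<times> V4. 0 \<le> wk A (fst z) * wl A (snd z) \<and> wk A (fst z) * wl A (snd z) \<le> H * H)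
      \<and> ?c7 \<le> (\<Sum>z\<in>V3 \<times> V4. 1 / 2 * (wk A (fst z) * wl A (snd z)))
      \<and> (\<Sum>z\<in>V3 \<times> V4. (wk A (fst z) * wl A (snd z)) * A00 A (fst z) (snd z)) < ?c7 / 4" for A
  define N8 where "N8 A \<longleftrightarrow> (\<forall>z\<in>V1 \<times> V2. 0 \<le> wij A (fst z) (snd z) \<and> wij A (fst z) (snd z) \<le> M)
      \<and> ?c8 \<le> (\<Sum>z\<in>V1 \<times> V2. 1 / 2 * (m (fst z) * v (snd z)) * wij A (fst z) (snd z))
      \<and> (\<Sum>z\<in>V1 \<times> V2. wij A (fst z) (snd z) * A10 A (fst z) (snd z)) < ?c8 / 4" for A
  have N7: "prob N7 \<le> q0"
  proof -
    have "prob N7 \<le> exp (- (?c7 / (4 * (H * H))))"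
      unfolding N7_def
      using sub disj indep_w pos_consts by (intro lower_tail_00) auto
    also have "\<dots> \<le> q0"
      using \<tau>_le(4) pos_consts(1,4) by (intro exp_le_q0) (simp add: power2_eq_square)
    finally show ?thesis .
  qed
  have N8: "prob N8 \<le> q0"
  proof -
    have "prob N8 \<le> exp (- (?c8 / (4 * M)))"
      unfolding N8_def
      using sub disj indep_wij pos_consts by (intro lower_tail_10) auto
    also have "\<dots> \<le> q0"
    proof (rule exp_le_q0)
      have "\<tau> \<le> 4 * H\<^sup>2" using \<tau>_le(5) zero_le_power2[of H] by linarith
      thus "\<tau> \<le> 2 ^ 30 * (?c8 / (4 * M))" using pos_consts(4) by simp
    qed
    finally show ?thesis .
  qed
  have ex: "prob (\<lambda>A. \<exists>l\<in>V4. H < wl A l) \<le> n * q0" "prob (\<lambda>A. \<exists>k\<in>V3. H < wk A k) \<le> n * q0"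
    "prob (\<lambda>A. \<exists>i\<in>V1. F False < (\<Sum>l\<in>V4. A10 A l i)) \<le> n * q0"
    "prob (\<lambda>A. \<exists>j\<in>V2. F True < (\<Sum>k\<in>V3. A10 A j k)) \<le> n * q0"
    using sub disj by (auto intro!: prob_ex_le degree_tails q0_pos)
  have "prob (\<lambda>A. Qb n A < H\<^sup>2 * M / 2 ^ 28) \<le> prob (\<lambda>A. (\<Sum>l\<in>V4. wl A l) < F False * H / 2 ^ 11 \<or>
      (\<Sum>k\<in>V3. wk A k) < F True * H / 2 ^ 11 \<or> N7 A \<or> N8 A \<or>
      (\<exists>l\<in>V4. H < wl A l) \<or> (\<exists>k\<in>V3. H < wk A k) \<or>
      (\<exists>i\<in>V1. F False < (\<Sum>l\<in>V4. A10 A l i)) \<or> (\<exists>j\<in>V2. F True < (\<Sum>k\<in>V3. A10 A j k)))"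
  proof (rule prob_mono, rule ccontr)
    fix A assume Q: "Qb n A < H\<^sup>2 * M / 2 ^ 28" and "\<not> ((\<Sum>l\<in>V4. wl A l) < F False * H / 2 ^ 11 \<or>
      (\<Sum>k\<in>V3. wk A k) < F True * H / 2 ^ 11 \<or> N7 A \<or> N8 A \<or>
      (\<exists>l\<in>V4. H < wl A l) \<or> (\<exists>k\<in>V3. H < wk A k) \<or>
      (\<exists>i\<in>V1. F False < (\<Sum>l\<in>V4. A10 A l i)) \<or> (\<exists>j\<in>V2. F True < (\<Sum>k\<in>V3. A10 A j k)))"
    hence t: "F False * H / 2 ^ 11 \<le> (\<Sum>l\<in>V4. wl A l)" "F True * H / 2 ^ 11 \<le> (\<Sum>k\<in>V3. wk A k)"
      "\<not> N7 A" "\<not> N8 A" "\<And>l. l \<in> V4 \<Longrightarrow> wl A l \<le> H" "\<And>k. k \<in> V3 \<Longrightarrow> wk A k \<le> H"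
      "\<And>i. i \<in> V1 \<Longrightarrow> (\<Sum>l\<in>V4. A10 A l i) \<le> F False" "\<And>j. j \<in> V2 \<Longrightarrow> (\<Sum>k\<in>V3. A10 A j k) \<le> F True"
      by (auto simp: not_less)
    have "F True * H / 2 ^ 11 * (F False * H / 2 ^ 11) \<le> (\<Sum>k\<in>V3. wk A k) * (\<Sum>l\<in>V4. wl A l)"
      using pos_consts(1) pos_consts(3)[of True] pos_consts(3)[of False]
      by (intro mult_mono t sum_nonneg w_nonneg) auto
    hence "?c7 \<le> (\<Sum>z\<in>V3 \<times> V4. 1 / 2 * (wk A (fst z) * wl A (snd z)))"
      unfolding sum_distrib_left[symmetric] sum_product_pairs
      by (simp add: M_def power2_eq_square mult_ac)
    moreover have "0 \<le> wk A k * wl A l" "wk A k * wl A l \<le> H * H" if "k \<in> V3" "l \<in> V4" for k l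
      using t(5)[OF that(2)] t(6)[OF that(1)] w_nonneg pos_consts(1) by (auto intro!: mult_mono)
    ultimately have Z: "?c7 / 4 \<le> (\<Sum>z\<in>V3 \<times> V4. wk A (fst z) * wl A (snd z) * A00 A (fst z) (snd z))"
      using t(3) unfolding N7_def by (auto simp: not_less)
    have "(\<Sum>z\<in>V1 \<times> V2. 1 / 2 * (m (fst z) * v (snd z)) * wij A (fst z) (snd z))
      = 1 / 2 * (\<Sum>z\<in>V3 \<times> V4. wk A (fst z) * wl A (snd z) * A00 A (fst z) (snd z))"
      unfolding wij_sum[symmetric] by (simp add: sum_distrib_left mult.assoc)
    hence "?c8 \<le> (\<Sum>z\<in>V1 \<times> V2. 1 / 2 * (m (fst z) * v (snd z)) * wij A (fst z) (snd z))"
      using Z by simp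
    moreover have "wij A i j \<le> M" if "i \<in> V1" "j \<in> V2" for i j
    proof -
      have "wij A i j \<le> F False * F True"
        by (rule order_trans[OF wij_le], intro mult_mono t that sum_nonneg A_range)
           (auto simp: sums_nonneg)
      thus ?thesis by (simp add: M_def)
    qed
    ultimately have "?c8 / 4 \<le> (\<Sum>z\<in>V1 \<times> V2. wij A (fst z) (snd z) * A10 A (fst z) (snd z))"
      using t(4) w_nonneg(3)[of A] unfolding N8_def by (auto simp: not_less)
    thus False using Qb_ge[of A] Q by simp
  qed
  \<comment> \<open>Four block events and four families of at most n degree events.\<close>
  also have "\<dots> \<le> q0 + (q0 + (q0 + (q0 + (n * q0 + (n * q0 + (n * q0 + n * q0))))))"
    by (intro prob_or_le wl_total_tail wk_total_tail N7 N8 ex)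
  also have "\<dots> = (4 * n + 4) * q0" by (simp add: algebra_simps)
  finally show ?thesis .
qed

text \<open>For the a-pattern the null slot jk is exposed last. Its probability is at least 1/2, so
  here plain degrees and counts suffice: \<open>wjk\<close> counts the completions of the pair (j,
  k).\<close>

definition wi :: "adjm \<Rightarrow> nat \<Rightarrow> real" where "wi A i = (\<Sum>j\<in>V2. A11 A i j)"
definition wo :: "adjm \<Rightarrow> nat \<Rightarrow> real" where "wo A l = (\<Sum>k\<in>V3. A10 A l k)"
definition wjk :: "adjm \<Rightarrow> nat \<Rightarrow> nat \<Rightarrow> real" where
  "wjk A j k = (\<Sum>z\<in>V4 \<times> V1. A11 A (snd z) j * A10 A (fst z) k * A00 A (fst z) (snd z))"

lemma Qa_ge: "(\<Sum>z\<in>V2 \<times> V3. wjk A (fst z) (snd z) * A00 A (fst z) (snd z)) \<le> Qa n A"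
proof -
  have "(\<Sum>z\<in>V2 \<times> V3. wjk A (fst z) (snd z) * A00 A (fst z) (snd z))
    = (\<Sum>z\<in>V2 \<times> V3. \<Sum>u\<in>V4 \<times> V1. Ta A (snd u) (fst z) (snd z) (fst u))"
    by (simp add: wjk_def Ta_def sum_distrib_left sum_distrib_right mult_ac)
  also have "\<dots> = (\<Sum>(i, j, k, l)\<in>V1 \<times> V2 \<times> V3 \<times> V4. Ta A i j k l)"
    unfolding sum.cartesian_product
    by (rule sum.reindex_bij_witness[of _ "\<lambda>(i, j, k, l). ((j, k), (l, i))" "\<lambda>((j, k), (l, i)). (i, j, k, l)"]) auto
  also have "\<dots> \<le> Qa n A"
    unfolding Qa_eq by (rule sum_mono2) (auto simp: blocks_quads Ta_def A_range)
  finally show ?thesis .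
qed

lemma wjk_sum: "(\<Sum>z\<in>V2 \<times> V3. wjk A (fst z) (snd z))
   = (\<Sum>z\<in>V4 \<times> V1. wo A (fst z) * wi A (snd z) * A00 A (fst z) (snd z))"
proof -
  have "(\<Sum>z\<in>V2 \<times> V3. wjk A (fst z) (snd z))
    = (\<Sum>u\<in>V4 \<times> V1. \<Sum>z\<in>V2 \<times> V3. A11 A (snd u) (fst z) * A10 A (fst u) (snd z) * A00 A (fst u) (snd u))"
    unfolding wjk_def by (rule sum.swap)
  also have "\<dots> = (\<Sum>z\<in>V4 \<times> V1. wo A (fst z) * wi A (snd z) * A00 A (fst z) (snd z))"
  proof (rule sum.cong[OF refl])
    fix u
    have "(\<Sum>z\<in>V2 \<times> V3. A11 A (snd u) (fst z) * A10 A (fst u) (snd z) * A00 A (fst u) (snd u))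
      = wi A (snd u) * wo A (fst u) * A00 A (fst u) (snd u)"
      unfolding sum_distrib_right[symmetric] wi_def wo_def
        sum_product_pairs[of "\<lambda>j. A11 A (snd u) j" "\<lambda>k. A10 A (fst u) k"] ..
    thus "(\<Sum>z\<in>V2 \<times> V3. A11 A (snd u) (fst z) * A10 A (fst u) (snd z) * A00 A (fst u) (snd u))
      = wo A (fst u) * wi A (snd u) * A00 A (fst u) (snd u)" by (simp only: mult_ac)
  qed
  finally show ?thesis .
qed

lemma count11_lower: "prob (\<lambda>A. (\<Sum>i\<in>V1. wi A i) < R / 2 ^ 11) \<le> q0"
proof -
  let ?c = "R / 2 ^ 9"
  have "prob (\<lambda>A. (\<Sum>i\<in>V1. wi A i) < R / 2 ^ 11)
    \<le> prob (\<lambda>A. (\<forall>z\<in>V1 \<times> V2. 0 \<le> (1::real) \<and> (1::real) \<le> 1)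
      \<and> ?c \<le> (\<Sum>z\<in>V1 \<times> V2. 1 / 2 * (e * h (fst z) * h (snd z)) * 1)
      \<and> (\<Sum>z\<in>V1 \<times> V2. 1 * A11 A (fst z) (snd z)) < ?c / 4)"
  proof (rule prob_mono, intro conjI)
    have "e / 2 * (H / 16 * (H / 16)) \<le> e / 2 * ((\<Sum>i\<in>V1. h i) * (\<Sum>i\<in>V2. h i))"
      using pos_consts(1) by (intro mult_left_mono mult_mono weights sum_nonneg nonneg) auto
    also have "\<dots> = (\<Sum>z\<in>V1 \<times> V2. 1 / 2 * (e * h (fst z) * h (snd z)) * 1)"
      unfolding sum_product_pairs_scaled[symmetric] by (intro sum.cong refl) simp
    finally show "?c \<le> (\<Sum>z\<in>V1 \<times> V2. 1 / 2 * (e * h (fst z) * h (snd z)) * 1)"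
      by (simp add: R_def power2_eq_square)
    fix A assume "(\<Sum>i\<in>V1. wi A i) < R / 2 ^ 11"
    thus "(\<Sum>z\<in>V1 \<times> V2. 1 * A11 A (fst z) (snd z)) < ?c / 4"
      by (simp add: wi_def sum.cartesian_product case_prod_beta)
  qed auto
  also have "\<dots> \<le> exp (- (?c / (4 * 1)))"
    using sub disj by (intro lower_tail_11) auto
  also have "\<dots> \<le> q0" using \<tau>_le(2) pos_consts(2) by (intro exp_le_q0) simp
  finally show ?thesis .
qed

lemma count11_upper: "prob (\<lambda>A. 4 * R < (\<Sum>i\<in>V1. wi A i)) \<le> q0"
proof -
  have "prob (\<lambda>A. 4 * R < (\<Sum>z\<in>V1 \<times> V2. A11 A (fst z) (snd z))) \<le> exp (- (4 * R / 2))"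
  proof (rule upper_tail_11)
    have "(\<Sum>z\<in>V1 \<times> V2. e * h (fst z) * h (snd z)) = e * ((\<Sum>i\<in>V1. h i) * (\<Sum>i\<in>V2. h i))"
      unfolding sum_product_pairs_scaled[symmetric] by (intro sum.cong refl) simp
    also have "\<dots> \<le> e * (H * H)"
      using pos_consts(1) by (intro mult_left_mono mult_mono sums_le sub sum_nonneg nonneg) auto
    finally show "(\<Sum>z\<in>V1 \<times> V2. e * h (fst z) * h (snd z)) \<le> 4 * R / 4" by (simp add: R_def power2_eq_square)
  qed (use sub disj in auto)
  also have "\<dots> \<le> q0" using \<tau>_le(2) pos_consts(2) by (intro exp_le_q0) simp
  finally show ?thesis by (simp add: wi_def sum.cartesian_product case_prod_beta)
qed

lemma count10_lower: "prob (\<lambda>A. (\<Sum>l\<in>V4. wo A l) < M / 2 ^ 11) \<le> q0"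
proof -
  let ?c = "M / 2 ^ 9"
  have "prob (\<lambda>A. (\<Sum>l\<in>V4. wo A l) < M / 2 ^ 11)
    \<le> prob (\<lambda>A. (\<forall>z\<in>V4 \<times> V3. 0 \<le> (1::real) \<and> (1::real) \<le> 1)
      \<and> ?c \<le> (\<Sum>z\<in>V4 \<times> V3. 1 / 2 * (m (fst z) * v (snd z)) * 1)
      \<and> (\<Sum>z\<in>V4 \<times> V3. 1 * A10 A (fst z) (snd z)) < ?c / 4)"
  proof (rule prob_mono, intro conjI)
    have "1 / 2 * (F False / 16 * (F True / 16)) \<le> 1 / 2 * ((\<Sum>i\<in>V4. m i) * (\<Sum>i\<in>V3. v i))"
      using pos_consts(3) by (intro mult_left_mono mult_mono weights sum_nonneg nonneg) (auto intro: less_imp_le)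
    also have "\<dots> = (\<Sum>z\<in>V4 \<times> V3. 1 / 2 * (m (fst z) * v (snd z)) * 1)"
      unfolding sum_product_pairs_scaled[symmetric] by (intro sum.cong refl) simp
    finally show "?c \<le> (\<Sum>z\<in>V4 \<times> V3. 1 / 2 * (m (fst z) * v (snd z)) * 1)"
      by (simp add: M_def)
    fix A assume "(\<Sum>l\<in>V4. wo A l) < M / 2 ^ 11"
    thus "(\<Sum>z\<in>V4 \<times> V3. 1 * A10 A (fst z) (snd z)) < ?c / 4"
      by (simp add: wo_def sum.cartesian_product case_prod_beta)
  qed auto
  also have "\<dots> \<le> exp (- (?c / (4 * 1)))"
    using sub disj by (intro lower_tail_10) auto
  also have "\<dots> \<le> q0" using \<tau>_le(4) pos_consts(4) by (intro exp_le_q0) simp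
  finally show ?thesis .
qed

lemma wa_nonneg: "0 \<le> wi A i" "0 \<le> wo A l" "0 \<le> wjk A j k"
  by (auto simp: wi_def wo_def wjk_def intro!: sum_nonneg mult_nonneg_nonneg A_range)

lemma indep_wa:
  assumes "l \<in> V4" "i \<in> V1"
  shows "indep_of (case_prod dyad ` (V4 \<times> V1)) (\<lambda>\<omega>. wo (adj \<omega>) l * wi (adj \<omega>) i)"
  unfolding wo_def wi_def
  by (intro indep_intros indep_adj dyad_notin_block) (use assms disj in blast)+

lemma indep_wjk:
  assumes "j \<in> V2" "k \<in> V3"
  shows "indep_of (case_prod dyad ` (V2 \<times> V3)) (\<lambda>\<omega>. wjk (adj \<omega>) j k)"
  unfolding wjk_def
  by (intro indep_intros indep_adj dyad_notin_block; unfold mem_Times_iff) (use assms disj in blast)+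

lemma wjk_le: "wjk A j k \<le> (\<Sum>l\<in>V4. A10 A l k) * (\<Sum>i\<in>V1. A11 A i j)"
proof -
  have "wjk A j k \<le> (\<Sum>z\<in>V4 \<times> V1. A10 A (fst z) k * A11 A (snd z) j)"
    unfolding wjk_def
  proof (rule sum_mono)
    fix z
    have "A11 A (snd z) j * A10 A (fst z) k * A00 A (fst z) (snd z) \<le> A11 A (snd z) j * A10 A (fst z) k * 1"
      by (intro mult_left_mono A_range mult_nonneg_nonneg)
    thus "A11 A (snd z) j * A10 A (fst z) k * A00 A (fst z) (snd z) \<le> A10 A (fst z) k * A11 A (snd z) j"
      by (simp add: mult.commute)
  qed
  thus ?thesis by (simp only: sum_product_pairs[of "\<lambda>l. A10 A l k" "\<lambda>i. A11 A i j"])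
qed

text \<open>A single reciprocated degree is capped by the whole count, which is at most 4 R outside
  a rare event. The crude cap is affordable: its \<open>R\<close> cancels against the one in the
  mean and leaves rates proportional to \<open>F False\<close> and \<open>F True\<close>.\<close>

lemma degree11_le:
  "i \<in> V1 \<Longrightarrow> wi A i \<le> (\<Sum>i\<in>V1. wi A i)" "j \<in> V2 \<Longrightarrow> (\<Sum>i\<in>V1. A11 A i j) \<le> (\<Sum>i\<in>V1. wi A i)"
proof -
  show "wi A i \<le> (\<Sum>i\<in>V1. wi A i)" if "i \<in> V1"
    using that finite_blocks by (intro member_le_sum) (auto simp: wa_nonneg)
  show "(\<Sum>i\<in>V1. A11 A i j) \<le> (\<Sum>i\<in>V1. wi A i)" if "j \<in> V2"
    unfolding wi_def
    using that finite_blocks by (intro sum_mono member_le_sum) (auto simp: A_range)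
qed

text \<open>The blocks \<open>V1 \<times> V2\<close> and \<open>V4 \<times> V3\<close> are exposed first, then \<open>V4 \<times> V1\<close>, and \<open>V2 \<times> V3\<close> last.\<close>

lemma Qa_tail: "prob (\<lambda>A. Qa n A < R * M / 2 ^ 28) \<le> (2 * n + 5) * q0"
proof -
  \<comment> \<open>Half the product of R / 2 ^ 11 and M / 2 ^ 11; then a factor 4 for the first
    null block and 2 for the normaliser of the second. The final tail again leads to 2 ^ 28.\<close>
  let ?c6 = "R * M / 2 ^ 23" and ?c7 = "R * M / 2 ^ 26"
  define N6 where "N6 A \<longleftrightarrow> (\<forall>z\<in>V4 \<times> V1. 0 \<le> wo A (fst z) * wi A (snd z) \<and> wo A (fst z) * wi A (snd z) \<le> F True * (4 * R))
      \<and> ?c6 \<le> (\<Sum>z\<in>V4 \<times> V1. 1 / 2 * (wo A (fst z) * wi A (snd z)))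
      \<and> (\<Sum>z\<in>V4 \<times> V1. (wo A (fst z) * wi A (snd z)) * A00 A (fst z) (snd z)) < ?c6 / 4" for A
  define N7 where "N7 A \<longleftrightarrow> (\<forall>z\<in>V2 \<times> V3. 0 \<le> wjk A (fst z) (snd z) \<and> wjk A (fst z) (snd z) \<le> F False * (4 * R))
      \<and> ?c7 \<le> (\<Sum>z\<in>V2 \<times> V3. 1 / 2 * wjk A (fst z) (snd z))
      \<and> (\<Sum>z\<in>V2 \<times> V3. wjk A (fst z) (snd z) * A00 A (fst z) (snd z)) < ?c7 / 4" for A
  note pos = pos_consts(1,2,4) pos_consts(3)[of True] pos_consts(3)[of False]
  have N6: "prob N6 \<le> q0"
  proof -
    have "prob N6 \<le> exp (- (?c6 / (4 * (F True * (4 * R)))))"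
      unfolding N6_def
      using sub disj indep_wa pos by (intro lower_tail_00) auto
    also have "\<dots> \<le> q0"
      using \<tau>_le(3)[of False] pos by (intro exp_le_q0) (simp add: M_def)
    finally show ?thesis .
  qed
  have N7: "prob N7 \<le> q0"
  proof -
    have "prob N7 \<le> exp (- (?c7 / (4 * (F False * (4 * R)))))"
      unfolding N7_def
      using sub disj indep_wjk pos by (intro lower_tail_00) auto
    also have "\<dots> \<le> q0"
      using \<tau>_le(3)[of True] pos by (intro exp_le_q0) (simp add: M_def)
    finally show ?thesis .
  qed
  have ex: "prob (\<lambda>A. \<exists>l\<in>V4. F True < (\<Sum>k\<in>V3. A10 A l k)) \<le> n * q0"
    "prob (\<lambda>A. \<exists>k\<in>V3. F False < (\<Sum>l\<in>V4. A10 A l k)) \<le> n * q0"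
    using sub disj by (auto intro!: prob_ex_le degree_tails q0_pos)
  have "prob (\<lambda>A. Qa n A < R * M / 2 ^ 28) \<le> prob (\<lambda>A. (\<Sum>i\<in>V1. wi A i) < R / 2 ^ 11 \<or>
      4 * R < (\<Sum>i\<in>V1. wi A i) \<or> (\<Sum>l\<in>V4. wo A l) < M / 2 ^ 11 \<or> N6 A \<or> N7 A \<or>
      (\<exists>l\<in>V4. F True < (\<Sum>k\<in>V3. A10 A l k)) \<or> (\<exists>k\<in>V3. F False < (\<Sum>l\<in>V4. A10 A l k)))"
  proof (rule prob_mono, rule ccontr)
    fix A assume Q: "Qa n A < R * M / 2 ^ 28" and "\<not> ((\<Sum>i\<in>V1. wi A i) < R / 2 ^ 11 \<or>
      4 * R < (\<Sum>i\<in>V1. wi A i) \<or> (\<Sum>l\<in>V4. wo A l) < M / 2 ^ 11 \<or> N6 A \<or> N7 A \<or>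
      (\<exists>l\<in>V4. F True < (\<Sum>k\<in>V3. A10 A l k)) \<or> (\<exists>k\<in>V3. F False < (\<Sum>l\<in>V4. A10 A l k)))"
    hence t: "R / 2 ^ 11 \<le> (\<Sum>i\<in>V1. wi A i)" "(\<Sum>i\<in>V1. wi A i) \<le> 4 * R" "M / 2 ^ 11 \<le> (\<Sum>l\<in>V4. wo A l)"
      "\<not> N6 A" "\<not> N7 A" "\<And>l. l \<in> V4 \<Longrightarrow> wo A l \<le> F True"
      "\<And>k. k \<in> V3 \<Longrightarrow> (\<Sum>l\<in>V4. A10 A l k) \<le> F False"
      by (auto simp: not_less wo_def)
    have "M / 2 ^ 11 * (R / 2 ^ 11) \<le> (\<Sum>l\<in>V4. wo A l) * (\<Sum>i\<in>V1. wi A i)"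
      using pos by (intro mult_mono t sum_nonneg wa_nonneg) auto
    hence "?c6 \<le> (\<Sum>z\<in>V4 \<times> V1. 1 / 2 * (wo A (fst z) * wi A (snd z)))"
      unfolding sum_distrib_left[symmetric] sum_product_pairs
      by (simp add: mult_ac)
    moreover have "0 \<le> wo A l * wi A i" "wo A l * wi A i \<le> F True * (4 * R)" if "l \<in> V4" "i \<in> V1" for l i
      using t(6)[OF that(1)] degree11_le(1)[OF that(2), of A] t(2) wa_nonneg pos
      by (auto intro!: mult_mono)
    ultimately have Z: "?c6 / 4 \<le> (\<Sum>z\<in>V4 \<times> V1. wo A (fst z) * wi A (snd z) * A00 A (fst z) (snd z))"
      using t(4) unfolding N6_def by (auto simp: not_less)
    have "?c7 \<le> (\<Sum>z\<in>V2 \<times> V3. 1 / 2 * wjk A (fst z) (snd z))"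
    proof -
      have "?c7 = 1 / 2 * (?c6 / 4)" by simp
      thus ?thesis unfolding sum_distrib_left[symmetric] wjk_sum using Z by linarith
    qed
    moreover have "wjk A j k \<le> F False * (4 * R)" if "j \<in> V2" "k \<in> V3" for j k
    proof (rule order_trans[OF wjk_le], rule mult_mono)
      show "(\<Sum>i\<in>V1. A11 A i j) \<le> 4 * R" using degree11_le(2)[OF that(1), of A] t(2) by linarith
    qed (use t(7)[OF that(2)] pos in \<open>auto intro!: sum_nonneg A_range\<close>)
    ultimately have "?c7 / 4 \<le> (\<Sum>z\<in>V2 \<times> V3. wjk A (fst z) (snd z) * A00 A (fst z) (snd z))"
      using t(5) wa_nonneg(3)[of A] unfolding N7_def by (auto simp: not_less)
    thus False using Qa_ge[of A] Q by simp
  qed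
  also have "\<dots> \<le> q0 + (q0 + (q0 + (q0 + (q0 + (n * q0 + n * q0)))))"
    by (intro prob_or_le count11_lower count11_upper count10_lower N6 N7 ex)
  also have "\<dots> = (2 * n + 5) * q0" by (simp add: algebra_simps)
  finally show ?thesis .
qed

end

section \<open>Risk of the truncated estimator\<close>

text \<open>Truncation is the projection onto [-t, t], and projecting onto an interval never
  increases the distance to one of its points.\<close>

lemma Htrunc_contract: "\<bar>r\<bar> \<le> t \<Longrightarrow> \<bar>Htrunc x t - r\<bar> \<le> \<bar>x - r\<bar>"
  unfolding Htrunc_def by (cases "x > 0"; cases "x = 0") (auto split: if_splits)

lemma abs_Htrunc_le: "0 \<le> t \<Longrightarrow> \<bar>Htrunc x t\<bar> \<le> t"
  unfolding Htrunc_def by (auto simp: abs_mult abs_sgn_eq)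

lemma abs_ln_diff_le:
  fixes a b c :: real
  assumes "0 < c" "c \<le> a" "c \<le> b"
  shows "\<bar>ln a - ln b\<bar> \<le> \<bar>a - b\<bar> / c"
proof -
  have *: "ln x - ln y \<le> \<bar>x - y\<bar> / c" if "c \<le> x" "c \<le> y" for x y
  proof -
    have xy: "0 < x" "0 < y" using that assms(1) by auto
    have "ln x - ln y = ln (x / y)" using xy by (simp add: ln_div)
    also have "\<dots> \<le> x / y - 1" using xy by (intro ln_le_minus_one) simp
    also have "\<dots> = (x - y) / y" using xy by (simp add: diff_divide_distrib)
    also have "\<dots> \<le> \<bar>x - y\<bar> / y" using xy by (intro divide_right_mono) auto
    also have "\<dots> \<le> \<bar>x - y\<bar> / c" using xy that assms(1) by (intro divide_left_mono) auto
    finally show ?thesis .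
  qed
  show ?thesis using *[of a b] *[of b a] assms by (auto simp: abs_le_iff abs_minus_commute)
qed

lemma abs_rho_hat_star_le: "1 \<le> n \<Longrightarrow> \<bar>rho_hat_star n A\<bar> \<le> 2 * ln (real n)"
  unfolding rho_hat_star_def using abs_Htrunc_le[of "2 * ln (real n)"] by auto

context p1_blocks
begin

lemma mean_Qa_pos: "0 < E (Qa n)"
  using mean_Qa_lower pos_consts(2,4) by (smt (verit) divide_pos_pos mult_pos_pos zero_less_power)

text \<open>Before truncation the error is \<open>ln (Qa n A) - ln (e * Qb n A)\<close>. Both
  arguments are at least \<open>R * M / 2 ^ 28\<close>, which bounds the slope of the logarithm, and
  their difference is \<open>Ustat\<close>.\<close>

lemma rho_hat_star_good:
  assumes "\<bar>\<rho>\<bar> \<le> 2 * ln (real n)" "R * M / 2 ^ 28 \<le> Qa n A" "H\<^sup>2 * M / 2 ^ 28 \<le> Qb n A"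
  shows "(rho_hat_star n A - \<rho>)\<^sup>2 \<le> (2 ^ 28 / (R * M))\<^sup>2 * (Ustat n \<rho> A)\<^sup>2"
proof -
  let ?c = "R * M / 2 ^ 28"
  have c: "0 < ?c" using pos_consts by simp
  have "0 < H\<^sup>2 * M / 2 ^ 28" using pos_consts by simp
  hence Q: "0 < Qa n A" "0 < Qb n A" using c assms by linarith+
  have "?c \<le> e * Qb n A"
    using mult_left_mono[OF assms(3), of e] by (simp add: R_def mult_ac)
  hence "\<bar>ln (Qa n A) - ln (e * Qb n A)\<bar> \<le> \<bar>Qa n A - e * Qb n A\<bar> / ?c"
    by (intro abs_ln_diff_le c assms)
  hence "\<bar>ln (Qa n A / Qb n A) - \<rho>\<bar> \<le> 2 ^ 28 / (R * M) * \<bar>Ustat n \<rho> A\<bar>"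
    using Q by (simp add: ln_div ln_mult Ustat_def diff_diff_eq add.commute mult.commute)
  hence "\<bar>rho_hat_star n A - \<rho>\<bar> \<le> 2 ^ 28 / (R * M) * \<bar>Ustat n \<rho> A\<bar>"
    using Q Htrunc_contract[OF assms(1), of "ln (Qa n A / Qb n A)"] by (simp add: rho_hat_star_def)
  hence "\<bar>rho_hat_star n A - \<rho>\<bar>\<^sup>2 \<le> (2 ^ 28 / (R * M) * \<bar>Ustat n \<rho> A\<bar>)\<^sup>2"
    by (intro power_mono) auto
  thus ?thesis by (simp only: power2_abs power_mult_distrib)
qed

text \<open>On the bad event the estimator and \<rho> both lie within 2 ln n of 0, so the squared
  error is at most 16 times the square of ln n. The two tail bounds add up to 6 n + 9 multiples of
  \<open>q0\<close>.\<close>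

lemma mean_square_error:
  assumes "1 \<le> n" "\<bar>\<rho>\<bar> \<le> 2 * ln (real n)"
  shows "E (\<lambda>A. (rho_hat_star n A - \<rho>)\<^sup>2)
    \<le> (2 ^ 28 / (R * M))\<^sup>2 * E (\<lambda>A. (Ustat n \<rho> A)\<^sup>2) + 16 * (ln (real n))\<^sup>2 * ((6 * n + 9) * q0)"
proof -
  let ?bad = "\<lambda>A. Qa n A < R * M / 2 ^ 28 \<or> Qb n A < H\<^sup>2 * M / 2 ^ 28"
  have "E (\<lambda>A. (rho_hat_star n A - \<rho>)\<^sup>2)
    \<le> E (\<lambda>A. (2 ^ 28 / (R * M))\<^sup>2 * (Ustat n \<rho> A)\<^sup>2 + 16 * (ln (real n))\<^sup>2 * of_bool (?bad A))"
  proof (rule mean_mono)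
    fix \<omega>
    let ?A = "adj \<omega>"
    show "(rho_hat_star n ?A - \<rho>)\<^sup>2 \<le> (2 ^ 28 / (R * M))\<^sup>2 * (Ustat n \<rho> ?A)\<^sup>2
        + 16 * (ln (real n))\<^sup>2 * of_bool (?bad ?A)"
    proof (cases "?bad ?A")
      case True
      have "\<bar>rho_hat_star n ?A - \<rho>\<bar> \<le> 4 * ln (real n)"
        using abs_rho_hat_star_le[OF assms(1), of ?A] assms(2) by linarith
      hence "\<bar>rho_hat_star n ?A - \<rho>\<bar>\<^sup>2 \<le> (4 * ln (real n))\<^sup>2" by (intro power_mono) auto
      hence "(rho_hat_star n ?A - \<rho>)\<^sup>2 \<le> 16 * (ln (real n))\<^sup>2" by (simp add: power_mult_distrib)
      moreover have "0 \<le> (2 ^ 28 / (R * M))\<^sup>2 * (Ustat n \<rho> ?A)\<^sup>2" by simp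
      moreover have "of_bool (?bad ?A) = (1 :: real)" using True by simp
      ultimately show ?thesis by (simp only: mult_1_right add_increasing)
    next
      case False
      have "of_bool (?bad ?A) = (0 :: real)" using False by simp
      moreover have "(rho_hat_star n ?A - \<rho>)\<^sup>2 \<le> (2 ^ 28 / (R * M))\<^sup>2 * (Ustat n \<rho> ?A)\<^sup>2"
        using False by (intro rho_hat_star_good assms) auto
      ultimately show ?thesis by (simp only: mult_zero_right add_0_right)
    qed
  qed
  also have "\<dots> = (2 ^ 28 / (R * M))\<^sup>2 * E (\<lambda>A. (Ustat n \<rho> A)\<^sup>2) + 16 * (ln (real n))\<^sup>2 * prob ?bad"
    by (simp only: mean_add mean_cmult prob_def)
  also have "\<dots> \<le> (2 ^ 28 / (R * M))\<^sup>2 * E (\<lambda>A. (Ustat n \<rho> A)\<^sup>2) + 16 * (ln (real n))\<^sup>2 * ((6 * n + 9) * q0)"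
  proof (intro add_left_mono mult_left_mono)
    have "prob ?bad \<le> (2 * n + 5) * q0 + (4 * n + 4) * q0" by (rule prob_or_le[OF Qa_tail Qb_tail])
    thus "prob ?bad \<le> (6 * n + 9) * q0" by (simp add: algebra_simps)
  qed simp
  finally show ?thesis .
qed

end

section \<open>The risk in terms of \<open>r_n\<close>, and the case of a single large n\<close>

context p1_model
begin

lemma l1_eta: "l1 n h = H"
  by (simp add: l1_def H_def nonneg)

lemma ip_mu_eta: "ip n m h = G False" and ip_nu_eta: "ip n v h = G True"
  by (simp_all add: ip_def G_def f_def)

lemma r_n_eq: "r_n n \<rho> \<gamma> \<alpha> \<beta> = max (1 / (e * H\<^sup>2)) (G False * G True / H ^ 4)"
  by (simp add: r_n_def l1_eta ip_mu_eta ip_nu_eta)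

end

text \<open>The premise \<open>tail\<close> bounds the bad-event term by 1 / R. The lower bound on
  the variance and \<open>Q \<le> R * M\<close> make 1 / R at most 2 ^ 40 times the relative
  variance, so it is absorbed in passing from 2 ^ 56 to 2 ^ 57.\<close>

lemma (in p1_regime) risk_bound:
  assumes n: "1 \<le> n" and \<rho>: "\<bar>\<rho>\<bar> \<le> 2 * ln (real n)"
    and tail: "16 * (ln (real n))\<^sup>2 * ((6 * n + 9) * exp (- (min H (e * H\<^sup>2) / 2 ^ 30))) \<le> 1 / (e * H\<^sup>2)"
  shows "E (\<lambda>A. (rho_hat_star n A - \<rho>)\<^sup>2) \<le> 2 ^ 57 * (E (\<lambda>A. (Ustat n \<rho> A)\<^sup>2) / (E (Qa n))\<^sup>2)"
    and "E (\<lambda>A. (Ustat n \<rho> A)\<^sup>2) / (E (Qa n))\<^sup>2 \<le> 2 ^ 57 * r_n n \<rho> \<gamma> \<alpha> \<beta>"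
proof -
  obtain V1 V2 V3 V4 where V: "V1 \<subseteq> {..<n}" "V2 \<subseteq> {..<n}" "V3 \<subseteq> {..<n}" "V4 \<subseteq> {..<n}"
    "V1 \<inter> V2 = {}" "V1 \<inter> V3 = {}" "V1 \<inter> V4 = {}" "V2 \<inter> V3 = {}" "V2 \<inter> V4 = {}" "V3 \<inter> V4 = {}"
    "H / 16 \<le> (\<Sum>i\<in>V1. h i)" "H / 16 \<le> (\<Sum>i\<in>V2. h i)"
    "F True / 16 \<le> (\<Sum>i\<in>V3. v i)" "F False / 16 \<le> (\<Sum>i\<in>V4. m i)"
    by (rule blocks_exist)
  interpret blocks: p1_blocks n \<rho> \<gamma> \<alpha> \<beta> V1 V2 V3 V4
    by unfold_locales (fact V)+
  define R where "R = e * H\<^sup>2"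
  define M where "M = F False * F True"
  define Q where "Q = E (Qa n)"
  define U where "U = E (\<lambda>A. (Ustat n \<rho> A)\<^sup>2)"
  have defs: "blocks.R = R" "blocks.M = M" "blocks.q0 = exp (- (min H R / 2 ^ 30))"
    by (simp_all add: blocks.R_def blocks.M_def blocks.q0_def blocks.\<tau>_def R_def M_def)
  have pos: "0 < R" "0 < M" "0 < Q" "0 < H" "0 \<le> U"
    using blocks.pos_consts blocks.mean_Qa_pos unfolding defs Q_def U_def by (auto intro!: mean_nonneg)
  have Q: "R * M / 2 ^ 20 \<le> Q" "Q \<le> R * M"
    using blocks.mean_Qa_lower blocks.mean_Qa_upper unfolding defs Q_def by auto
  have U: "R * M\<^sup>2 / 2 ^ 40 \<le> U" "U \<le> 500 * (X + Y)"
    using blocks.variance_lower variance_upper unfolding defs U_def by auto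
  have inv: "1 / (R * M)\<^sup>2 \<le> 1 / Q\<^sup>2"
    using Q pos by (intro divide_left_mono power_mono) auto
  have "1 / R = 2 ^ 40 * (R * M\<^sup>2 / 2 ^ 40) * (1 / (R * M)\<^sup>2)"
    using pos by (simp add: power2_eq_square)
  also have "\<dots> \<le> 2 ^ 40 * U * (1 / Q\<^sup>2)"
    using U(1) inv pos by (intro mult_mono) auto
  finally have 1: "1 / R \<le> 2 ^ 40 * (U / Q\<^sup>2)" by simp
  have "(2 ^ 28 / (R * M))\<^sup>2 * U = 2 ^ 56 * U * (1 / (R * M)\<^sup>2)"
    by (simp add: power_divide)
  also have "\<dots> \<le> 2 ^ 56 * U * (1 / Q\<^sup>2)"
    using inv pos by (intro mult_left_mono) auto
  finally have 2: "(2 ^ 28 / (R * M))\<^sup>2 * U \<le> 2 ^ 56 * (U / Q\<^sup>2)" by simp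
  have UQ: "0 \<le> U / Q\<^sup>2" using pos by simp
  have "E (\<lambda>A. (rho_hat_star n A - \<rho>)\<^sup>2) \<le> (2 ^ 28 / (R * M))\<^sup>2 * U + 1 / R"
    using blocks.mean_square_error[OF n \<rho>] tail unfolding defs U_def[symmetric] R_def[symmetric] by linarith
  also have "\<dots> \<le> 2 ^ 56 * (U / Q\<^sup>2) + 2 ^ 40 * (U / Q\<^sup>2)" using 1 2 by linarith
  also have "\<dots> \<le> 2 ^ 57 * (U / Q\<^sup>2)" using UQ by simp
  finally show "E (\<lambda>A. (rho_hat_star n A - \<rho>)\<^sup>2) \<le> 2 ^ 57 * (E (\<lambda>A. (Ustat n \<rho> A)\<^sup>2) / (E (Qa n))\<^sup>2)"
    by (simp only: U_def Q_def)
  have "1 / Q\<^sup>2 \<le> 1 / (R * M / 2 ^ 20)\<^sup>2"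
    using Q pos by (intro divide_left_mono power_mono) auto
  hence "U * (1 / Q\<^sup>2) \<le> 500 * (X + Y) * (1 / (R * M / 2 ^ 20)\<^sup>2)"
    using U(2) X_nonneg Y_nonneg pos by (intro mult_mono) auto
  also have "\<dots> = 500 * 2 ^ 40 * (X / (R * M)\<^sup>2 + Y / (R * M)\<^sup>2)"
    by (simp add: power_divide add_divide_distrib)
  also have "X / (R * M)\<^sup>2 = G False * G True / H ^ 4"
  proof -
    have "(R * M)\<^sup>2 = e\<^sup>2 * M\<^sup>2 * H ^ 4"
      by (simp add: R_def power2_eq_square power4_eq_xxxx mult_ac)
    moreover have "X = e\<^sup>2 * M\<^sup>2 * (G False * G True)" by (simp add: X_def M_def mult_ac)
    ultimately show ?thesis using pos by simp
  qed
  also have "Y / (R * M)\<^sup>2 = 1 / (e * H\<^sup>2)"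
  proof -
    have "Y = R * M\<^sup>2" by (simp add: Y_def R_def M_def)
    hence "Y / (R * M)\<^sup>2 = 1 / R" using pos by (simp add: power2_eq_square)
    thus ?thesis by (simp only: R_def)
  qed
  finally have "U / Q\<^sup>2 \<le> 500 * 2 ^ 40 * (G False * G True / H ^ 4 + 1 / (e * H\<^sup>2))" by simp
  \<comment> \<open>Each of the two terms is at most their maximum, and 1000 * 2 ^ 40 is below 2 ^
    57.\<close>
  also have "\<dots> \<le> 500 * 2 ^ 40 * (r_n n \<rho> \<gamma> \<alpha> \<beta> + r_n n \<rho> \<gamma> \<alpha> \<beta>)"
    unfolding r_n_eq by (intro mult_left_mono add_mono) auto
  also have "\<dots> \<le> 2 ^ 57 * r_n n \<rho> \<gamma> \<alpha> \<beta>"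
  proof -
    have "0 \<le> 1 / (e * H\<^sup>2)" by simp
    hence "0 \<le> r_n n \<rho> \<gamma> \<alpha> \<beta>" unfolding r_n_eq by linarith
    thus ?thesis by simp
  qed
  finally show "E (\<lambda>A. (Ustat n \<rho> A)\<^sup>2) / (E (Qa n))\<^sup>2 \<le> 2 ^ 57 * r_n n \<rho> \<gamma> \<alpha> \<beta>"
    by (simp only: U_def Q_def)
qed

lemma vmax_ge: "i < n \<Longrightarrow> x i \<le> vmax n x"
  unfolding vmax_def by (rule Max_ge) auto

text \<open>The consequences of (G1) and (G2+) at a single large \<open>n\<close>.\<close>

locale p1_large = p1_model +
  assumes n_ge: "3 \<le> n"
    and vmax_mu: "vmax n m \<le> 1 / 8" and vmax_nu: "vmax n v \<le> 1 / 8"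
    and vmax_eta: "exp (\<rho> / 2) * vmax n h \<le> 1 / 2"
    and H_large: "2 ^ 40 \<le> H / (ln (real n))\<^sup>2"
    and R_large: "2 ^ 20 \<le> exp (\<rho> / 2) * H / sqrt (ln (real n))"
begin

lemma ln_n_ge_1: "1 \<le> ln (real n)"
proof -
  have "exp 1 \<le> real n" using exp_le n_ge by linarith
  thus ?thesis using n_ge by (subst ln_ge_iff) auto
qed

lemma H_ge_ln: "2 ^ 40 * ln (real n) \<le> H"
proof -
  have "2 ^ 40 * ln (real n) \<le> 2 ^ 40 * (ln (real n))\<^sup>2"
    using self_le_power[OF ln_n_ge_1, of 2] by simp
  also have "\<dots> \<le> H" using H_large ln_n_ge_1 by (simp add: field_simps)
  finally show ?thesis .
qed

lemma sqrt_R: "e * H\<^sup>2 = (exp (\<rho> / 2) * H)\<^sup>2"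
  by (simp add: power_mult_distrib exp_double[symmetric])

lemma R_ge_ln: "2 ^ 40 * ln (real n) \<le> e * H\<^sup>2"
proof -
  have "2 ^ 20 * sqrt (ln (real n)) \<le> exp (\<rho> / 2) * H"
    using R_large ln_n_ge_1 by (simp add: field_simps)
  hence "(2 ^ 20 * sqrt (ln (real n)))\<^sup>2 \<le> (exp (\<rho> / 2) * H)\<^sup>2"
    using ln_n_ge_1 by (intro power_mono) auto
  thus ?thesis using ln_n_ge_1 unfolding sqrt_R by (simp add: power_mult_distrib)
qed

lemma ln_le: "ln (real n) \<le> H" "ln (real n) \<le> e * H\<^sup>2"
proof -
  have "1 * ln (real n) \<le> 2 ^ 40 * ln (real n)"
    using ln_n_ge_1 by (intro mult_right_mono) auto
  thus "ln (real n) \<le> H" "ln (real n) \<le> e * H\<^sup>2"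
    using H_ge_ln R_ge_ln by linarith+
qed

lemma H_le_vmax: "H \<le> n * vmax n h"
proof -
  have "H \<le> (\<Sum>i<n. vmax n h)" unfolding H_def by (intro sum_mono vmax_ge) simp
  thus ?thesis by simp
qed

sublocale p1_regime
proof
  show "m i \<le> 1 / 8" "v i \<le> 1 / 8" if "i < n" for i
    using vmax_ge[of i n m] vmax_ge[of i n v] vmax_mu vmax_nu that by linarith+
  have *: "exp (\<rho> / 2) * h i \<le> 1 / 2" if "i < n" for i
    using mult_left_mono[OF vmax_ge[OF that, of h] exp_ge_zero[of "\<rho> / 2"]] vmax_eta by (rule order_trans)
  show "e * h i * h j \<le> 1 / 2" if "i < n" "j < n" for i j
  proof -
    have "e * h i * h j = (exp (\<rho> / 2) * h i) * (exp (\<rho> / 2) * h j)"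
      by (simp add: exp_add[symmetric])
    also have "\<dots> \<le> 1 / 2 * (1 / 2)" using that by (intro mult_mono *) (auto simp: nonneg)
    finally show ?thesis by simp
  qed
  show "32 \<le> H" using H_ge_ln ln_n_ge_1 by simp
  show "1 \<le> e * H\<^sup>2" using R_ge_ln ln_n_ge_1 by simp
qed

text \<open>\<open>H\<close> is at most n times the largest \<open>h i\<close>, and the hypothesis
  \<open>vmax_eta\<close> absorbs the exponential factor.\<close>

lemma sqrt_R_le: "exp (\<rho> / 2) * H \<le> n"
proof -
  have "exp (\<rho> / 2) * H \<le> exp (\<rho> / 2) * (n * vmax n h)" by (intro mult_left_mono H_le_vmax) simp
  also have "\<dots> = n * (exp (\<rho> / 2) * vmax n h)" by simp
  also have "\<dots> \<le> real n * 1" using vmax_eta by (intro mult_left_mono) simp_all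
  finally show ?thesis by simp
qed

lemma H_le_n: "H \<le> n"
proof -
  have "h i \<le> 1" if "i < n" for i
    using mult_mono[OF m_le[OF that] v_le[OF that]] nonneg[of i] by (simp add: eta_def)
  hence "H \<le> (\<Sum>i<n. 1)" unfolding H_def by (intro sum_mono) auto
  thus ?thesis by simp
qed

text \<open>This is why truncation at 2 ln n is harmless: \<open>exp (\<rho> / 2) * H\<close> lies
  between 1 and n, and so does \<open>H\<close>.\<close>

lemma abs_rho_le: "\<bar>\<rho>\<bar> \<le> 2 * ln (real n)"
proof -
  have n: "0 < real n" using n_ge by simp
  have "exp (\<rho> / 2) * 1 \<le> exp (\<rho> / 2) * H" by (intro mult_left_mono one_le_H) simp
  hence "exp (\<rho> / 2) \<le> real n" using sqrt_R_le by linarith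
  hence "exp (\<rho> / 2) \<le> exp (ln (real n))" using n by (simp only: exp_ln)
  hence 1: "\<rho> / 2 \<le> ln (real n)" by simp
  have "1\<^sup>2 \<le> (exp (\<rho> / 2) * H)\<^sup>2" using R_ge unfolding sqrt_R by simp
  hence "1 \<le> exp (\<rho> / 2) * H" by (rule power2_le_imp_le) (use one_le_H in auto)
  also have "\<dots> \<le> exp (\<rho> / 2) * n" by (intro mult_left_mono H_le_n) simp
  finally have "exp (- (\<rho> / 2)) \<le> exp (ln (real n))" using n by (simp add: exp_minus field_simps)
  hence "- (\<rho> / 2) \<le> ln (real n)" by simp
  thus ?thesis using 1 by linarith
qed

text \<open>Powers of n: at most 2 from the squared logarithm, 1 from the union bound and 2 from
  \<open>e * H\<^sup>2\<close>, against -10 from the exponential. What remains is 240 / n^5, at most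
  1 since 3^5 = 243.\<close>

lemma tail_small:
  "16 * (ln (real n))\<^sup>2 * ((6 * n + 9) * exp (- (min H (e * H\<^sup>2) / 2 ^ 30))) \<le> 1 / (e * H\<^sup>2)"
proof -
  let ?q = "exp (- (min H (e * H\<^sup>2) / 2 ^ 30))"
  have n: "3 \<le> real n" using n_ge by simp
  \<comment> \<open>The threshold 2 ^ 40 against the 2 ^ 30 in the exponent leaves 2 ^ 10 multiples
    of ln n, of which 10 are used.\<close>
  have "10 * ln (real n) \<le> min H (e * H\<^sup>2) / 2 ^ 30"
    using H_ge_ln R_ge_ln ln_n_ge_1 by simp
  hence "?q \<le> exp (- (10 * ln (real n)))" by simp
  also have "\<dots> = 1 / real n ^ 10"
  proof -
    have "exp (real 10 * ln (real n)) = exp (ln (real n)) ^ 10" by (rule exp_of_nat_mult)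
    thus ?thesis using n by (simp add: exp_minus inverse_eq_divide)
  qed
  finally have q: "?q \<le> 1 / real n ^ 10" .
  have R: "e * H\<^sup>2 \<le> (real n)\<^sup>2"
    unfolding sqrt_R using sqrt_R_le one_le_H by (intro power_mono) auto
  have ln: "(ln (real n))\<^sup>2 \<le> (real n)\<^sup>2"
    using ln_n_ge_1 ln_le_minus_one[of "real n"] n by (intro power_mono) auto
  have "16 * (ln (real n))\<^sup>2 * ((6 * n + 9) * ?q) * (e * H\<^sup>2)
    \<le> 16 * (real n)\<^sup>2 * ((15 * n) * (1 / real n ^ 10)) * (real n)\<^sup>2"
    using n by (intro mult_mono ln R q) auto
  also have "\<dots> = 240 * real n ^ 5 / real n ^ 10"
    by (simp add: power2_eq_square power_numeral_reduce)
  also have "\<dots> \<le> real n ^ 5 * real n ^ 5 / real n ^ 10"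
  proof (intro divide_right_mono mult_right_mono)
    have "(3 :: real) ^ 5 \<le> real n ^ 5" using n by (intro power_mono) auto
    thus "240 \<le> real n ^ 5" by simp
  qed auto
  also have "\<dots> = 1" using n by (simp add: power_add[symmetric])
  finally show ?thesis using R_ge by (subst pos_le_divide_eq) auto
qed

text \<open>Since all \<mu> and \<nu> are at most 1, both inner products are at most
  \<open>H\<close>, and the second term of \<open>r_n\<close> is at most the inverse square of
  \<open>H\<close>.\<close>

lemma r_n_le_inverse_ln: "r_n n \<rho> \<gamma> \<alpha> \<beta> \<le> 1 / ln (real n)"
proof -
  have ln: "0 < ln (real n)" using ln_n_ge_1 by linarith
  have G: "G t \<le> H" for t
    unfolding G_def H_def
  proof (rule sum_mono)
    fix i assume "i \<in> {..<n}"
    hence "f t i \<le> 1" using f_le[of i t] by simp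
    thus "f t i * h i \<le> h i" by (intro mult_left_le_one_le nonneg f_nonneg)
  qed
  have "G False * G True / H ^ 4 \<le> H * H / H ^ 4"
    using one_le_H by (intro divide_right_mono mult_mono G sums_nonneg) auto
  also have "\<dots> = 1 / H\<^sup>2" using one_le_H by (simp add: power4_eq_xxxx power2_eq_square)
  also have "\<dots> \<le> 1 / ln (real n)"
  proof (rule divide_left_mono)
    have "ln (real n) \<le> H" by (rule ln_le)
    also have "H \<le> H\<^sup>2" using self_le_power[OF one_le_H, of 2] by simp
    finally show "ln (real n) \<le> H\<^sup>2" .
  qed (use ln one_le_H in auto)
  finally have 1: "G False * G True / H ^ 4 \<le> 1 / ln (real n)" .
  have "ln (real n) \<le> e * H\<^sup>2" by (rule ln_le)
  hence 2: "1 / (e * H\<^sup>2) \<le> 1 / ln (real n)" using ln by (intro divide_left_mono) auto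
  show ?thesis unfolding r_n_eq using 1 2 by simp
qed

lemma r_n_nonneg: "0 \<le> r_n n \<rho> \<gamma> \<alpha> \<beta>"
proof -
  have "0 \<le> 1 / (e * H\<^sup>2)" by simp
  thus ?thesis unfolding r_n_eq by linarith
qed

lemmas risk_bound_large = risk_bound[OF _ abs_rho_le tail_small]

text \<open>All \<mu> and \<nu> equal exp (\<gamma> / 2) up to factors exp (c0). Two inner products
  lose exp (3 c0) each and the fourth power of \<open>H\<close> loses exp (8 c0), which makes 14.
  For the second bound the comparison is reversed: the lower bounds ln n on \<open>H\<close> and
  \<open>e * H\<^sup>2\<close> turn into lower bounds on the denominators.\<close>

lemma bounded_parameters:
  assumes c0: "0 < c0" and b: "\<And>i. i < n \<Longrightarrow> \<bar>\<alpha> i\<bar> \<le> c0 \<and> \<bar>\<beta> i\<bar> \<le> c0"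
  shows "r_n n \<rho> \<gamma> \<alpha> \<beta> \<le> exp (14 * c0) / ((real n)\<^sup>2 * exp \<gamma>) * max 1 (exp (- (\<gamma> + \<rho>)))"
    and "1 / ((real n)\<^sup>2 * exp \<gamma>) * max 1 (exp (- (\<gamma> + \<rho>))) \<le> exp (4 * c0) / ln (real n)"
proof -
  have n: "0 < real n" using n_ge by simp
  have ln: "0 < ln (real n)" using ln_n_ge_1 by linarith
  let ?d = "(real n)\<^sup>2 * exp \<gamma>" and ?w = "exp (- (\<gamma> + \<rho>))"
  have d: "0 < ?d" using n by simp
  have h: "exp (\<gamma> - 2 * c0) \<le> h i" "h i \<le> exp (\<gamma> + 2 * c0)"
    "f t i \<le> exp (\<gamma> / 2 + c0)" if "i < n" for i t
    using b[OF that] by (auto simp: eta_def mu_def nu_def f_def exp_add[symmetric])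
  have H1: "n * exp (\<gamma> - 2 * c0) \<le> H"
  proof -
    have "(\<Sum>i<n. exp (\<gamma> - 2 * c0)) \<le> H" unfolding H_def by (intro sum_mono h) auto
    thus ?thesis by simp
  qed
  have H2: "H \<le> n * exp (\<gamma> + 2 * c0)"
  proof -
    have "H \<le> (\<Sum>i<n. exp (\<gamma> + 2 * c0))" unfolding H_def by (intro sum_mono h) auto
    thus ?thesis by simp
  qed
  have G: "G t \<le> n * exp (3 / 2 * \<gamma> + 3 * c0)" for t
  proof -
    have "G t \<le> (\<Sum>i<n. exp (\<gamma> / 2 + c0) * exp (\<gamma> + 2 * c0))"
      unfolding G_def by (intro sum_mono mult_mono h f_nonneg nonneg) auto
    also have "\<dots> = n * exp (3 / 2 * \<gamma> + 3 * c0)"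
      by (simp add: exp_add[symmetric] algebra_simps)
    finally show ?thesis .
  qed
  have "(n * exp (\<gamma> - 2 * c0)) ^ 2 \<le> H ^ 2" "(n * exp (\<gamma> - 2 * c0)) ^ 4 \<le> H ^ 4"
    using H1 by (auto intro!: power_mono)
  hence H24: "(real n)\<^sup>2 * exp (2 * \<gamma> - 4 * c0) \<le> H\<^sup>2" "real n ^ 4 * exp (4 * \<gamma> - 8 * c0) \<le> H ^ 4"
    by (simp_all add: power_mult_distrib exp_of_nat_mult[symmetric] algebra_simps)
  have "1 / (e * H\<^sup>2) \<le> 1 / (e * ((real n)\<^sup>2 * exp (2 * \<gamma> - 4 * c0)))"
    using H24(1) n one_le_H by (intro divide_left_mono mult_left_mono mult_pos_pos) auto
  also have "\<dots> = exp (4 * c0) / ?d * ?w"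
  proof -
    have "e * exp (2 * \<gamma> - 4 * c0) * (exp (4 * c0) * ?w) = exp \<gamma>"
      by (simp add: exp_add[symmetric])
    thus ?thesis using n by (simp add: field_simps)
  qed
  also have "\<dots> \<le> exp (14 * c0) / ?d * max 1 ?w"
    using c0 d by (intro mult_mono divide_right_mono) auto
  finally have 1: "1 / (e * H\<^sup>2) \<le> exp (14 * c0) / ?d * max 1 ?w" .
  have "G False * G True / H ^ 4 \<le> (n * exp (3 / 2 * \<gamma> + 3 * c0)) * (n * exp (3 / 2 * \<gamma> + 3 * c0))
      / (real n ^ 4 * exp (4 * \<gamma> - 8 * c0))"
    using H24(2) n by (intro frac_le mult_mono G sums_nonneg) auto
  also have "\<dots> = exp (14 * c0) / ?d"
  proof -
    have "exp (3 / 2 * \<gamma> + 3 * c0) * exp (3 / 2 * \<gamma> + 3 * c0) * exp \<gamma> = exp (14 * c0) * exp (4 * \<gamma> - 8 * c0)"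
      by (simp add: exp_add[symmetric])
    thus ?thesis using n by (simp add: field_simps power2_eq_square power4_eq_xxxx)
  qed
  also have "\<dots> \<le> exp (14 * c0) / ?d * max 1 ?w"
    using d mult_left_mono[of 1 "max 1 ?w" "exp (14 * c0) / ?d"] by simp
  finally have 2: "G False * G True / H ^ 4 \<le> exp (14 * c0) / ?d * max 1 ?w" .
  show "r_n n \<rho> \<gamma> \<alpha> \<beta> \<le> exp (14 * c0) / ?d * max 1 ?w"
    unfolding r_n_eq using 1 2 by simp
  have "ln (real n) * exp (- (4 * c0)) \<le> H * exp (- (2 * c0))"
    using ln_le(1) ln c0 by (intro mult_mono) auto
  also have "\<dots> \<le> n * exp (\<gamma> + 2 * c0) * exp (- (2 * c0))"
    by (intro mult_right_mono H2) auto
  also have "\<dots> = n * exp \<gamma>" by (simp add: exp_add[symmetric] mult.assoc)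
  \<comment> \<open>Passing from n to its square is crude, but only convergence to 0 is
    wanted.\<close>
  also have "\<dots> \<le> ?d" using n_ge self_le_power[of "real n" 2] by simp
  finally have d1: "ln (real n) * exp (- (4 * c0)) \<le> ?d" .
  have "ln (real n) * exp (- (4 * c0)) \<le> e * H\<^sup>2 * exp (- (4 * c0))"
    by (intro mult_right_mono ln_le) simp
  also have "\<dots> \<le> e * (n * exp (\<gamma> + 2 * c0))\<^sup>2 * exp (- (4 * c0))"
    using H2 one_le_H by (intro mult_right_mono mult_left_mono power_mono) auto
  also have "\<dots> = (real n)\<^sup>2 * exp (2 * \<gamma> + \<rho>)"
    by (simp add: power_mult_distrib exp_double[symmetric] exp_add[symmetric] mult_ac)
  finally have d2: "ln (real n) * exp (- (4 * c0)) \<le> (real n)\<^sup>2 * exp (2 * \<gamma> + \<rho>)" .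
  have le: "1 / x \<le> exp (4 * c0) / ln (real n)" if "ln (real n) * exp (- (4 * c0)) \<le> x" for x
  proof -
    have "1 / x \<le> 1 / (ln (real n) * exp (- (4 * c0)))"
      using that ln by (intro frac_le) auto
    thus ?thesis by (simp add: exp_minus field_simps)
  qed
  have "1 / ?d * ?w = 1 / ((real n)\<^sup>2 * exp (2 * \<gamma> + \<rho>))"
  proof -
    have "exp (2 * \<gamma> + \<rho>) * ?w = exp \<gamma>" by (simp add: exp_add[symmetric])
    thus ?thesis using n by (simp add: field_simps)
  qed
  hence "1 / ?d * ?w \<le> exp (4 * c0) / ln (real n)" using le[OF d2] by simp
  moreover have "1 / ?d * 1 \<le> exp (4 * c0) / ln (real n)" using le[OF d1] by simp
  ultimately show "1 / ?d * max 1 ?w \<le> exp (4 * c0) / ln (real n)"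
    by (simp add: max_def)
qed

end

lemma inverse_ln_tendsto_0: "(\<lambda>n. c / ln (real n)) \<longlonglongrightarrow> 0"
  by (rule real_tendsto_divide_at_top[OF tendsto_const filterlim_compose[OF ln_at_top filterlim_real_sequentially]])

theorem theorem2:
  fixes \<rho> \<gamma> :: "nat \<Rightarrow> real" and \<alpha> \<beta> :: "nat \<Rightarrow> nat \<Rightarrow> real"
  assumes sum_alpha: "\<And>n. (\<Sum>i<n. \<alpha> n i) = 0"
    and sum_beta: "\<And>n. (\<Sum>i<n. \<beta> n i) = 0"
    \<comment> \<open>(G1)\<close>
    and G1_mu: "(\<lambda>n. vmax n (mu (\<gamma> n) (\<alpha> n))) \<longlonglongrightarrow> 0"
    and G1_nu: "(\<lambda>n. vmax n (nu (\<gamma> n) (\<beta> n))) \<longlonglongrightarrow> 0"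
    and G1_eta: "(\<lambda>n. exp (\<rho> n / 2) * vmax n (eta (\<gamma> n) (\<alpha> n) (\<beta> n))) \<longlonglongrightarrow> 0"
    \<comment> \<open>(G2+)\<close>
    and G2a: "filterlim (\<lambda>n. l1 n (eta (\<gamma> n) (\<alpha> n) (\<beta> n)) / (ln (real n))\<^sup>2) at_top sequentially"
    and G2b: "filterlim (\<lambda>n. exp (\<rho> n / 2) * l1 n (eta (\<gamma> n) (\<alpha> n) (\<beta> n)) / sqrt (ln (real n)))
                at_top sequentially"
    \<comment> \<open>(SP1)\<close>
    and SP1: "(\<lambda>n. (vmax n (mu (\<gamma> n) (\<alpha> n)))\<^sup>2 * (vmax n (nu (\<gamma> n) (\<beta> n)))\<^sup>2
                 / (ip n (mu (\<gamma> n) (\<alpha> n)) (eta (\<gamma> n) (\<alpha> n) (\<beta> n))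
                    * ip n (nu (\<gamma> n) (\<beta> n)) (eta (\<gamma> n) (\<alpha> n) (\<beta> n)))) \<longlonglongrightarrow> 0"
    \<comment> \<open>(SP2): in Case (L), the l1 norms of mu and nu are of the same order\<close>
    and SP2: "(\<exists>C>0. \<forall>\<^sub>F n in sequentially. exp (\<rho> n) \<ge> C * exp (rho_tilde n (\<gamma> n) (\<alpha> n) (\<beta> n)))
              \<longrightarrow> (\<exists>c0>0. \<exists>c1>0. \<forall>\<^sub>F n in sequentially.
                    c0 \<le> l1 n (mu (\<gamma> n) (\<alpha> n)) / l1 n (nu (\<gamma> n) (\<beta> n)) \<and>
                    l1 n (mu (\<gamma> n) (\<alpha> n)) / l1 n (nu (\<gamma> n) (\<beta> n)) \<le> c1)"
  shows "(\<exists>C>0. \<forall>\<^sub>F n in sequentially.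
            p1_E n (\<rho> n) (\<gamma> n) (\<alpha> n) (\<beta> n) (\<lambda>A. (rho_hat_star n A - \<rho> n)\<^sup>2)
              \<le> C * (p1_Var n (\<rho> n) (\<gamma> n) (\<alpha> n) (\<beta> n) (Ustat n (\<rho> n))
                     / (p1_E n (\<rho> n) (\<gamma> n) (\<alpha> n) (\<beta> n) (Qa n))\<^sup>2)
            \<and> p1_Var n (\<rho> n) (\<gamma> n) (\<alpha> n) (\<beta> n) (Ustat n (\<rho> n))
                / (p1_E n (\<rho> n) (\<gamma> n) (\<alpha> n) (\<beta> n) (Qa n))\<^sup>2
              \<le> C * r_n n (\<rho> n) (\<gamma> n) (\<alpha> n) (\<beta> n))
       \<and> (\<lambda>n. r_n n (\<rho> n) (\<gamma> n) (\<alpha> n) (\<beta> n)) \<longlonglongrightarrow> 0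
       \<and> ((\<exists>c0>0. \<forall>n. \<forall>i<n. \<bar>\<alpha> n i\<bar> \<le> c0 \<and> \<bar>\<beta> n i\<bar> \<le> c0) \<longrightarrow>
            (\<exists>C>0. \<forall>\<^sub>F n in sequentially.
               r_n n (\<rho> n) (\<gamma> n) (\<alpha> n) (\<beta> n)
                 \<le> C / ((real n)\<^sup>2 * exp (\<gamma> n)) * max 1 (exp (- (\<gamma> n + \<rho> n))))
            \<and> (\<lambda>n. 1 / ((real n)\<^sup>2 * exp (\<gamma> n)) * max 1 (exp (- (\<gamma> n + \<rho> n)))) \<longlonglongrightarrow> 0)"
proof -
  \<comment> \<open>Each limit enters only through one fixed threshold; what follows is an
    inequality at a single n with constants that do not depend on n.\<close>
  have "\<forall>\<^sub>F n in sequentially. p1_large n (\<rho> n) (\<gamma> n) (\<alpha> n) (\<beta> n)"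
  proof -
    have "\<forall>\<^sub>F n in sequentially. vmax n (mu (\<gamma> n) (\<alpha> n)) < 1 / 8"
      "\<forall>\<^sub>F n in sequentially. vmax n (nu (\<gamma> n) (\<beta> n)) < 1 / 8"
      "\<forall>\<^sub>F n in sequentially. exp (\<rho> n / 2) * vmax n (eta (\<gamma> n) (\<alpha> n) (\<beta> n)) < 1 / 2"
      by (rule order_tendstoD(2)[OF G1_mu] order_tendstoD(2)[OF G1_nu] order_tendstoD(2)[OF G1_eta]; simp)+
    moreover have "\<forall>\<^sub>F n in sequentially. 2 ^ 40 \<le> l1 n (eta (\<gamma> n) (\<alpha> n) (\<beta> n)) / (ln (real n))\<^sup>2"
      using G2a by (auto simp: filterlim_at_top)
    moreover have "\<forall>\<^sub>F n in sequentially.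
        2 ^ 20 \<le> exp (\<rho> n / 2) * l1 n (eta (\<gamma> n) (\<alpha> n) (\<beta> n)) / sqrt (ln (real n))"
      using G2b by (auto simp: filterlim_at_top)
    ultimately show ?thesis
      using eventually_ge_at_top[of 3]
    proof eventually_elim
      case (elim n)
      thus ?case
        by unfold_locales (simp_all add: p1_model.l1_eta)
    qed
  qed
  hence ev: "\<forall>\<^sub>F n in sequentially. 3 \<le> n \<and> p1_large n (\<rho> n) (\<gamma> n) (\<alpha> n) (\<beta> n)"
    using eventually_ge_at_top[of 3] by eventually_elim simp
  let ?r = "\<lambda>n. r_n n (\<rho> n) (\<gamma> n) (\<alpha> n) (\<beta> n)"
  let ?s = "\<lambda>n. 1 / ((real n)\<^sup>2 * exp (\<gamma> n)) * max 1 (exp (- (\<gamma> n + \<rho> n)))"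
  show ?thesis
  proof (intro conjI impI)
    show "\<exists>C>0. \<forall>\<^sub>F n in sequentially.
            p1_E n (\<rho> n) (\<gamma> n) (\<alpha> n) (\<beta> n) (\<lambda>A. (rho_hat_star n A - \<rho> n)\<^sup>2)
              \<le> C * (p1_Var n (\<rho> n) (\<gamma> n) (\<alpha> n) (\<beta> n) (Ustat n (\<rho> n))
                     / (p1_E n (\<rho> n) (\<gamma> n) (\<alpha> n) (\<beta> n) (Qa n))\<^sup>2)
            \<and> p1_Var n (\<rho> n) (\<gamma> n) (\<alpha> n) (\<beta> n) (Ustat n (\<rho> n))
                / (p1_E n (\<rho> n) (\<gamma> n) (\<alpha> n) (\<beta> n) (Qa n))\<^sup>2
              \<le> C * ?r n"
    proof (intro exI[of _ "2 ^ 57"] conjI)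
      show "\<forall>\<^sub>F n in sequentially.
            p1_E n (\<rho> n) (\<gamma> n) (\<alpha> n) (\<beta> n) (\<lambda>A. (rho_hat_star n A - \<rho> n)\<^sup>2)
              \<le> 2 ^ 57 * (p1_Var n (\<rho> n) (\<gamma> n) (\<alpha> n) (\<beta> n) (Ustat n (\<rho> n))
                     / (p1_E n (\<rho> n) (\<gamma> n) (\<alpha> n) (\<beta> n) (Qa n))\<^sup>2)
            \<and> p1_Var n (\<rho> n) (\<gamma> n) (\<alpha> n) (\<beta> n) (Ustat n (\<rho> n))
                / (p1_E n (\<rho> n) (\<gamma> n) (\<alpha> n) (\<beta> n) (Qa n))\<^sup>2
              \<le> 2 ^ 57 * ?r n"
        using ev
      proof eventually_elim
        case (elim n)
        then interpret p1_large n "\<rho> n" "\<gamma> n" "\<alpha> n" "\<beta> n" by simp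
        show ?case
          unfolding p1_Var_Ustat p1_E_eq using risk_bound_large elim by auto
      qed
    qed simp
    show "?r \<longlonglongrightarrow> 0"
    proof (rule tendsto_sandwich[OF _ _ tendsto_const inverse_ln_tendsto_0[of 1]])
      show "\<forall>\<^sub>F n in sequentially. 0 \<le> ?r n"
        using ev by eventually_elim (auto intro: p1_large.r_n_nonneg)
      show "\<forall>\<^sub>F n in sequentially. ?r n \<le> 1 / ln (real n)"
        using ev by eventually_elim (auto intro: p1_large.r_n_le_inverse_ln)
    qed
    assume "\<exists>c0>0. \<forall>n. \<forall>i<n. \<bar>\<alpha> n i\<bar> \<le> c0 \<and> \<bar>\<beta> n i\<bar> \<le> c0"
    then obtain c0 where c0: "0 < c0" "\<And>n i. i < n \<Longrightarrow> \<bar>\<alpha> n i\<bar> \<le> c0 \<and> \<bar>\<beta> n i\<bar> \<le> c0" by blast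
    show "\<exists>C>0. \<forall>\<^sub>F n in sequentially. ?r n
        \<le> C / ((real n)\<^sup>2 * exp (\<gamma> n)) * max 1 (exp (- (\<gamma> n + \<rho> n)))"
    proof (intro exI[of _ "exp (14 * c0)"] conjI)
      show "\<forall>\<^sub>F n in sequentially. ?r n
        \<le> exp (14 * c0) / ((real n)\<^sup>2 * exp (\<gamma> n)) * max 1 (exp (- (\<gamma> n + \<rho> n)))"
        using ev by eventually_elim (rule p1_large.bounded_parameters(1)[OF _ c0], auto)
    qed simp
    show "?s \<longlonglongrightarrow> 0"
    proof (rule tendsto_sandwich[OF _ _ tendsto_const inverse_ln_tendsto_0[of "exp (4 * c0)"]])
      show "\<forall>\<^sub>F n in sequentially. 0 \<le> ?s n" by (simp add: le_max_iff_disj)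
      show "\<forall>\<^sub>F n in sequentially. ?s n \<le> exp (4 * c0) / ln (real n)"
        using ev by eventually_elim (rule p1_large.bounded_parameters(2)[OF _ c0], auto)
    qed
  qed
qed

end
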